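(* Let $0<q<1$, let $\ell\ge 2$ be an integer and let $N\in\mathbb{Z}$. Let $H_N$ and $D_N$ be the Hilbert space and the Dolbeault--Dirac operator of the D'Andrea--D\k{a}browski spectral triple $(\mathcal{A}(\mathbb{C}\mathrm{P}^\ell_q),H_N,D_N)$ on the quantum projective space $\mathbb{C}\mathrm{P}^\ell_q$, and let $K_{2\rho}^{-1}$ be the inverse of the positive invertible (unbounded) operator on $H_N$ given by the closure of the left action of the element $K_{2\rho}\in \mathrm{U}_q(\mathfrak{su}(\ell+1))$. Then: (1) the operator $K_{2\rho}^{-1}(D_N^2+1)^{-s/2}$ is trace-class for all $s>2\ell$; (2) the corresponding spectral dimension, in the sense of modular spectral triples, is $2\ell$, i.e. $$\inf\big\{s>0:\ \mathrm{Tr}\big(K_{2\rho}^{-1}(D_N^2+1)^{-s/2}\big)<\infty\big\}=2\ell;$$ (3) the limit $$\lim_{s\to 2\ell^+}(s-2\ell)\,\mathrm{Tr}\big(K_{2\rho}^{-1}(D_N^2+1)^{-s/2}\big)$$ exists and is non-zero.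
   Context: For $0<q<1$, $\mathrm{U}_q(\mathfrak{su}(\ell+1))$ is the $*$-algebra generated by $K_i=K_i^*$, $K_i^{-1}$, $E_i$, $F_i=E_i^*$ ($i=1,\dots,\ell$) with relations $[K_i,K_j]=0$; $K_iE_iK_i^{-1}=qE_i$; $K_iE_jK_i^{-1}=q^{-1/2}E_j$ if $|i-j|=1$; $K_iE_jK_i^{-1}=E_j$ if $|i-j|>1$; $[E_i,F_j]=\delta_{ij}\frac{K_i^2-K_i^{-2}}{q-q^{-1}}$; $E_i^2E_j-(q+q^{-1})E_iE_jE_i+E_jE_i^2=0$ if $|i-j|=1$; $[E_i,E_j]=0$ if $|i-j|>1$. Put $$K_{2\rho} = \big(K_1^{\ell}K_2^{2(\ell-1)}\cdots K_j^{j(\ell-j+1)}\cdots K_\ell^{\ell}\big)^2 .$$ For $n=(n_1,\dots,n_\ell)\in\mathbb{N}^\ell$, $V_n$ is the irreducible finite-dimensional $*$-representation $\rho_n$ in which the $K_j$ are positive, with highest weight vector $v$ annihilated by all $E_j$ and $\rho_n(K_i)v=q^{n_i/2}v$. The data $(H_N,D_N)$. For $0\le k\le\ell$, $\Omega^k_N$ is the $q$-analogue of the module of antiholomorphic $k$-forms on $\mathbb{C}\mathrm{P}^\ell$ twisted by a line bundle $\Gamma_N$. $H_N$ is the Hilbert space completion of $\bigoplus_{k=0}^\ell\Omega^k_N$. This space carries a left action of $\mathrm{U}_q(\mathfrak{su}(\ell+1))$ (a $*$-representation with respect to the inner product) and decomposes as an orthogonal direct sum of irreducible representations: $$\Omega^0_N\simeq\bigoplus_{m\in\mathbb{N}}V_{(m+c_1,0,\dots,0,m+c_2)},\qquad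 \Omega^\ell_N\simeq\bigoplus_{m\in\mathbb{N}}V_{(m+c_7,0,\dots,0,m+c_8)},$$ $$\Omega^k_N\simeq\bigoplus_{m\in\mathbb{N}}V_{(m+c_3,0,\dots,0,m+c_4)+e_k}\oplus V_{(m+c_5,0,\dots,0,m+c_6)+e_{k+1}}\qquad (1\le k\le\ell-1),$$ where $e_k$ is the $k$-th standard basis vector of $\mathbb{Z}^\ell$ and $c_1,\dots,c_8$ are non-negative integers depending on $k$ and $N$ but not on $m$. $D_N$ is the self-adjoint unbounded operator on $H_N$ obtained by suitable linear combinations, on each $\Omega^k_N$, of the $q$-Dolbeault operator $\bar\partial:\Omega^k_N\to\Omega^{k+1}_N$ ($\bar\partial^2=0$) and its adjoint $\bar\partial^\dagger$. The following properties of $D_N$, established by D'Andrea and D\k{a}browski, specify it to the extent needed here: $D_N^2$ preserves each $\Omega^k_N$; it acts as a multiple $\lambda^2$ of the identity ($\lambda\ge 0$) on each irreducible summand $V_n$ in the decomposition of $\Omega^k_N$ ($0\le k\le\ell$) into irreducible representations of $\mathrm{U}_q(\mathfrak{su}(\ell+1))$; and, along each of the families of summands indexed by $m\in\mathbb{N}$, namely $V_{(m+c_1,0,\dots,0,m+c_2)}$ in $\Omega^0_N$, $V_{(m+c_3,0,\dots,0,m+c_4)+e_k}$ and $V_{(m+c_5,0,\dots,0,m+c_6)+e_{k+1}}$ in $\Omega^k_N$ for each $1\le k\le\ell-1$, and $V_{(m+c_7,0,\dots,0,m+c_8)}$ in $\Omega^\ell_N$, the eigenvalue $\lambda=\lambda_m$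 of $|D_N|$ satisfies $\lambda_m\sim q^{-m}$, i.e. $\lim_{m\to\infty}\lambda_m q^{m}$ exists and is a non-zero constant. The operator $K_{2\rho}$ on $H_N$ is the closure of the operator acting as $\rho_n(K_{2\rho})$ on each irreducible summand $V_n$; it is positive and invertible and commutes with $D_N^2$; accordingly $K_{2\rho}^{-1}$ acts as $\rho_n(K_{2\rho})^{-1}$ on each summand $V_n$. $\mathrm{Tr}$ is the operator trace on $H_N$. *)

theory Defs
  imports "HOL-Analysis.Analysis"
begin

section \<open>Complex Hilbert spaces\<close>

text \<open>The inner product is conjugate-linear in its first argument.  Norm, metric and topology are
  those of the underlying real Hilbert space, whose inner product is the real part.\<close>

class complex_hilbert_space = real_inner + complete_space +
  fixes scaleC :: "complex \<Rightarrow> 'a \<Rightarrow> 'a"  (infixr \<open>*\<^sub>C\<close> 75)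
    and cinner :: "'a \<Rightarrow> 'a \<Rightarrow> complex"
  assumes scaleC_add_right: "a *\<^sub>C (x + y) = a *\<^sub>C x + a *\<^sub>C y"
    and scaleC_add_left: "(a + b) *\<^sub>C x = a *\<^sub>C x + b *\<^sub>C x"
    and scaleC_scaleC: "a *\<^sub>C b *\<^sub>C x = (a * b) *\<^sub>C x"
    and scaleC_one: "1 *\<^sub>C x = x"
    and scaleR_scaleC: "r *\<^sub>R x = complex_of_real r *\<^sub>C x"
    and cinner_commute: "cinner x y = cnj (cinner y x)"
    and cinner_add_right: "cinner x (y + z) = cinner x y + cinner x z"
    and cinner_scaleC_right: "cinner x (a *\<^sub>C y) = a * cinner x y"
    and inner_eq_Re_cinner: "inner x y = Re (cinner x y)"

interpretation complex_vector: vector_space "scaleC :: complex \<Rightarrow> 'a \<Rightarrow> 'a::complex_hilbert_space"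
  by unfold_locales (rule scaleC_add_right scaleC_add_left scaleC_scaleC scaleC_one)+

abbreviation csubspace :: "'a::complex_hilbert_space set \<Rightarrow> bool"
  where "csubspace \<equiv> module.subspace scaleC"

abbreviation cspan :: "'a::complex_hilbert_space set \<Rightarrow> 'a set"
  where "cspan \<equiv> module.span scaleC"

lemma cinner_add_left:
  "cinner (x + y) z = cinner x z + cinner y (z::'a::complex_hilbert_space)"
  by (metis cinner_add_right cinner_commute complex_cnj_add)

lemma cinner_scaleC_left:
  "cinner (a *\<^sub>C x) y = cnj a * cinner x (y::'a::complex_hilbert_space)"
  by (metis cinner_commute cinner_scaleC_right complex_cnj_mult)

instantiation complex :: complex_hilbert_space
begin

definition scaleC_complex :: "complex \<Rightarrow> complex \<Rightarrow> complex"
  where "scaleC_complex a x = a * x"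

definition cinner_complex :: "complex \<Rightarrow> complex \<Rightarrow> complex"
  where "cinner_complex x y = cnj x * y"

instance
  by intro_classes
    (auto simp: scaleC_complex_def cinner_complex_def algebra_simps scaleR_conv_of_real
      inner_complex_def)

end

instantiation prod :: (complex_hilbert_space, complex_hilbert_space) complex_hilbert_space
begin

definition scaleC_prod :: "complex \<Rightarrow> 'a \<times> 'b \<Rightarrow> 'a \<times> 'b"
  where "scaleC_prod a p = (a *\<^sub>C fst p, a *\<^sub>C snd p)"

definition cinner_prod :: "'a \<times> 'b \<Rightarrow> 'a \<times> 'b \<Rightarrow> complex"
  where "cinner_prod p r = cinner (fst p) (fst r) + cinner (snd p) (snd r)"

instance
proof
  fix x y :: "'a \<times> 'b"
  show "cinner x y = cnj (cinner y x)"
    unfolding cinner_prod_def complex_cnj_add by (metis cinner_commute)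
qed (auto simp: scaleC_prod_def cinner_prod_def scaleC_add_right scaleC_add_left scaleC_scaleC
    scaleC_one scaleR_scaleC scaleR_prod_def cinner_add_right cinner_scaleC_right
    inner_prod_def inner_eq_Re_cinner algebra_simps prod_eq_iff)

end

definition orthonormal_basis :: "'h::complex_hilbert_space set \<Rightarrow> bool" where
  "orthonormal_basis B \<longleftrightarrow>
     (\<forall>e\<in>B. \<forall>f\<in>B. cinner e f = (if e = f then 1 else 0)) \<and> closure (cspan B) = UNIV"


section \<open>Unbounded operators, given by their graphs\<close>

type_synonym 'h operator = "('h \<times> 'h) set"

text \<open>With operators as graphs, the identity is \<open>Id\<close>, the inverse of an injective operator is the
  converse relation, and the closure of a closable operator is the topological closure.\<close>

definition linear_operator :: "'h::complex_hilbert_space operator \<Rightarrow> bool" where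
  "linear_operator T \<longleftrightarrow> csubspace T \<and> single_valued T"

definition op_apply :: "'h operator \<Rightarrow> 'h \<Rightarrow> 'h" where
  "op_apply T x = (THE y. (x, y) \<in> T)"

definition op_add :: "'h::complex_hilbert_space operator \<Rightarrow> 'h operator \<Rightarrow> 'h operator" where
  "op_add S T = {(x, y + z) | x y z. (x, y) \<in> S \<and> (x, z) \<in> T}"

definition op_comp :: "'h operator \<Rightarrow> 'h operator \<Rightarrow> 'h operator" where
  "op_comp S T = T O S"

definition op_adjoint :: "'h::complex_hilbert_space operator \<Rightarrow> 'h operator" where
  "op_adjoint T = {(y, z). \<forall>(x, w)\<in>T. cinner w y = cinner x z}"

definition self_adjoint :: "'h::complex_hilbert_space operator \<Rightarrow> bool" where
  "self_adjoint T \<longleftrightarrow> linear_operator T \<and> closure (Domain T) = UNIV \<and> op_adjoint T = T"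

definition positive_operator :: "'h::complex_hilbert_space operator \<Rightarrow> bool" where
  "positive_operator T \<longleftrightarrow> linear_operator T \<and> (\<forall>(x, y)\<in>T. cinner x y \<in> \<real> \<and> 0 \<le> Re (cinner x y))"

definition bounded_operator :: "'h::complex_hilbert_space operator \<Rightarrow> bool" where
  "bounded_operator T \<longleftrightarrow>
     linear_operator T \<and> Domain T = UNIV \<and> (\<exists>M. \<forall>(x, y)\<in>T. norm y \<le> M * norm x)"

text \<open>Functional calculus \<open>f(A)\<close> for a self-adjoint operator with pure point spectrum, i.e. one whose
  eigenvectors have dense span: the finite linear combinations of eigenvectors are a core of \<open>f(A)\<close>,
  and \<open>f(A)\<close> acts on an eigenvector of eigenvalue \<open>\<mu>\<close> as \<open>f(\<mu>)\<close>.\<close>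

definition pp_calculus ::
  "(real \<Rightarrow> real) \<Rightarrow> 'h::complex_hilbert_space operator \<Rightarrow> 'h operator" where
  "pp_calculus f A = closure (cspan {(x, f \<mu> *\<^sub>R x) | x \<mu>. (x, \<mu> *\<^sub>R x) \<in> A})"

text \<open>\<open>T\<close> is trace-class if it is bounded and \<open>|T|\<close>, the positive square root of \<open>T\<^sup>*T\<close>, has finite
  trace.  Here, and in the two traces below, the choice of the orthonormal basis is immaterial.\<close>

definition trace_class :: "'h::complex_hilbert_space operator \<Rightarrow> bool" where
  "trace_class T \<longleftrightarrow> bounded_operator T \<and>
     (\<exists>P. bounded_operator P \<and> positive_operator P \<and> op_comp P P = op_comp (op_adjoint T) T \<and>
        (\<exists>B. orthonormal_basis B \<and> (\<lambda>e. cinner e (op_apply P e)) summable_on B))"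

definition op_trace :: "'h::complex_hilbert_space operator \<Rightarrow> complex" where
  "op_trace T = (\<Sum>\<^sub>\<infinity>e\<in>(SOME B. orthonormal_basis B). cinner e (op_apply T e))"

text \<open>The \<open>[0,\<infinity>]\<close>-valued trace of a positive self-adjoint operator, infinite if that operator is
  unbounded.\<close>

definition positive_trace :: "'h::complex_hilbert_space operator \<Rightarrow> ennreal" where
  "positive_trace T =
     (if bounded_operator T \<and> positive_operator T
      then (\<Sum>\<^sub>\<infinity>e\<in>(SOME B. orthonormal_basis B). ennreal (Re (cinner e (op_apply T e))))
      else \<infinity>)"

text \<open>\<open>W (D\<^sup>2 + 1)\<^bsup>-s/2\<^esup>\<close> for a weight \<open>W\<close>; \<open>D\<close> is required to have \<open>D\<^sup>2\<close> of pure point spectrum.\<close>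

definition zeta_operator ::
  "'h::complex_hilbert_space operator \<Rightarrow> 'h operator \<Rightarrow> real \<Rightarrow> 'h operator" where
  "zeta_operator W D s =
     op_comp W (pp_calculus (\<lambda>\<mu>. \<mu> powr (- s / 2)) (op_add (op_comp D D) Id))"

definition modular_spectral_dimension ::
  "'h::complex_hilbert_space operator \<Rightarrow> 'h operator \<Rightarrow> real" where
  "modular_spectral_dimension W D = Inf {s. 0 < s \<and> positive_trace (zeta_operator W D s) < \<infinity>}"


section \<open>Representations of \<open>U\<^sub>q(su(l+1))\<close>\<close>

datatype uq_gen = genK nat | genKinv nat | genE nat | genF nat

text \<open>A representation of the algebra presented by generators and relations is a family of linear
  maps, one for each generator, satisfying the relations; a word in the generators then acts as
  \<open>foldr \<rho> w\<close>.  Generator indices range over \<open>1,\<dots>,l\<close>; only the values of \<open>\<rho>\<close> at these indices and on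
  the representation space matter.\<close>

type_synonym 'h uq_action = "uq_gen \<Rightarrow> 'h \<Rightarrow> 'h"

definition uq_gens :: "nat \<Rightarrow> uq_gen set" where
  "uq_gens l = genK ` {1..l} \<union> genKinv ` {1..l} \<union> genE ` {1..l} \<union> genF ` {1..l}"

definition linear_between ::
  "'h::complex_hilbert_space set \<Rightarrow> 'h set \<Rightarrow> ('h \<Rightarrow> 'h) \<Rightarrow> bool" where
  "linear_between V W f \<longleftrightarrow>
     (\<forall>x\<in>V. f x \<in> W) \<and> (\<forall>x\<in>V. \<forall>y\<in>V. f (x + y) = f x + f y) \<and> (\<forall>a. \<forall>x\<in>V. f (a *\<^sub>C x) = a *\<^sub>C f x)"

text \<open>The relations omit those for the \<open>F\<^sub>i\<close> alone and for \<open>K\<^sub>i\<close> with \<open>F\<^sub>j\<close>, which are the adjoints of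
  relations listed here.\<close>

definition uq_relations_on ::
  "real \<Rightarrow> nat \<Rightarrow> 'h::complex_hilbert_space uq_action \<Rightarrow> 'h set \<Rightarrow> bool" where
  "uq_relations_on q l \<rho> V \<longleftrightarrow> (\<forall>x\<in>V. \<forall>i\<in>{1..l}.
     \<rho> (genK i) (\<rho> (genKinv i) x) = x \<and>
     \<rho> (genKinv i) (\<rho> (genK i) x) = x \<and>
     \<rho> (genK i) (\<rho> (genE i) (\<rho> (genKinv i) x)) = q *\<^sub>R \<rho> (genE i) x \<and>
     (\<forall>j\<in>{1..l}.
        \<rho> (genK i) (\<rho> (genK j) x) = \<rho> (genK j) (\<rho> (genK i) x) \<and>
        \<rho> (genE i) (\<rho> (genF j) x) - \<rho> (genF j) (\<rho> (genE i) x) =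
          (if i = j
           then (1 / (q - 1 / q)) *\<^sub>R
                  (\<rho> (genK i) (\<rho> (genK i) x) - \<rho> (genKinv i) (\<rho> (genKinv i) x))
           else 0) \<and>
        (\<bar>int i - int j\<bar> = 1 \<longrightarrow>
           \<rho> (genK i) (\<rho> (genE j) (\<rho> (genKinv i) x)) = (q powr (- 1 / 2)) *\<^sub>R \<rho> (genE j) x \<and>
           \<rho> (genE i) (\<rho> (genE i) (\<rho> (genE j) x))
             - (q + 1 / q) *\<^sub>R \<rho> (genE i) (\<rho> (genE j) (\<rho> (genE i) x))
             + \<rho> (genE j) (\<rho> (genE i) (\<rho> (genE i) x)) = 0) \<and>
        (\<bar>int i - int j\<bar> > 1 \<longrightarrow>
           \<rho> (genK i) (\<rho> (genE j) (\<rho> (genKinv i) x)) = \<rho> (genE j) x \<and>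
           \<rho> (genE i) (\<rho> (genE j) x) = \<rho> (genE j) (\<rho> (genE i) x))))"

text \<open>\<open>*\<close>-representation on a (not necessarily closed) subspace, with \<open>K\<^sub>i\<^sup>* = K\<^sub>i\<close> and \<open>E\<^sub>i\<^sup>* = F\<^sub>i\<close>.\<close>

definition uq_star_rep ::
  "real \<Rightarrow> nat \<Rightarrow> 'h::complex_hilbert_space uq_action \<Rightarrow> 'h set \<Rightarrow> bool" where
  "uq_star_rep q l \<rho> V \<longleftrightarrow> csubspace V \<and>
     (\<forall>g\<in>uq_gens l. linear_between V V (\<rho> g)) \<and>
     uq_relations_on q l \<rho> V \<and>
     (\<forall>i\<in>{1..l}. \<forall>x\<in>V. \<forall>y\<in>V.
        cinner (\<rho> (genK i) x) y = cinner x (\<rho> (genK i) y) \<and>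
        cinner (\<rho> (genE i) x) y = cinner x (\<rho> (genF i) y))"

definition uq_irreducible ::
  "nat \<Rightarrow> 'h::complex_hilbert_space uq_action \<Rightarrow> 'h set \<Rightarrow> bool" where
  "uq_irreducible l \<rho> V \<longleftrightarrow> V \<noteq> {0} \<and>
     (\<forall>W. csubspace W \<and> W \<subseteq> V \<and> (\<forall>g\<in>uq_gens l. \<rho> g ` W \<subseteq> W) \<longrightarrow> W = {0} \<or> W = V)"

text \<open>The subspace \<open>V\<close> is a copy of the irreducible representation \<open>V\<^sub>n\<close>, where only the entries
  \<open>n 1, \<dots>, n l\<close> matter.\<close>

definition uq_highest_weight_irrep ::
  "real \<Rightarrow> nat \<Rightarrow> 'h::complex_hilbert_space uq_action \<Rightarrow> (nat \<Rightarrow> nat) \<Rightarrow> 'h set \<Rightarrow> bool" where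
  "uq_highest_weight_irrep q l \<rho> n V \<longleftrightarrow>
     uq_star_rep q l \<rho> V \<and> (\<exists>S. finite S \<and> V = cspan S) \<and> uq_irreducible l \<rho> V \<and>
     (\<forall>i\<in>{1..l}. \<forall>x\<in>V. 0 \<le> Re (cinner x (\<rho> (genK i) x))) \<and>
     (\<exists>v\<in>V. v \<noteq> 0 \<and>
        (\<forall>i\<in>{1..l}. \<rho> (genE i) v = 0 \<and> \<rho> (genK i) v = (q powr (real (n i) / 2)) *\<^sub>R v))"

definition K2rho :: "nat \<Rightarrow> uq_gen list" where
  "K2rho l =
     (let w = concat (map (\<lambda>j. replicate (j * (l - j + 1)) (genK j)) [1..<l + 1]) in w @ w)"


section \<open>The Dolbeault--Dirac operator\<close>

record 'h dolbeault_data =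
  action :: "'h uq_action"
  forms :: "nat \<Rightarrow> 'h set"
  dbar :: "'h \<Rightarrow> 'h"
  dbar_adj :: "'h \<Rightarrow> 'h"
  dirac :: "'h operator"

definition all_forms :: "nat \<Rightarrow> 'h::complex_hilbert_space dolbeault_data \<Rightarrow> 'h set" where
  "all_forms l X = cspan (\<Union>k\<le>l. forms X k)"

definition summand_index :: "nat \<Rightarrow> (nat \<times> nat \<times> nat) set" where
  "summand_index l =
     {(k, j, m). k \<le> l \<and> (if k = 0 \<or> k = l then j = 0 else j \<le> 1)}"

text \<open>The weight \<open>(m+a, 0, \<dots>, 0, m+b)\<close>, to which \<open>e\<^sub>k\<close> (family \<open>j = 0\<close>) or \<open>e\<^sub>k\<^sub>+\<^sub>1\<close> (family
  \<open>j = 1\<close>) is added in the degrees \<open>0 < k < l\<close>.\<close>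

definition summand_weight :: "nat \<Rightarrow> nat \<Rightarrow> nat \<Rightarrow> nat \<Rightarrow> nat \<Rightarrow> nat \<Rightarrow> nat \<Rightarrow> nat" where
  "summand_weight l k j a b m i =
     (if i = 1 then m + a else 0) + (if i = l then m + b else 0)
     + (if 0 < k \<and> k < l \<and> i = k + j then 1 else 0)"

text \<open>\<open>V (k, j, m)\<close> is the \<open>m\<close>-th summand in the \<open>j\<close>-th family of \<open>\<Omega>\<^sup>k\<close>.\<close>

definition forms_decomposition ::
  "real \<Rightarrow> nat \<Rightarrow> 'h::complex_hilbert_space dolbeault_data \<Rightarrow> (nat \<times> nat \<times> nat \<Rightarrow> 'h set) \<Rightarrow> bool"
  where
  "forms_decomposition q l X V \<longleftrightarrow>
     (\<exists>a b :: nat \<Rightarrow> nat \<Rightarrow> nat. \<forall>(k, j, m)\<in>summand_index l.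
        uq_highest_weight_irrep q l (action X) (summand_weight l k j (a k j) (b k j) m) (V (k, j, m))) \<and>
     (\<forall>t\<in>summand_index l. \<forall>u\<in>summand_index l. t \<noteq> u \<longrightarrow>
        (\<forall>x\<in>V t. \<forall>y\<in>V u. cinner x y = 0)) \<and>
     (\<forall>k\<le>l. forms X k = cspan (\<Union>{V (k, j, m) | j m. (k, j, m) \<in> summand_index l}))"

definition dolbeault_complex :: "nat \<Rightarrow> 'h::complex_hilbert_space dolbeault_data \<Rightarrow> bool" where
  "dolbeault_complex l X \<longleftrightarrow>
     (\<forall>k<l. linear_between (forms X k) (forms X (Suc k)) (dbar X) \<and>
            linear_between (forms X (Suc k)) (forms X k) (dbar_adj X) \<and>
            (\<forall>x\<in>forms X k. \<forall>y\<in>forms X (Suc k). cinner (dbar X x) y = cinner x (dbar_adj X y))) \<and>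
     (\<forall>x\<in>forms X l. dbar X x = 0) \<and> (\<forall>x\<in>forms X 0. dbar_adj X x = 0) \<and>
     (\<forall>k\<le>l. \<forall>x\<in>forms X k. dbar X (dbar X x) = 0)"

text \<open>In the last clause \<open>lam t\<close> is the eigenvalue of \<open>|D|\<close> on the summand \<open>V t\<close>.  That \<open>D\<^sup>2\<close> preserves
  each \<open>\<Omega>\<^sup>k\<close> is contained in its being scalar on the summands.\<close>

definition dolbeault_dirac ::
  "real \<Rightarrow> nat \<Rightarrow> 'h::complex_hilbert_space dolbeault_data \<Rightarrow> bool" where
  "dolbeault_dirac q l X \<longleftrightarrow>
     closure (all_forms l X) = UNIV \<and>
     uq_star_rep q l (action X) (all_forms l X) \<and>
     dolbeault_complex l X \<and>
     self_adjoint (dirac X) \<and>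
     (\<exists>\<alpha> \<beta>. \<forall>k\<le>l. \<forall>x\<in>forms X k. (x, \<alpha> k *\<^sub>C dbar X x + \<beta> k *\<^sub>C dbar_adj X x) \<in> dirac X) \<and>
     (\<exists>V lam. forms_decomposition q l X V \<and>
        (\<forall>t\<in>summand_index l. 0 \<le> lam t \<and>
           (\<forall>x\<in>V t. (x, (lam t)\<^sup>2 *\<^sub>R x) \<in> op_comp (dirac X) (dirac X))) \<and>
        (\<forall>k j. (k, j, 0) \<in> summand_index l \<longrightarrow>
           (\<exists>C. C \<noteq> 0 \<and> (\<lambda>m. lam (k, j, m) * q ^ m) \<longlonglongrightarrow> C)))"

definition K2rho_operator :: "nat \<Rightarrow> 'h::complex_hilbert_space dolbeault_data \<Rightarrow> 'h operator" where
  "K2rho_operator l X = closure {(x, foldr (action X) (K2rho l) x) | x. x \<in> all_forms l X}"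

end

theory Submission
  imports Defs "HOL-Real_Asymp.Real_Asymp" "Jordan_Normal_Form.Determinant"
begin

text \<open>
  \<open>K\<^bsub>2\<rho>\<^esub>\<close> and \<open>D\<^sup>2\<close> are simultaneously diagonal in an orthonormal basis, so the trace is the sum over the
  summands of \<open>(\<lambda>\<^sup>2 + 1)\<^bsup>-s/2\<^esup>\<close> times the trace of \<open>K\<^bsub>2\<rho>\<^esub>\<^sup>-\<^sup>1\<close>.  On the summand with highest
  weight \<open>n\<close> the vectors \<open>F\<^sub>w v\<close> with \<open>w\<close> of length \<open>r\<close> span an eigenspace of \<open>K\<^bsub>2\<rho>\<^esub>\<^sup>-\<^sup>1\<close>
  for the eigenvalue \<open>q\<^sup>2\<^sup>r\<close> times the one on \<open>v\<close>, and that one is \<open>q\<^bsup>-2lm\<^esup>\<close> up to a constant.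
  Let \<open>d\<^sub>m(r)\<close> be the dimension of this eigenspace.

  The Weyl character formula can be avoided.  The Gram matrix of the \<open>F\<^sub>w v\<close> consists, after
  rescaling, of polynomials in \<open>q\<^sup>m\<close>; its minors vanish identically or for finitely many \<open>m\<close> only,
  so \<open>d\<^sub>m(r)\<close> is eventually constant in \<open>m\<close>.  By the quantum Serre relations the \<open>F\<^sub>w\<close> lie in the
  span of ordered monomials in root vectors, so \<open>d\<^sub>m(r)\<close> is bounded by a polynomial in \<open>r\<close>
  uniformly in \<open>m\<close>.  Dominated convergence then gives a positive limit of \<open>\<Sum>\<^sub>r d\<^sub>m(r) q\<^sup>2\<^sup>r\<close>.

  Hence each family of summands contributes \<open>\<Sum>\<^sub>m c\<^sub>m(s) u\<^sup>m\<close> with \<open>u = q\<^bsup>s-2l\<^esup>\<close> and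
  \<open>c\<^sub>m(s)\<close> tending to a positive limit as \<open>m \<rightarrow> \<infinity>\<close> and \<open>s \<rightarrow> 2l\<close>, which behaves like
  a geometric series.
\<close>

section \<open>Orthonormal bases and diagonal operators\<close>

text \<open>Two questions of uniformity shape the argument. The Gram matrices show for each level
  \<open>r\<close> separately that its dimension stabilises, but say nothing about the
  \<open>m\<close> from which on it does, so by themselves they do not justify exchanging the limit
  with the sum over \<open>r\<close>. That takes a bound on all levels independent of
  \<open>m\<close>, and the only decay available is \<open>q ^ (2 * r)\<close>: counting words gives
  \<open>l ^ r\<close>, which is too large when \<open>q\<close> is close to 1, whereas ordered
  monomials in root vectors grow polynomially. Likewise \<open>c\<^sub>m(s)\<close> has to converge
  jointly in \<open>m\<close> and \<open>s\<close>, because \<open>s = 2l\<close> is exactly where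
  the series stops converging.

  On the analytic side, operators are graphs, and both \<open>K2rho_operator\<close> and
  \<open>pp_calculus\<close> are defined as closures. Each is identified with a relation
  \<open>diag_op\<close> between coefficients in one basis, where inverses and products can be
  computed entrywise. The traces, however, are taken in a basis picked by \<open>SOME\<close>, so
  independence of the basis must be established, including in the direction that turns a finite
  trace into summable eigenvalues.\<close>

lemma cinner_0_right [simp]: "cinner (x::'a::complex_hilbert_space) 0 = 0"
  by (metis add_cancel_right_right cinner_add_right)

lemma cinner_0_left [simp]: "cinner 0 (x::'a::complex_hilbert_space) = 0"
  by (metis cinner_0_right cinner_commute complex_cnj_zero)

lemma cinner_scaleR_right: "cinner (x::'a::complex_hilbert_space) (r *\<^sub>R y) = of_real r * cinner x y"
  by (simp add: scaleR_scaleC cinner_scaleC_right)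

lemma cinner_scaleR_left: "cinner (r *\<^sub>R x) (y::'a::complex_hilbert_space) = of_real r * cinner x y"
  by (simp add: scaleR_scaleC cinner_scaleC_left)

lemma cinner_minus_right: "cinner (x::'a::complex_hilbert_space) (- y) = - cinner x y"
  using cinner_scaleR_right[of x "-1" y] by simp

lemma cinner_diff_right: "cinner (x::'a::complex_hilbert_space) (y - z) = cinner x y - cinner x z"
  using cinner_add_right[of x y "- z"] by (simp add: cinner_minus_right)

lemma cinner_diff_left: "cinner (x - y) (z::'a::complex_hilbert_space) = cinner x z - cinner y z"
  by (metis cinner_commute cinner_diff_right complex_cnj_diff)

lemma cinner_sum_right: "cinner (x::'a::complex_hilbert_space) (sum f A) = (\<Sum>i\<in>A. cinner x (f i))"
  by (induction A rule: infinite_finite_induct) (auto simp: cinner_add_right)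

lemma cinner_self: "cinner (x::'a::complex_hilbert_space) x = of_real ((norm x)\<^sup>2)"
proof -
  have "Im (cinner x x) = 0"
    using arg_cong[OF cinner_commute[of x x], of Im] by simp
  moreover have "Re (cinner x x) = (norm x)\<^sup>2"
    by (metis inner_eq_Re_cinner power2_norm_eq_inner)
  ultimately show ?thesis by (simp add: complex_eq_iff)
qed

lemma norm_scaleC: "norm (a *\<^sub>C (x::'a::complex_hilbert_space)) = cmod a * norm x"
proof -
  have "complex_of_real ((norm (a *\<^sub>C x))\<^sup>2) = (cnj a * a) * cinner x x"
    unfolding cinner_self[symmetric] by (simp add: cinner_scaleC_left cinner_scaleC_right)
  also have "\<dots> = of_real ((cmod a)\<^sup>2 * (norm x)\<^sup>2)"
    by (simp add: cinner_self mult.commute[of "cnj a"] flip: complex_norm_square)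
  finally have "(norm (a *\<^sub>C x))\<^sup>2 = (cmod a * norm x)\<^sup>2"
    by (simp only: of_real_eq_iff power_mult_distrib)
  then show ?thesis
    by (simp add: power2_eq_imp_eq)
qed

text \<open>The Cauchy-Schwarz inequality of the underlying real space bounds only the real part;
  the unimodular factor \<open>a\<close> rotates \<open>cinner x y\<close> onto its modulus.\<close>

lemma cmod_cinner_le: "cmod (cinner x y) \<le> norm x * norm (y::'a::complex_hilbert_space)"
proof (cases "cinner x y = 0")
  case False
  define a where "a = cnj (cinner x y) / cmod (cinner x y)"
  have "cmod a = 1" using False by (simp add: a_def norm_divide)
  have "cmod (cinner x y) = Re (cinner x (a *\<^sub>C y))"
    using False by (simp add: a_def cinner_scaleC_right complex_norm_square[symmetric] mult.commute
        power2_eq_square complex_norm_square[symmetric] flip: of_real_mult)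
  also have "\<dots> \<le> norm x * norm (a *\<^sub>C y)"
    by (metis inner_eq_Re_cinner norm_cauchy_schwarz)
  finally show ?thesis by (simp add: norm_scaleC \<open>cmod a = 1\<close>)
qed auto

lemma bounded_linear_cinner_right: "bounded_linear (cinner (x::'a::complex_hilbert_space))"
  by (rule bounded_linear_intro[of _ "norm x"])
    (simp_all add: cinner_add_right cinner_scaleR_right scaleR_conv_of_real
      cmod_cinner_le[of x, unfolded mult.commute[of "norm x"]])

lemmas continuous_on_cinner_right [continuous_intros] =
  bounded_linear.continuous_on[OF bounded_linear_cinner_right]

lemma csubspace_Collect_cinner:
  "csubspace {x. \<forall>e\<in>E. cinner e x = 0}"
  by (auto simp: complex_vector.subspace_def cinner_add_right cinner_scaleC_right)

lemma cinner_eq_0_dense: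
  fixes z :: "'a::complex_hilbert_space"
  assumes "closure (cspan B) = UNIV" and "\<And>e. e \<in> B \<Longrightarrow> cinner e z = 0"
  shows "z = 0"
proof -
  have "cspan B \<subseteq> {x. \<forall>e\<in>{z}. cinner e x = 0}"
  proof (rule complex_vector.span_minimal[OF _ csubspace_Collect_cinner], clarsimp)
    fix x assume "x \<in> B"
    then show "cinner z x = 0" using assms(2)[of x] cinner_commute[of z x] by simp
  qed
  then have "closure (cspan B) \<subseteq> {x. cinner z x = 0}"
    by (intro closure_minimal) (auto intro!: closed_Collect_eq continuous_intros)
  then have "cinner z z = 0" using assms(1) by auto
  then show ?thesis by (simp add: cinner_self)
qed

section \<open>Finite projections and expansion in an orthonormal basis\<close>

definition orthonormal_set :: "'a::complex_hilbert_space set \<Rightarrow> bool" where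
  "orthonormal_set B \<longleftrightarrow> (\<forall>e\<in>B. \<forall>f\<in>B. cinner e f = (if e = f then 1 else 0))"

text \<open>For a finite orthonormal \<open>S\<close> this is the orthogonal projection onto its
  span.\<close>

definition oproj :: "'a::complex_hilbert_space set \<Rightarrow> 'a \<Rightarrow> 'a" where
  "oproj S x = (\<Sum>e\<in>S. cinner e x *\<^sub>C e)"

lemma cinner_oproj:
  assumes "orthonormal_set B" "finite S" "S \<subseteq> B" "e \<in> B"
  shows "cinner e (oproj S x) = (if e \<in> S then cinner e x else 0)"
proof -
  have "cinner e (oproj S x) = (\<Sum>f\<in>S. cinner f x * cinner e f)"
    by (simp add: oproj_def cinner_sum_right cinner_scaleC_right)
  also have "\<dots> = (\<Sum>f\<in>S. if f = e then cinner e x else 0)"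
    using assms by (intro sum.cong) (auto simp: orthonormal_set_def)
  finally show ?thesis using assms by simp
qed

lemma oproj_in_span: "oproj S x \<in> cspan S"
  unfolding oproj_def
  by (intro complex_vector.span_sum complex_vector.span_scale complex_vector.span_base)

lemma cinner_oproj_orth:
  assumes "orthonormal_set S" "finite S" "y \<in> cspan S"
  shows "cinner y (x - oproj S x) = 0"
proof -
  have "cspan S \<subseteq> {y. \<forall>e\<in>{x - oproj S x}. cinner e y = 0}"
  proof (rule complex_vector.span_minimal[OF _ csubspace_Collect_cinner], clarsimp)
    fix e assume "e \<in> S"
    then have "cinner e (x - oproj S x) = 0"
      using cinner_oproj[OF assms(1,2) order_refl] by (simp add: cinner_diff_right)
    then show "cinner (x - oproj S x) e = 0" by (metis cinner_commute complex_cnj_zero)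
  qed
  then have "cinner (x - oproj S x) y = 0" using assms(3) by auto
  then show ?thesis by (metis cinner_commute complex_cnj_zero)
qed

lemma pythagoras:
  assumes "cinner x y = 0"
  shows "(norm (x + y))\<^sup>2 = (norm x)\<^sup>2 + (norm (y::'a::complex_hilbert_space))\<^sup>2"
proof -
  have "cinner y x = 0" using assms by (metis cinner_commute complex_cnj_zero)
  then have "cinner (x + y) (x + y) = cinner x x + cinner y y"
    using assms by (simp add: cinner_add_left cinner_add_right)
  then show ?thesis unfolding cinner_self by (metis of_real_add of_real_eq_iff)
qed

lemma oproj_best:
  assumes "orthonormal_set S" "finite S" "y \<in> cspan S"
  shows "norm (x - oproj S x) \<le> norm (x - y)"
proof -
  have "oproj S x - y \<in> cspan S"
    by (intro complex_vector.span_diff oproj_in_span assms)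
  then have "cinner (oproj S x - y) (x - oproj S x) = 0"
    using cinner_oproj_orth assms by blast
  from pythagoras[OF this] have "(norm (x - oproj S x))\<^sup>2 \<le> (norm (x - y))\<^sup>2" by simp
  then show ?thesis by (rule power2_le_imp_le) simp
qed

lemma orthonormal_set_subset: "orthonormal_set B \<Longrightarrow> S \<subseteq> B \<Longrightarrow> orthonormal_set S"
  by (simp add: orthonormal_set_def subset_iff)

text \<open>Density provides one finite combination near \<open>x\<close>; by best approximation
  every larger finite set of basis vectors projects \<open>x\<close> at least as close. That is
  convergence along the net of finite subsets, so the basis may have any cardinality.\<close>

lemma has_sum_oproj:
  assumes "orthonormal_basis B"
  shows "((\<lambda>e. cinner e x *\<^sub>C e) has_sum x) B"
proof -
  have on: "orthonormal_set B" and dense: "closure (cspan B) = UNIV"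
    using assms by (auto simp: orthonormal_basis_def orthonormal_set_def)
  have "((\<lambda>S. oproj S x) \<longlongrightarrow> x) (finite_subsets_at_top B)"
  proof (rule tendstoI)
    fix \<epsilon> :: real assume "\<epsilon> > 0"
    then obtain y where y: "y \<in> cspan B" "dist y x < \<epsilon>"
      using dense closure_approachable[of x "cspan B"] by auto
    obtain T where T: "finite T" "T \<subseteq> B" "y \<in> cspan T"
    proof -
      obtain t c where t: "finite t" "t \<subseteq> B" "y = (\<Sum>a\<in>t. c a *\<^sub>C a)"
        using y(1) unfolding complex_vector.span_explicit by blast
      then have "y \<in> cspan t"
        by (auto intro: complex_vector.span_sum complex_vector.span_scale complex_vector.span_base)
      with t show ?thesis using that by blast
    qed
    have "dist (oproj S x) x < \<epsilon>" if "finite S" "T \<subseteq> S" "S \<subseteq> B" for S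
    proof -
      have "y \<in> cspan S" using T(3) complex_vector.span_mono[OF that(2)] by auto
      then have "norm (x - oproj S x) \<le> norm (x - y)"
        using oproj_best orthonormal_set_subset[OF on] that by blast
      then show ?thesis using y(2) by (simp add: dist_norm norm_minus_commute)
    qed
    then show "\<forall>\<^sub>F S in finite_subsets_at_top B. dist (oproj S x) x < \<epsilon>"
      using T unfolding eventually_finite_subsets_at_top by blast
  qed
  then show ?thesis by (simp add: has_sum_def oproj_def)
qed

lemma has_sum_cinner:
  assumes "orthonormal_basis B"
  shows "((\<lambda>e. cinner e y * cinner x e) has_sum cinner x y) B"
  using has_sum_bounded_linear[OF bounded_linear_cinner_right has_sum_oproj[OF assms], of x y]
  by (simp add: o_def cinner_scaleC_right)

lemma has_sum_parseval:
  assumes "orthonormal_basis B"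
  shows "((\<lambda>e. (cmod (cinner e x))\<^sup>2) has_sum (norm x)\<^sup>2) B"
proof -
  have "((\<lambda>e. Re (cinner e x * cinner x e)) has_sum Re (cinner x x)) B"
    using has_sum_bounded_linear[OF bounded_linear_Re has_sum_cinner[OF assms]] by (simp add: o_def)
  moreover have "Re (cinner e x * cinner x e) = (cmod (cinner e x))\<^sup>2" for e
    using cinner_commute[of x e] by (simp add: complex_mult_cnj cmod_power2)
  ultimately show ?thesis by (simp add: cinner_self)
qed

text \<open>For an orthonormal basis, the operator with eigenvalue \<open>z e\<close> on
  \<open>e\<close>, on its maximal domain. A condition on coefficients makes closedness immediate
  and leaves no domain to specify: \<open>x\<close> is in the domain as soon as some
  \<open>y\<close> has the right coefficients.\<close>

definition diag_op :: "'a set \<Rightarrow> ('a \<Rightarrow> real) \<Rightarrow> 'a::complex_hilbert_space operator" where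
  "diag_op B z = {(x, y). \<forall>e\<in>B. cinner e y = of_real (z e) * cinner e x}"

lemma csubspace_diag_op: "csubspace (diag_op B z)"
proof (rule complex_vector.subspaceI)
  show "0 \<in> diag_op B z" by (simp add: diag_op_def zero_prod_def)
  show "p + r \<in> diag_op B z" if "p \<in> diag_op B z" "r \<in> diag_op B z" for p r
    using that by (auto simp: diag_op_def cinner_add_right distrib_left)
  show "c *\<^sub>C p \<in> diag_op B z" if "p \<in> diag_op B z" for c p
    using that by (auto simp: diag_op_def scaleC_prod_def cinner_scaleC_right mult.left_commute)
qed

lemma closed_diag_op: "closed (diag_op B z)"
proof -
  have "diag_op B z = (\<Inter>e\<in>B. {p. cinner e (snd p) = of_real (z e) * cinner e (fst p)})"
    by (auto simp: diag_op_def)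
  also have "closed \<dots>"
    by (intro closed_INT ballI closed_Collect_eq continuous_intros)
  finally show ?thesis .
qed

lemma diag_op_unique:
  assumes "orthonormal_basis B" "(x, y) \<in> diag_op B z" "(x, y') \<in> diag_op B z"
  shows "y = y'"
  using cinner_eq_0_dense[of B "y - y'"] assms
  by (auto simp: orthonormal_basis_def diag_op_def cinner_diff_right)

lemma linear_operator_diag_op:
  assumes "orthonormal_basis B"
  shows "linear_operator (diag_op B z)"
  unfolding linear_operator_def
proof
  show "single_valued (diag_op B z)"
    by (rule single_valuedI) (rule diag_op_unique[OF assms])
qed (rule csubspace_diag_op)

lemma diag_op_basis:
  assumes "orthonormal_basis B" "e \<in> B"
  shows "(e, z e *\<^sub>R e) \<in> diag_op B z"
  using assms by (auto simp: diag_op_def orthonormal_basis_def cinner_scaleR_right)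

text \<open>The finite combinations of basis vectors form a core: projecting both components of a
  pair to the same finite set of basis vectors gives pairs in the span that converge to it. This
  connects \<open>diag_op\<close> with the operators defined as closures.\<close>

lemma diag_op_eq_closure:
  assumes B: "orthonormal_basis B"
  shows "diag_op B z = closure (cspan {(e, z e *\<^sub>R e) | e. e \<in> B})"
proof
  show "closure (cspan {(e, z e *\<^sub>R e) | e. e \<in> B}) \<subseteq> diag_op B z"
    using diag_op_basis[OF B]
    by (intro closure_minimal complex_vector.span_minimal csubspace_diag_op closed_diag_op) auto
next
  show "diag_op B z \<subseteq> closure (cspan {(e, z e *\<^sub>R e) | e. e \<in> B})" (is "_ \<subseteq> closure ?C")
  proof clarify
    fix x y assume xy: "(x, y) \<in> diag_op B z"
    have "((\<lambda>S. (oproj S x, oproj S y)) \<longlongrightarrow> (x, y)) (finite_subsets_at_top B)"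
      using has_sum_oproj[OF B, of x] has_sum_oproj[OF B, of y]
      by (intro tendsto_Pair) (simp_all add: has_sum_def oproj_def)
    moreover have "\<forall>\<^sub>F S in finite_subsets_at_top B. (oproj S x, oproj S y) \<in> closure ?C"
    proof (rule eventually_finite_subsets_at_top_weakI)
      fix S assume S: "finite S" "S \<subseteq> B"
      have "(oproj S x, oproj S y) = (\<Sum>e\<in>S. cinner e x *\<^sub>C (e, z e *\<^sub>R e))"
        using S xy by (auto simp: oproj_def diag_op_def scaleC_prod_def scaleR_scaleC scaleC_scaleC
            subset_iff mult.commute fst_sum snd_sum intro!: prod_eqI sum.cong
            arg_cong2[of _ _ _ _ scaleC])
      also have "\<dots> \<in> ?C"
        using S by (intro complex_vector.span_sum complex_vector.span_scale complex_vector.span_base) auto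
      finally show "(oproj S x, oproj S y) \<in> closure ?C"
        using closure_subset by blast
    qed
    ultimately show "(x, y) \<in> closure ?C"
      by (intro Lim_in_closed_set[OF closed_closure]) auto
  qed
qed

lemma norm_diag_op_le:
  assumes B: "orthonormal_basis B" and z: "\<And>e. e \<in> B \<Longrightarrow> \<bar>z e\<bar> \<le> M"
    and xy: "(x, y) \<in> diag_op B z"
  shows "norm y \<le> M * norm x"
\<comment> \<open>An empty basis means a trivial space, and then the hypothesis on \<open>M\<close>
  is vacuous, so \<open>M\<close> might be negative.\<close>
proof (cases "B = {}")
  case True
  then have "y = 0" using has_sum_oproj[OF B, of y] by (simp add: has_sum_finite_iff)
  moreover have "x = 0" using True has_sum_oproj[OF B, of x] by (simp add: has_sum_finite_iff)
  ultimately show ?thesis by simp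
next
  case False
  then have M: "0 \<le> M" using z by force
  have "(norm y)\<^sup>2 \<le> M\<^sup>2 * (norm x)\<^sup>2"
  proof (rule has_sum_mono[OF has_sum_parseval[OF B] has_sum_cmult_right[OF has_sum_parseval[OF B]]])
    fix e assume e: "e \<in> B"
    then have "cmod (cinner e y) = \<bar>z e\<bar> * cmod (cinner e x)"
      using xy by (auto simp: diag_op_def norm_mult)
    moreover have "(\<bar>z e\<bar> * cmod (cinner e x))\<^sup>2 \<le> (M * cmod (cinner e x))\<^sup>2"
      using z[OF e] by (intro power_mono mult_right_mono) auto
    ultimately show "(cmod (cinner e y))\<^sup>2 \<le> M\<^sup>2 * (cmod (cinner e x))\<^sup>2"
      by (simp add: power_mult_distrib)
  qed
  then have "(norm y)\<^sup>2 \<le> (M * norm x)\<^sup>2" by (simp add: power_mult_distrib)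
  then show ?thesis using M by (meson norm_ge_zero power2_le_imp_le zero_le_mult_iff)
qed

text \<open>The image of \<open>x\<close> is obtained by completeness: along finite projections
  converging to \<open>x\<close> the images are Cauchy by \<open>norm_diag_op_le\<close>, and the
  graph is closed. The projections are first thinned out to a sequence, since convergence in
  \<open>has_sum\<close> is along a net.\<close>

lemma Domain_diag_op:
  assumes B: "orthonormal_basis B" and z: "\<And>e. e \<in> B \<Longrightarrow> \<bar>z e\<bar> \<le> M"
  shows "Domain (diag_op B z) = UNIV"
proof -
  have "\<exists>y. (x, y) \<in> diag_op B z" for x
  proof -
    have "\<exists>S. finite S \<and> S \<subseteq> B \<and> dist (oproj S x) x < \<epsilon>" if "\<epsilon> > 0" for \<epsilon>
      using tendstoD[OF has_sum_oproj[OF B, of x, unfolded has_sum_def] that]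
      unfolding eventually_finite_subsets_at_top oproj_def by blast
    then have "\<forall>n. \<exists>S. finite S \<and> S \<subseteq> B \<and> dist (oproj S x) x < inverse (real (Suc n))"
      by simp
    then obtain S where S: "\<And>n. finite (S n)" "\<And>n. S n \<subseteq> B"
      "\<And>n. dist (oproj (S n) x) x < inverse (real (Suc n))"
      by metis
    have x: "(\<lambda>n. oproj (S n) x) \<longlonglongrightarrow> x"
    proof -
      have "norm (dist (oproj (S n) x) x) \<le> inverse (real (Suc n))" for n
        using S(3)[of n] by simp
      then have "(\<lambda>n. dist (oproj (S n) x) x) \<longlonglongrightarrow> 0"
        by (intro Lim_null_comparison[OF _ LIMSEQ_inverse_real_of_nat] always_eventually allI)
      then show ?thesis by (subst tendsto_dist_iff)
    qed
    define y where "y n = (\<Sum>e\<in>S n. cinner e x *\<^sub>C z e *\<^sub>R e)" for n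
    have xy: "(oproj (S n) x, y n) \<in> diag_op B z" for n
    proof -
      have "(oproj (S n) x, y n) = (\<Sum>e\<in>S n. cinner e x *\<^sub>C (e, z e *\<^sub>R e))"
        by (auto simp: oproj_def y_def scaleC_prod_def fst_sum snd_sum intro!: prod_eqI)
      then show ?thesis
        using S(2) diag_op_basis[OF B]
        by (auto intro!: complex_vector.subspace_sum complex_vector.subspace_scale csubspace_diag_op)
    qed
    have "Cauchy y"
    proof (rule metric_CauchyI)
      fix \<epsilon> :: real assume "\<epsilon> > 0"
      moreover have "\<bar>M\<bar> + 1 > 0" by auto
      ultimately have "\<epsilon> / (\<bar>M\<bar> + 1) > 0" by simp
      from metric_CauchyD[OF LIMSEQ_imp_Cauchy[OF x] this] obtain N where
        N: "\<And>m n. m \<ge> N \<Longrightarrow> n \<ge> N \<Longrightarrow> dist (oproj (S m) x) (oproj (S n) x) < \<epsilon> / (\<bar>M\<bar> + 1)"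
        by blast
      have "dist (y m) (y n) < \<epsilon>" if "m \<ge> N" "n \<ge> N" for m n
      proof -
        have "(oproj (S m) x - oproj (S n) x, y m - y n) \<in> diag_op B z"
          using complex_vector.subspace_diff[OF csubspace_diag_op xy[of m] xy[of n]] by simp
        moreover have "\<bar>z e\<bar> \<le> \<bar>M\<bar> + 1" if "e \<in> B" for e using z[OF that] by linarith
        ultimately have "dist (y m) (y n) \<le> (\<bar>M\<bar> + 1) * dist (oproj (S m) x) (oproj (S n) x)"
          unfolding dist_norm by (intro norm_diag_op_le[OF B]) auto
        also have "\<dots> < \<epsilon>"
          using N[OF that] by (simp add: field_simps)
        finally show ?thesis .
      qed
      then show "\<exists>N. \<forall>m\<ge>N. \<forall>n\<ge>N. dist (y m) (y n) < \<epsilon>" by blast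
    qed
    then obtain l where "y \<longlonglongrightarrow> l" by (auto simp: Cauchy_convergent_iff convergent_def)
    with x have "(\<lambda>n. (oproj (S n) x, y n)) \<longlonglongrightarrow> (x, l)" by (rule tendsto_Pair)
    then have "(x, l) \<in> diag_op B z"
      by (rule closed_sequentially[OF closed_diag_op xy])
    then show ?thesis by blast
  qed
  then show ?thesis by auto
qed

lemma bounded_operator_diag_op:
  assumes "orthonormal_basis B" "\<And>e. e \<in> B \<Longrightarrow> \<bar>z e\<bar> \<le> M"
  shows "bounded_operator (diag_op B z)"
  unfolding bounded_operator_def
  using linear_operator_diag_op[OF assms(1)] Domain_diag_op[of B z, OF assms]
    norm_diag_op_le[of B z, OF assms] by blast

lemma op_apply_diag_op:
  assumes "orthonormal_basis B" "(x, y) \<in> diag_op B z"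
  shows "op_apply (diag_op B z) x = y"
  unfolding op_apply_def using assms diag_op_unique[OF assms(1)] by (intro the_equality)

text \<open>Testing against basis vectors alone already fixes the coefficients of a pair in the
  adjoint. Conversely, both inner products have the same Parseval expansion because \<open>z\<close>
  is real.\<close>

lemma op_adjoint_diag_op:
  assumes B: "orthonormal_basis B"
  shows "op_adjoint (diag_op B z) = diag_op B z"
proof (intro equalityI subrelI)
  fix y w assume yw: "(y, w) \<in> op_adjoint (diag_op B z)"
  have "cinner e w = of_real (z e) * cinner e y" if e: "e \<in> B" for e
  proof -
    have "cinner (z e *\<^sub>R e) y = cinner e w"
      using yw diag_op_basis[OF B e] unfolding op_adjoint_def by blast
    then show ?thesis by (simp add: cinner_scaleR_left)
  qed
  then show "(y, w) \<in> diag_op B z" by (simp add: diag_op_def)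
next
  fix y w assume yw: "(y, w) \<in> diag_op B z"
  have "cinner x' y = cinner x w" if x: "(x, x') \<in> diag_op B z" for x x'
  proof (rule has_sum_unique[OF has_sum_cinner[OF B]])
    have "cinner e w * cinner x e = cinner e y * cinner x' e" if e: "e \<in> B" for e
    proof -
      have "cinner x' e = of_real (z e) * cinner x e"
        using x e cinner_commute[of x' e] cinner_commute[of x e] by (simp add: diag_op_def)
      then show ?thesis using yw e by (simp add: diag_op_def)
    qed
    then show "((\<lambda>e. cinner e y * cinner x' e) has_sum cinner x w) B"
      using has_sum_cinner[OF B, of w x] by (subst (asm) has_sum_cong) auto
  qed
  then show "(y, w) \<in> op_adjoint (diag_op B z)" by (auto simp: op_adjoint_def)
qed

lemma has_sum_diag_op_form:
  assumes B: "orthonormal_basis B" and xy: "(x, y) \<in> diag_op B z"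
  shows "((\<lambda>e. z e * (cmod (cinner e x))\<^sup>2) has_sum Re (cinner x y)) B"
    and "cinner x y \<in> \<real>"
proof -
  have "((\<lambda>e. complex_of_real (z e * (cmod (cinner e x))\<^sup>2)) has_sum cinner x y) B"
    using has_sum_cinner[OF B, of y x]
  proof (subst (asm) has_sum_cong)
    fix e assume e: "e \<in> B"
    have "cinner e x * cinner x e = of_real ((cmod (cinner e x))\<^sup>2)"
      using cinner_commute[of x e] by (simp add: complex_norm_square del: of_real_power)
    then show "cinner e y * cinner x e = of_real (z e * (cmod (cinner e x))\<^sup>2)"
      using xy e by (simp add: diag_op_def mult.assoc)
  qed
  from has_sum_bounded_linear[OF bounded_linear_Re this] has_sum_bounded_linear[OF bounded_linear_Im this]
  show "((\<lambda>e. z e * (cmod (cinner e x))\<^sup>2) has_sum Re (cinner x y)) B" "cinner x y \<in> \<real>"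
    by (auto simp: o_def complex_is_Real_iff dest: infsumI)
qed

lemma positive_operator_diag_op:
  assumes B: "orthonormal_basis B" and "\<And>e. e \<in> B \<Longrightarrow> 0 \<le> z e"
  shows "positive_operator (diag_op B z)"
proof -
  have "0 \<le> Re (cinner x y)" if "(x, y) \<in> diag_op B z" for x y
    using has_sum_diag_op_form(1)[OF B that] by (rule has_sum_nonneg) (simp add: assms(2))
  then show ?thesis
    unfolding positive_operator_def
    using linear_operator_diag_op[OF B] has_sum_diag_op_form(2)[OF B] by auto
qed

text \<open>Exchange of summation for the non-negative array
  \<open>z e * (cmod (cinner e e'))\<^sup>2\<close>: summed over \<open>e\<close> it gives the
  diagonal entry at \<open>e'\<close>, summed over \<open>e'\<close> it gives \<open>z e\<close> by
  Parseval. Both directions are recorded, one for computing traces and one for detecting divergence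
  in the basis picked by \<open>SOME\<close>.\<close>

lemma
  assumes B: "orthonormal_basis B" and B': "orthonormal_basis B'"
    and z: "\<And>e. e \<in> B \<Longrightarrow> 0 \<le> z e" "\<And>e. e \<in> B \<Longrightarrow> z e \<le> M"
  shows has_sum_trace_diag_op: "z summable_on B \<Longrightarrow>
      ((\<lambda>e. Re (cinner e (op_apply (diag_op B z) e))) has_sum infsum z B) B'"
    and summable_on_trace_diag_op: "(\<lambda>e. Re (cinner e (op_apply (diag_op B z) e))) summable_on B' \<Longrightarrow>
      z summable_on B"
    and trace_diag_op_Re: "\<And>x. cinner x (op_apply (diag_op B z) x)
       = of_real (Re (cinner x (op_apply (diag_op B z) x)))"
    and trace_diag_op_nonneg: "\<And>x. Re (cinner x (op_apply (diag_op B z) x)) \<ge> 0"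
proof -
  let ?h = "\<lambda>e. Re (cinner e (op_apply (diag_op B z) e))"
  define f where "f = (\<lambda>(e', e). z e * (cmod (cinner e e'))\<^sup>2)"
  have "\<bar>z e\<bar> \<le> M" if "e \<in> B" for e using z that by fastforce
  from Domain_diag_op[of B z, OF B this]
  have app: "(x, op_apply (diag_op B z) x) \<in> diag_op B z" for x
    using op_apply_diag_op[OF B] by (metis Domain.cases UNIV_I)
  show "cinner x (op_apply (diag_op B z) x) = of_real (?h x)" for x
    using has_sum_diag_op_form(2)[OF B app] by simp
  have row: "((\<lambda>e. f (x, e)) has_sum ?h x) B" for x
    using has_sum_diag_op_form(1)[OF B app] by (simp add: f_def)
  then show "?h x \<ge> 0" for x
    by (rule has_sum_nonneg) (simp add: f_def z)
  have col: "((\<lambda>e'. f (e', e)) has_sum z e) B'" if e: "e \<in> B" for e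
  proof -
    have "cmod (cinner e e') = cmod (cinner e' e)" for e'
      by (metis cinner_commute complex_mod_cnj)
    moreover have "norm e = 1"
    proof -
      have "cinner e e = 1" using B e by (auto simp: orthonormal_basis_def)
      then show ?thesis using norm_ge_zero[of e]
        by (auto simp: cinner_self power2_eq_1_iff simp flip: of_real_power)
    qed
    ultimately show ?thesis
      using has_sum_cmult_right[OF has_sum_parseval[OF B', of e], of "z e"] by (simp add: f_def)
  qed
  have f0: "f (e', e) \<ge> 0" if "e \<in> B" for e e' using z that by (simp add: f_def)
  show "(?h has_sum infsum z B) B'" if "z summable_on B"
  proof -
    have "(\<lambda>(e, e'). f (e', e)) summable_on B \<times> B'"
      using col that f0 by (intro summable_on_SigmaI[where g = z]) auto
    then have sw: "f summable_on B' \<times> B" by (subst summable_on_swap) simp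
    have "infsum ?h B' = infsum (\<lambda>e'. infsum (\<lambda>e. f (e', e)) B) B'"
      using row by (intro infsum_cong) (metis infsumI)
    also have "\<dots> = infsum (\<lambda>e. infsum (\<lambda>e'. f (e', e)) B') B"
      using sw by (intro infsum_swap_banach) simp
    also have "\<dots> = infsum z B"
      using col by (intro infsum_cong) (metis infsumI)
    finally have "infsum ?h B' = infsum z B" .
    moreover have "(\<lambda>e'. infsum (\<lambda>e. f (e', e)) B) summable_on B'"
      using sw by (intro summable_on_Sigma_banach) simp
    then have "?h summable_on B'" by (simp add: infsumI[OF row])
    ultimately show ?thesis using has_sum_infsum by force
  qed
  show "z summable_on B" if "?h summable_on B'"
  proof -
    have "f summable_on B' \<times> B"
      using row that f0 by (intro summable_on_SigmaI[where g = ?h]) auto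
    then have "(\<lambda>(e, e'). f (e', e)) summable_on B \<times> B'" by (subst (asm) summable_on_swap) simp
    then have "(\<lambda>e. infsum (\<lambda>e'. f (e', e)) B') summable_on B"
      by (intro summable_on_Sigma_banach) simp
    also have "?this \<longleftrightarrow> ?thesis" using col by (intro summable_on_cong) (metis infsumI)
    finally show ?thesis .
  qed
qed

lemma nonneg_summable_on_le_infsum:
  fixes z :: "'a \<Rightarrow> real"
  assumes "z summable_on B" "\<And>e. e \<in> B \<Longrightarrow> 0 \<le> z e" "e \<in> B"
  shows "z e \<le> infsum z B"
  using finite_sum_le_infsum[OF assms(1), of "{e}"] assms by auto

lemma
  assumes B: "orthonormal_basis B" and z: "\<And>e. e \<in> B \<Longrightarrow> 0 \<le> z e" and sum: "z summable_on B"
  shows trace_class_diag_op: "trace_class (diag_op B z)"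
    and op_trace_diag_op: "op_trace (diag_op B z) = of_real (infsum z B)"
    and positive_trace_diag_op: "positive_trace (diag_op B z) < \<infinity>"
proof -
  note le = nonneg_summable_on_le_infsum[OF sum z]
  have bd: "bounded_operator (diag_op B z)"
    using bounded_operator_diag_op[OF B, of z "infsum z B"] le z by (simp add: abs_of_nonneg)
  have pos: "positive_operator (diag_op B z)" by (rule positive_operator_diag_op[of B z, OF B z])
  have some: "orthonormal_basis (SOME B::'a set. orthonormal_basis B)" using B by (rule someI)
  have hs: "((\<lambda>e. Re (cinner e (op_apply (diag_op B z) e))) has_sum infsum z B) B'"
    if "orthonormal_basis B'" for B'
    using has_sum_trace_diag_op[of B _ z, OF B that z le sum] .
  have hc: "((\<lambda>e. cinner e (op_apply (diag_op B z) e)) has_sum of_real (infsum z B)) B'"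
    if "orthonormal_basis B'" for B'
    using has_sum_bounded_linear[OF bounded_linear_of_real[where 'a=complex] hs[OF that]]
    by (simp add: o_def trace_diag_op_Re[of B _ z, OF B that z le, symmetric])
  \<comment> \<open>A self-adjoint operator with non-negative eigenvalues is its own modulus, so it
    serves as its own witness \<open>P\<close>.\<close>
  show "trace_class (diag_op B z)"
    unfolding trace_class_def op_adjoint_diag_op[OF B]
    using bd pos B hc[OF B] by (blast intro: has_sum_imp_summable)
  show "op_trace (diag_op B z) = of_real (infsum z B)"
    unfolding op_trace_def by (rule infsumI[OF hc[OF some]])
  have "(\<Sum>\<^sub>\<infinity>e\<in>(SOME B. orthonormal_basis B). ennreal (Re (cinner e (op_apply (diag_op B z) e))))
      = ennreal (infsum z B)" (is "infsum (\<lambda>e. ennreal (?h e)) ?B = _")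
  proof (rule infsumI)
    have "((\<lambda>S. ennreal (sum ?h S)) \<longlongrightarrow> ennreal (infsum z B)) (finite_subsets_at_top ?B)"
      using hs[OF some] by (intro tendsto_ennrealI) (simp add: has_sum_def)
    moreover have "ennreal (sum ?h S) = (\<Sum>e\<in>S. ennreal (?h e))" for S
      by (rule sum_ennreal[symmetric]) (rule trace_diag_op_nonneg[of B B z, OF B B z le])
    ultimately show "((\<lambda>e. ennreal (?h e)) has_sum ennreal (infsum z B)) ?B"
      by (simp add: has_sum_def)
  qed
  then show "positive_trace (diag_op B z) < \<infinity>"
    unfolding positive_trace_def using bd pos by simp
qed

text \<open>A finite value rules out the default branch of \<open>positive_trace\<close>, so the
  operator is bounded; a norm bound \<open>M\<close> then bounds every eigenvalue, which is the
  hypothesis of the change of basis.\<close>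

lemma positive_trace_diag_op_finiteD:
  assumes B: "orthonormal_basis B" and z: "\<And>e. e \<in> B \<Longrightarrow> 0 \<le> z e"
    and fin: "positive_trace (diag_op B z) < \<infinity>"
  shows "z summable_on B"
proof -
  let ?B = "SOME B::'a set. orthonormal_basis B"
  let ?h = "\<lambda>e. Re (cinner e (op_apply (diag_op B z) e))"
  have some: "orthonormal_basis ?B" using B by (rule someI)
  have bd: "bounded_operator (diag_op B z)"
    and inf: "infsum (\<lambda>e. ennreal (?h e)) ?B < \<infinity>"
    using fin by (auto simp: positive_trace_def split: if_splits)
  obtain M where M: "\<And>x y. (x, y) \<in> diag_op B z \<Longrightarrow> norm y \<le> M * norm x"
    using bd unfolding bounded_operator_def by blast
  have le: "z e \<le> M" if e: "e \<in> B" for e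
  proof -
    have "cinner e e = 1" using B e by (auto simp: orthonormal_basis_def)
    then have "norm e = 1" using norm_ge_zero[of e]
      by (auto simp: cinner_self power2_eq_1_iff simp flip: of_real_power)
    then show ?thesis using M[OF diag_op_basis[OF B e]] by simp
  qed
  note h0 = trace_diag_op_nonneg[of B B z, OF B B z le]
  have "?h summable_on ?B"
  proof (rule nonneg_bdd_above_summable_on)
    show "bdd_above (sum ?h ` {F. F \<subseteq> ?B \<and> finite F})"
    proof (rule bdd_aboveI2)
      fix F assume F: "F \<in> {F. F \<subseteq> ?B \<and> finite F}"
      have fF: "finite F" using F by simp
      have "ennreal (sum ?h F) = (\<Sum>e\<in>F. ennreal (?h e))"
        by (rule sum_ennreal[symmetric]) (rule h0)
      also have "\<dots> \<le> infsum (\<lambda>e. ennreal (?h e)) ?B"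
        unfolding infsum_finite[OF fF, symmetric]
        by (rule infsum_mono_neutral) (use F in \<open>auto intro!: nonneg_summable_on_complete\<close>)
      finally have "enn2real (ennreal (sum ?h F)) \<le> enn2real (infsum (\<lambda>e. ennreal (?h e)) ?B)"
        using inf by (intro enn2real_mono) auto
      then show "sum ?h F \<le> enn2real (infsum (\<lambda>e. ennreal (?h e)) ?B)"
        using sum_nonneg[of F ?h] h0 by simp
    qed
  qed (rule h0)
  from summable_on_trace_diag_op[of B ?B z, OF B some z le this]
  show ?thesis by simp
qed

lemma diag_op_converse:
  assumes "\<And>e. e \<in> B \<Longrightarrow> z e \<noteq> 0"
  shows "(diag_op B z)\<inverse> = diag_op B (\<lambda>e. 1 / z e)"
  using assms by (auto simp: diag_op_def field_simps)

text \<open>Only the factor applied first is bounded. It is therefore everywhere defined, so an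
  intermediate vector always exists and the composite keeps the maximal domain of the product, even
  if \<open>w\<close> is unbounded.\<close>

lemma op_comp_diag_op:
  assumes B: "orthonormal_basis B" and z: "\<And>e. e \<in> B \<Longrightarrow> \<bar>z e\<bar> \<le> M"
  shows "op_comp (diag_op B w) (diag_op B z) = diag_op B (\<lambda>e. w e * z e)"
proof (intro equalityI subrelI)
  fix x y assume xy: "(x, y) \<in> diag_op B (\<lambda>e. w e * z e)"
  obtain u where "(x, u) \<in> diag_op B z" using Domain_diag_op[of B z, OF B z] by blast
  then show "(x, y) \<in> op_comp (diag_op B w) (diag_op B z)"
    using xy unfolding op_comp_def by (intro relcompI[of x u]) (auto simp: diag_op_def)
qed (auto simp: op_comp_def diag_op_def)

section \<open>A spanning set for the subalgebra generated by the \<open>F\<^sub>i\<close>\<close>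

text \<open>An iterated \<open>q\<close>-commutator of \<open>F j, \<dots>, F k\<close>: for
  \<open>j \<le> k\<close> the quantum root vector of the positive root \<alpha>_j + ... +
  \<alpha>_k in type A.\<close>

function root_vec :: "real \<Rightarrow> (nat \<Rightarrow> 'a::{real_algebra, monoid_mult}) \<Rightarrow> nat \<Rightarrow> nat \<Rightarrow> 'a" where
  "root_vec q F k j =
     (if j < k then F j * root_vec q F k (Suc j) - (1 / q) *\<^sub>R (root_vec q F k (Suc j) * F j) else F k)"
  by pat_completeness auto
termination by (relation "Wellfounded.measure (\<lambda>(q, F, k, j). k - j)") auto

declare root_vec.simps [simp del]

primrec root_mon :: "real \<Rightarrow> (nat \<Rightarrow> 'a::{real_algebra, monoid_mult}) \<Rightarrow> nat \<Rightarrow> nat \<Rightarrow> (nat \<Rightarrow> nat) \<Rightarrow> 'a" where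
  "root_mon q F k 0 a = 1"
| "root_mon q F k (Suc j) a = root_vec q F k (Suc j) ^ a (Suc j) * root_mon q F k j a"

text \<open>\<open>root_vec q F k j\<close> is a combination of products of \<open>Suc k - j\<close>
  generators, so this is the number of letters in the monomial.\<close>

definition root_deg :: "nat \<Rightarrow> (nat \<Rightarrow> nat) \<Rightarrow> nat" where
  "root_deg k a = (\<Sum>j\<in>{1..k}. a j * (Suc k - j))"

text \<open>Root vectors are grouped by the upper end \<open>k\<close> of their root, with the block
  of largest \<open>k\<close> on the left. A generator coming from the left then meets this block
  first, and what remains is a monomial of smaller rank.\<close>

primrec pbw :: "real \<Rightarrow> (nat \<Rightarrow> 'a::{real_algebra, monoid_mult}) \<Rightarrow> nat \<Rightarrow> nat \<Rightarrow> 'a set" where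
  "pbw q F 0 r = (if r = 0 then {1} else {})"
| "pbw q F (Suc k) r =
     {root_mon q F (Suc k) (Suc k) a * b | a s b. root_deg (Suc k) a + s = r \<and> b \<in> pbw q F k s}"

text \<open>Since \<open>a\<close> commutes with \<open>y\<close>, the double commutator
  \<open>z\<close> can be bracketed as \<open>a\<close> with \<open>x\<close> or as \<open>c\<close>
  with \<open>y\<close>. The first form gives \<open>b * z = q\<^sup>2 *\<^sub>R (z * b) - q
  *\<^sub>R (c * x - x * c)\<close>; the second evaluates \<open>c * x - x * c\<close> in terms of
  \<open>b * z\<close> and \<open>z * b\<close>. Together they say that \<open>1 + q\<^sup>2\<close>
  annihilates \<open>b * z - z * b\<close>.\<close>

lemma q_commutator_commutes:
  fixes a b y :: "'a::{real_algebra, monoid_mult}"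
  assumes q: "q > 0" and ay: "a * y = y * a"
    and c: "c = a * b - (1 / q) *\<^sub>R (b * a)" and x: "x = b * y - (1 / q) *\<^sub>R (y * b)"
    and cb: "c * b = q *\<^sub>R (b * c)" and bx: "b * x = q *\<^sub>R (x * b)"
    and z: "z = a * x - (1 / q) *\<^sub>R (x * a)"
  shows "b * z = z * b"
proof -
  have ay': "a * (y * w) = y * (a * w)" for w by (metis ay mult.assoc)
  have zc: "z = c * y - (1 / q) *\<^sub>R (y * c)"
    unfolding z x c by (simp add: algebra_simps ay ay')
  have ba: "b * a = q *\<^sub>R (a * b) - q *\<^sub>R c" using q unfolding c by (simp add: algebra_simps)
  have bc: "b * c = (1 / q) *\<^sub>R (c * b)" using q unfolding cb by simp
  have xab: "q *\<^sub>R (x * (a * b)) = q *\<^sub>R (x * c) + x * (b * a)"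
    using q unfolding c by (simp add: algebra_simps)
  have "b * z = (b * a) * x - (1 / q) *\<^sub>R ((b * x) * a)"
    unfolding z by (simp add: algebra_simps)
  also have "\<dots> = q *\<^sub>R (a * (b * x)) - q *\<^sub>R (c * x) - x * (b * a)"
    unfolding ba using q bx by (simp add: algebra_simps ba)
  also have "\<dots> = q\<^sup>2 *\<^sub>R (a * x * b) - q *\<^sub>R (c * x) - x * (b * a)"
    unfolding bx by (simp add: algebra_simps power2_eq_square)
  also have "q\<^sup>2 *\<^sub>R (a * x * b) = q\<^sup>2 *\<^sub>R (z * b) + q *\<^sub>R (x * (a * b))"
    unfolding z using q by (simp add: algebra_simps power2_eq_square)
  finally have 1: "b * z = q\<^sup>2 *\<^sub>R (z * b) - q *\<^sub>R (c * x - x * c)"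
    unfolding xab by (simp add: algebra_simps)
  have cb': "c * (b * w) = q *\<^sub>R (b * (c * w))" for w
    by (metis cb mult.assoc mult_scaleR_left)
  have "c * x = q *\<^sub>R (b * c * y) - (1 / q) *\<^sub>R (c * y * b)"
    unfolding x by (simp add: algebra_simps cb')
  moreover have "x * c = b * y * c - (1 / q)\<^sup>2 *\<^sub>R (y * c * b)"
    unfolding x by (simp add: algebra_simps bc power2_eq_square)
  ultimately have 2: "c * x - x * c = q *\<^sub>R (b * z) - (1 / q) *\<^sub>R (z * b)"
    unfolding zc using q by (simp add: algebra_simps power2_eq_square)
  have "(1 + q\<^sup>2) *\<^sub>R (b * z) = (1 + q\<^sup>2) *\<^sub>R (z * b)"
    using 1 q unfolding 2 by (simp add: algebra_simps power2_eq_square)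
  moreover have "1 + q\<^sup>2 \<noteq> 0" by (smt (verit) zero_le_power2)
  ultimately show ?thesis by simp
qed

text \<open>Each of the \<open>n\<close> factors can turn \<open>f\<close> into \<open>w\<close>,
  which then \<open>q\<close>-commutes to the right end; the scalars add up to a kind of quantum
  integer \<open>e\<close>. Its value does not matter, except that it vanishes at
  \<open>n = 0\<close>, where \<open>n - 1\<close> is truncated.\<close>

lemma power_commute_past:
  fixes f x w :: "'a::{real_algebra, monoid_mult}"
  assumes fx: "f * x = p *\<^sub>R (x * f) + w" and wx: "w * x = q *\<^sub>R (x * w)"
  shows "\<exists>e. (n = 0 \<longrightarrow> e = 0) \<and> f * x ^ n = p ^ n *\<^sub>R (x ^ n * f) + e *\<^sub>R (x ^ (n - 1) * w)"
proof (induction n)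
  case (Suc n)
  then obtain e where e: "n = 0 \<longrightarrow> e = 0"
    "f * x ^ n = p ^ n *\<^sub>R (x ^ n * f) + e *\<^sub>R (x ^ (n - 1) * w)" by blast
  have "f * x ^ Suc n = (f * x ^ n) * x" by (simp add: power_commutes mult.assoc)
  also have "\<dots> = p ^ n *\<^sub>R (x ^ n * (f * x)) + e *\<^sub>R (x ^ (n - 1) * (w * x))"
    unfolding e by (simp add: algebra_simps)
  also have "\<dots> = p ^ Suc n *\<^sub>R (x ^ Suc n * f) + p ^ n *\<^sub>R (x ^ n * w) + (e * q) *\<^sub>R ((x ^ (n - 1) * x) * w)"
    unfolding fx wx by (simp add: algebra_simps power_Suc2 del: power_Suc)
  also have "(e * q) *\<^sub>R ((x ^ (n - 1) * x) * w) = (e * q) *\<^sub>R (x ^ n * w)"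
    using e(1) by (cases n) (auto simp: power_commutes)
  finally have "f * x ^ Suc n = p ^ Suc n *\<^sub>R (x ^ Suc n * f) + (p ^ n + e * q) *\<^sub>R (x ^ (Suc n - 1) * w)"
    by (simp add: algebra_simps)
  then show ?case by blast
qed simp

locale q_serre =
  fixes q :: real and l :: nat and F :: "nat \<Rightarrow> 'a::{real_algebra, monoid_mult}"
  assumes q: "q > 0"
    and serre: "\<And>i j. i \<in> {1..l} \<Longrightarrow> j \<in> {1..l} \<Longrightarrow> \<bar>int i - int j\<bar> = 1 \<Longrightarrow>
      F i * (F i * F j) - (q + 1 / q) *\<^sub>R (F i * (F j * F i)) + F j * (F i * F i) = 0"
    and comm: "\<And>i j. i \<in> {1..l} \<Longrightarrow> j \<in> {1..l} \<Longrightarrow> \<bar>int i - int j\<bar> > 1 \<Longrightarrow> F i * F j = F j * F i"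
begin

abbreviation "X \<equiv> root_vec q F"

lemma X_step: "j < k \<Longrightarrow> X k j = F j * X k (Suc j) - (1 / q) *\<^sub>R (X k (Suc j) * F j)"
  by (subst root_vec.simps) simp

lemma X_diag: "X k k = F k"
  by (subst root_vec.simps) simp

section \<open>Commutation rules between generators and root vectors\<close>

lemma commute_left:
  assumes "1 \<le> i" "i + 1 < j" "j \<le> k" "k \<le> l"
  shows "F i * X k j = X k j * F i"
  using assms
proof (induction "k - j" arbitrary: j)
  case 0
  then show ?case by (simp add: X_diag comm)
next
  case (Suc d)
  then have IH: "F i * X k (Suc j) = X k (Suc j) * F i" by simp
  have c: "F i * F j = F j * F i" using Suc by (intro comm) auto
  have j: "j < k" using Suc by simp
  show ?case unfolding X_step[OF j]
    by (simp add: algebra_simps IH) (metis IH c mult.assoc)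
qed

text \<open>\<open>X k (Suc j)\<close> is a \<open>q\<close>-commutator of \<open>F (Suc j)\<close>
  with an element that commutes with \<open>F j\<close>, and such a commutator can be taken of the
  whole Serre relation between \<open>F j\<close> and \<open>F (Suc j)\<close>.\<close>

lemma serre_left:
  assumes i: "1 \<le> j" "j < k" "k \<le> l"
  shows "F j * (F j * X k (Suc j)) - (q + 1 / q) *\<^sub>R (F j * (X k (Suc j) * F j)) + X k (Suc j) * (F j * F j) = 0"
proof (cases "Suc j = k")
  case True
  then show ?thesis using serre[of j "Suc j"] assms by (simp add: X_diag)
next
  case False
  then have j: "Suc j < k" using assms by simp
  define a b w where "a = F j" and "b = F (Suc j)" and "w = X k (Suc (Suc j))"
  have aw: "a * w = w * a" unfolding a_def w_def using assms j by (intro commute_left) auto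
  then have aw': "a * (w * u) = w * (a * u)" for u by (metis mult.assoc)
  have "a * (a * b) - (q + 1 / q) *\<^sub>R (a * (b * a)) + b * (a * a) = 0" (is "?s = 0")
    unfolding a_def b_def using assms by (intro serre) auto
  then have "?s * w - (1 / q) *\<^sub>R (w * ?s) = 0" by simp
  also have "?s * w - (1 / q) *\<^sub>R (w * ?s) = a * (a * (b * w - (1 / q) *\<^sub>R (w * b)))
     - (q + 1 / q) *\<^sub>R (a * ((b * w - (1 / q) *\<^sub>R (w * b)) * a)) + (b * w - (1 / q) *\<^sub>R (w * b)) * (a * a)"
    by (simp add: algebra_simps aw aw')
  finally show ?thesis unfolding X_step[OF j] a_def b_def w_def .
qed

lemma q_commute_diag:
  assumes "1 \<le> j" "j < k" "k \<le> l"
  shows "F j * X k j = q *\<^sub>R (X k j * F j)"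
proof -
  have "F j * X k j - q *\<^sub>R (X k j * F j) =
    F j * (F j * X k (Suc j)) - (q + 1 / q) *\<^sub>R (F j * (X k (Suc j) * F j)) + X k (Suc j) * (F j * F j)"
    unfolding X_step[OF assms(2)] using q by (simp add: algebra_simps)
  then show ?thesis using serre_left[OF assms] by simp
qed

text \<open>Descending induction on \<open>j\<close>. As long as \<open>i > Suc j\<close>, the
  letter \<open>F i\<close> commutes with both constituents of \<open>X k j\<close>; the real
  content is \<open>i = Suc j\<close>, where it commutes with neither and
  \<open>q_commutator_commutes\<close> is needed.\<close>

lemma commute_right:
  assumes "1 \<le> j" "j < i" "i < k" "k \<le> l"
  shows "F i * X k j = X k j * F i"
  using assms
proof (induction "k - j" arbitrary: j)
  case (Suc d)
  have j: "j < k" using Suc by simp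
  show ?case
  proof (cases "i = Suc j")
    case True
    define c where "c = F j * F i - (1 / q) *\<^sub>R (F i * F j)"
    have "F i * (F i * F j) - (q + 1 / q) *\<^sub>R (F i * (F j * F i)) + F j * (F i * F i) = 0"
      using Suc True by (intro serre) auto
    moreover have "c * F i - q *\<^sub>R (F i * c) =
       F i * (F i * F j) - (q + 1 / q) *\<^sub>R (F i * (F j * F i)) + F j * (F i * F i)"
      unfolding c_def using q by (simp add: algebra_simps)
    ultimately have cb: "c * F i = q *\<^sub>R (F i * c)" by simp
    show ?thesis
    proof (rule q_commutator_commutes[OF q _ c_def _ cb])
      show "F j * X k (Suc i) = X k (Suc i) * F j"
        using Suc True by (intro commute_left) auto
      show "X k i = F i * X k (Suc i) - (1 / q) *\<^sub>R (X k (Suc i) * F i)"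
        using Suc by (intro X_step) auto
      show "F i * X k i = q *\<^sub>R (X k i * F i)" using Suc by (intro q_commute_diag) auto
      show "X k j = F j * X k i - (1 / q) *\<^sub>R (X k i * F j)" using X_step[OF j] True by simp
    qed
  next
    case False
    then have IH: "F i * X k (Suc j) = X k (Suc j) * F i" using Suc by simp
    have c: "F i * F j = F j * F i" using Suc False by (intro comm) auto
    show ?thesis unfolding X_step[OF j]
      by (simp add: algebra_simps IH) (metis IH c mult.assoc)
  qed
qed simp

lemma q_commute_last:
  assumes "1 \<le> i" "i < k" "k \<le> l"
  shows "X k i * F k = q *\<^sub>R (F k * X k i)"
  using assms
proof (induction "k - i" arbitrary: i)
  case (Suc d)
  show ?case
  proof (cases "Suc i = k")
    case True
    have "F k * (F k * F i) - (q + 1 / q) *\<^sub>R (F k * (F i * F k)) + F i * (F k * F k) = 0"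
      using Suc True by (intro serre) auto
    moreover have "X k i * F k - q *\<^sub>R (F k * X k i) =
       F k * (F k * F i) - (q + 1 / q) *\<^sub>R (F k * (F i * F k)) + F i * (F k * F k)"
    proof -
      have Xi: "X k i = F i * F k - (1 / q) *\<^sub>R (F k * F i)"
        using True X_step[of i k] by (auto simp: X_diag)
      show ?thesis unfolding Xi using q by (simp add: algebra_simps)
    qed
    ultimately show ?thesis by simp
  next
    case False
    then have IH: "X k (Suc i) * F k = q *\<^sub>R (F k * X k (Suc i))" using Suc by simp
    then have IH': "X k (Suc i) * (F k * u) = q *\<^sub>R (F k * (X k (Suc i) * u))" for u
      by (metis mult.assoc mult_scaleR_left)
    have c: "F i * F k = F k * F i" using Suc False by (intro comm) auto
    then have c': "F i * (F k * u) = F k * (F i * u)" for u by (metis mult.assoc)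
    have i: "i < k" using Suc by simp
    show ?thesis unfolding X_step[OF i] by (simp add: algebra_simps IH IH' c c')
  qed
qed simp

lemma q_commute_X:
  assumes "1 \<le> i" "i < j" "j \<le> k" "k \<le> l"
  shows "X k i * X k j = q *\<^sub>R (X k j * X k i)"
  using assms
proof (induction "k - j" arbitrary: j)
  case 0
  then show ?case using q_commute_last[of i k] by (simp add: X_diag)
next
  case (Suc d)
  then have j: "j < k" by simp
  let ?z = "X k i" and ?u = "X k (Suc j)"
  have zu: "?z * ?u = q *\<^sub>R (?u * ?z)" using Suc by simp
  then have zu': "?z * (?u * w) = q *\<^sub>R (?u * (?z * w))" for w
    by (metis mult.assoc mult_scaleR_left)
  have zf: "?z * F j = F j * ?z" using commute_right[of i j k] Suc j by simp
  then have zf': "?z * (F j * w) = F j * (?z * w)" for w by (metis mult.assoc)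
  show ?case unfolding X_step[OF j] by (simp add: algebra_simps zu zu' zf zf')
qed

lemma power_commute:
  fixes f x :: 'a
  assumes "f * x = p *\<^sub>R (x * f)"
  shows "f * x ^ n = p ^ n *\<^sub>R (x ^ n * f)"
  using power_commute_past[of f x p 0 0 n] assms by auto

lemma root_mon_cong: "(\<And>i. 1 \<le> i \<Longrightarrow> i \<le> j \<Longrightarrow> a i = b i) \<Longrightarrow> root_mon q F k j a = root_mon q F k j b"
  by (induction j) auto

text \<open>All factors but \<open>X k (Suc i)\<close> commute with \<open>F i\<close> up to a
  scalar. Passing a power of that one converts a single factor \<open>X k (Suc i)\<close> into
  \<open>X k i\<close>; this is the only correction term, and it is again an ordered
  monomial.\<close>

lemma F_root_mon:
  assumes "1 \<le> i" "i < k" "j \<le> k" "k \<le> l"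
  shows "\<exists>c d. (d \<noteq> 0 \<longrightarrow> i < j \<and> a (Suc i) > 0) \<and>
    F i * root_mon q F k j a = c *\<^sub>R (root_mon q F k j a * F i)
      + d *\<^sub>R root_mon q F k j (a(Suc i := a (Suc i) - 1, i := Suc (a i)))"
  using assms(3)
proof (induction j)
  case 0
  show ?case by (intro exI[of _ 1] exI[of _ 0]) simp
next
  case (Suc j)
  let ?a = "a(Suc i := a (Suc i) - 1, i := Suc (a i))"
  let ?M = "root_mon q F k j a" and ?x = "X k (Suc j) ^ a (Suc j)"
  obtain c d where cd: "d \<noteq> 0 \<longrightarrow> i < j \<and> a (Suc i) > 0"
    "F i * ?M = c *\<^sub>R (?M * F i) + d *\<^sub>R root_mon q F k j ?a"
    using Suc.IH[OF Suc_leD[OF Suc.prems]] by blast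
  \<comment> \<open>The common treatment of every factor that commutes with \<open>F i\<close> up to
    a scalar \<open>p\<close>, which is \<open>1\<close> or \<open>q\<close>.\<close>
  have pass: ?case if fx: "F i * X k (Suc j) = p *\<^sub>R (X k (Suc j) * F i)" and ne: "d \<noteq> 0 \<longrightarrow> i < j"
    "j \<noteq> i" for p
  proof -
    have "F i * root_mon q F k (Suc j) a = (F i * ?x) * ?M" by (simp add: mult.assoc)
    also have "\<dots> = p ^ a (Suc j) *\<^sub>R (?x * (F i * ?M))"
      unfolding power_commute[OF fx] by (simp add: mult.assoc)
    also have "\<dots> = (p ^ a (Suc j) * c) *\<^sub>R (?x * ?M * F i)
        + (p ^ a (Suc j) * d) *\<^sub>R (?x * root_mon q F k j ?a)"
      unfolding cd by (simp add: algebra_simps)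
    also have "(p ^ a (Suc j) * d) *\<^sub>R (?x * root_mon q F k j ?a) =
        (p ^ a (Suc j) * d) *\<^sub>R root_mon q F k (Suc j) ?a"
      using ne by (cases "d = 0") auto
    finally have eq: "F i * root_mon q F k (Suc j) a =
        (p ^ a (Suc j) * c) *\<^sub>R (root_mon q F k (Suc j) a * F i)
          + (p ^ a (Suc j) * d) *\<^sub>R root_mon q F k (Suc j) ?a"
      by (simp only: root_mon.simps)
    have "p ^ a (Suc j) * d \<noteq> 0 \<longrightarrow> i < Suc j \<and> a (Suc i) > 0" using cd(1) by auto
    with eq show ?thesis by blast
  qed
  consider "Suc j < i" | "Suc j = i" | "j = i" | "i < j" by linarith
  then show ?case
  proof cases
    case 1
    then show ?thesis using commute_right[of "Suc j" i k] assms Suc.prems cd by (intro pass[of 1]) auto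
  next
    case 2
    then show ?thesis using q_commute_diag[of i k] assms Suc.prems cd by (intro pass[of q]) auto
  next
    case 4
    then show ?thesis using commute_left[of i "Suc j" k] assms Suc.prems cd by (intro pass[of 1]) auto
  next
    \<comment> \<open>The factor at hand is \<open>X k (Suc i)\<close>. The new \<open>X k i\<close>
      appears directly to the left of the power of \<open>X k i\<close>, so nothing has to be
      reordered.\<close>
    case 3
    then have d: "d = 0" using cd by auto
    have fx: "F i * X k (Suc i) = (1 / q) *\<^sub>R (X k (Suc i) * F i) + X k i"
      using X_step[of i k] assms by simp
    have wx: "X k i * X k (Suc i) = q *\<^sub>R (X k (Suc i) * X k i)"
      using assms by (intro q_commute_X) auto
    let ?n = "a (Suc i)"
    obtain e where e: "?n = 0 \<longrightarrow> e = 0"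
      "F i * X k (Suc i) ^ ?n = (1 / q) ^ ?n *\<^sub>R (X k (Suc i) ^ ?n * F i) + e *\<^sub>R (X k (Suc i) ^ (?n - 1) * X k i)"
      using power_commute_past[OF fx wx, of ?n] by (elim exE conjE) (rule that)
    have "X k i * root_mon q F k i a = root_mon q F k i ?a"
    proof -
      obtain i' where i': "i = Suc i'" using assms by (cases i) auto
      have "root_mon q F k i' ?a = root_mon q F k i' a"
        by (rule root_mon_cong) (use i' in auto)
      then show ?thesis unfolding i' by (simp add: mult.assoc)
    qed
    moreover have "F i * root_mon q F k (Suc j) a = (F i * X k (Suc i) ^ ?n) * root_mon q F k i a"
      using 3 by (simp add: mult.assoc)
    ultimately have "F i * root_mon q F k (Suc j) a = (1 / q) ^ ?n *\<^sub>R (X k (Suc i) ^ ?n * (F i * root_mon q F k i a))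
       + e *\<^sub>R (X k (Suc i) ^ (?n - 1) * root_mon q F k i ?a)"
      unfolding e by (simp add: distrib_right mult.assoc)
    also have "\<dots> = ((1 / q) ^ ?n * c) *\<^sub>R (root_mon q F k (Suc j) a * F i) + e *\<^sub>R root_mon q F k (Suc j) ?a"
      using cd d 3 by (simp add: mult.assoc)
    finally have eq: "F i * root_mon q F k (Suc j) a =
        ((1 / q) ^ ?n * c) *\<^sub>R (root_mon q F k (Suc j) a * F i) + e *\<^sub>R root_mon q F k (Suc j) ?a" .
    have "e \<noteq> 0 \<longrightarrow> i < Suc j \<and> a (Suc i) > 0" using e(1) 3 by auto
    with eq show ?thesis by blast
  qed
qed

text \<open>A root vector with \<open>k - i\<close> letters is traded for one with
  \<open>Suc k - i\<close>: the extra letter is the absorbed \<open>F i\<close>.\<close>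

lemma root_deg_shift:
  assumes "1 \<le> i" "i < k" "a (Suc i) > 0"
  shows "root_deg k (a(Suc i := a (Suc i) - 1, i := Suc (a i))) = Suc (root_deg k a)"
proof -
  have split: "{1..k} = insert i (insert (Suc i) ({1..k} - {i, Suc i}))" using assms by auto
  obtain n where n: "a (Suc i) = Suc n" using assms by (cases "a (Suc i)") auto
  have k: "Suc k - i = Suc (k - i)" using assms by simp
  show ?thesis unfolding root_deg_def
    by (subst (1 2) split) (simp add: n k)
qed

lemma span_mult_left:
  assumes "\<And>b. b \<in> A \<Longrightarrow> f * b \<in> span C" "x \<in> span A"
  shows "f * x \<in> span (C :: 'a set)"
  using assms(2)
proof (induction rule: span_induct_alt)
  case (step c b y)
  then show ?case using assms(1)
    by (auto simp: distrib_left intro: span_add span_scale)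
qed (simp add: span_zero)

text \<open>Induction on the rank. The generator of largest index is itself the leftmost root vector
  and raises its exponent; any other one crosses the leftmost block by \<open>F_root_mon\<close> and
  then acts on a monomial of smaller rank.\<close>

lemma F_pbw:
  assumes "i \<in> {1..k}" "k \<le> l" "b \<in> pbw q F k r"
  shows "F i * b \<in> span (pbw q F k (Suc r))"
  using assms
proof (induction k arbitrary: b r)
  case (Suc k)
  let ?K = "Suc k"
  obtain a s b' where b: "b = root_mon q F ?K ?K a * b'" "root_deg ?K a + s = r" "b' \<in> pbw q F k s"
    using Suc.prems by auto
  show ?case
  proof (cases "i = ?K")
    case True
    let ?a = "a(?K := Suc (a ?K))"
    have "root_deg ?K ?a = Suc (root_deg ?K a)"
    proof -
      have split: "{1..?K} = insert ?K {1..k}" by auto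
      show ?thesis unfolding root_deg_def by (subst (1 2) split) simp
    qed
    moreover have "F i * b = root_mon q F ?K ?K ?a * b'"
    proof -
      have "root_mon q F ?K k ?a = root_mon q F ?K k a" by (rule root_mon_cong) auto
      then show ?thesis unfolding b True by (simp add: X_diag mult.assoc)
    qed
    ultimately have "F i * b \<in> pbw q F ?K (Suc r)"
      using b unfolding pbw.simps(2) by (intro CollectI exI[of _ ?a] exI[of _ s] exI[of _ b']) auto
    then show ?thesis by (rule span_base)
  next
    case False
    let ?a = "a(Suc i := a (Suc i) - 1, i := Suc (a i))"
    obtain c d where cd: "d \<noteq> 0 \<longrightarrow> i < ?K \<and> a (Suc i) > 0"
      "F i * root_mon q F ?K ?K a = c *\<^sub>R (root_mon q F ?K ?K a * F i) + d *\<^sub>R root_mon q F ?K ?K ?a"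
      using F_root_mon[of i ?K ?K a] Suc.prems False by auto
    have "F i * b = (F i * root_mon q F ?K ?K a) * b'" unfolding b by (simp add: mult.assoc)
    also have "\<dots> = c *\<^sub>R (root_mon q F ?K ?K a * (F i * b')) + d *\<^sub>R (root_mon q F ?K ?K ?a * b')"
      unfolding cd(2) by (simp add: algebra_simps)
    also have "\<dots> \<in> span (pbw q F ?K (Suc r))"
    proof (intro span_add)
      have "F i * b' \<in> span (pbw q F k (Suc s))" using Suc b False by auto
      then have "root_mon q F ?K ?K a * (F i * b') \<in> span (pbw q F ?K (Suc r))"
      proof (rule span_mult_left[rotated])
        fix u assume "u \<in> pbw q F k (Suc s)"
        then show "root_mon q F ?K ?K a * u \<in> span (pbw q F ?K (Suc r))"
          using b unfolding pbw.simps(2)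
          by (intro span_base CollectI exI[of _ a] exI[of _ "Suc s"] exI[of _ u]) auto
      qed
      then show "c *\<^sub>R (root_mon q F ?K ?K a * (F i * b')) \<in> span (pbw q F ?K (Suc r))"
        by (rule span_scale)
      show "d *\<^sub>R (root_mon q F ?K ?K ?a * b') \<in> span (pbw q F ?K (Suc r))"
      proof (cases "d = 0")
        case dn: False
        then have "root_deg ?K ?a = Suc (root_deg ?K a)"
          using cd Suc.prems by (intro root_deg_shift) auto
        then show ?thesis
          using b unfolding pbw.simps(2)
          by (intro span_scale span_base CollectI exI[of _ ?a] exI[of _ s] exI[of _ b']) auto
      qed (simp add: span_zero)
    qed
    finally show ?thesis .
  qed
qed simp

lemma one_in_pbw: "1 \<in> pbw q F k 0"
proof (induction k)
  case (Suc k)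
  have "root_mon q F (Suc k) j (\<lambda>_. 0) = 1" for j by (induction j) auto
  then show ?case using Suc unfolding pbw.simps(2)
    by (intro CollectI exI[of _ "\<lambda>_. 0"] exI[of _ 0] exI[of _ 1]) (auto simp: root_deg_def)
qed simp

lemma word_in_span_pbw:
  assumes "set w \<subseteq> {1..l}"
  shows "prod_list (map F w) \<in> span (pbw q F l (length w))"
  using assms
proof (induction w)
  case (Cons i w)
  then have i: "i \<in> {1..l}" and IH: "prod_list (map F w) \<in> span (pbw q F l (length w))" by auto
  have "F i * prod_list (map F w) \<in> span (pbw q F l (Suc (length w)))"
    by (rule span_mult_left[OF _ IH]) (rule F_pbw[OF i order_refl])
  then show ?case by simp
qed (simp add: one_in_pbw span_base)

end

text \<open>The block of index \<open>i\<close> involves \<open>i\<close> exponents, and the degree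
  left to the smaller blocks is one further choice; each takes at most \<open>r + 1\<close> values
  because every root vector has degree at least one.\<close>

lemma finite_card_pbw:
  "finite (pbw q F k r) \<and> card (pbw q F k r) \<le> (r + 1) ^ (\<Sum>i\<le>k. i + 1)"
proof (induction k arbitrary: r)
  case (Suc k)
  let ?K = "Suc k"
  let ?A = "{1..?K} \<rightarrow>\<^sub>E {..r}"
  let ?U = "\<Union>a\<in>?A. \<Union>s\<in>{..r}. (\<lambda>b. root_mon q F ?K ?K a * b) ` pbw q F k s"
  let ?p = "\<Sum>i\<le>k. i + 1"
  have fin: "finite ?A" by (intro finite_PiE) auto
  have "card ?U \<le> (\<Sum>a\<in>?A. \<Sum>s\<in>{..r}. card ((\<lambda>b. root_mon q F ?K ?K a * b) ` pbw q F k s))"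
    by (intro order_trans[OF card_UN_le] sum_mono fin finite_atMost order_refl)
  also have "\<dots> \<le> (\<Sum>a\<in>?A. \<Sum>s\<in>{..r}. (r + 1) ^ ?p)"
  proof (intro sum_mono)
    fix a s assume s: "s \<in> {..r}"
    have "card ((\<lambda>b. root_mon q F ?K ?K a * b) ` pbw q F k s) \<le> card (pbw q F k s)"
      using Suc.IH by (intro card_image_le) auto
    also have "\<dots> \<le> (s + 1) ^ ?p" using Suc.IH by auto
    also have "\<dots> \<le> (r + 1) ^ ?p" using s by (intro power_mono) auto
    finally show "card ((\<lambda>b. root_mon q F ?K ?K a * b) ` pbw q F k s) \<le> (r + 1) ^ ?p" .
  qed
  also have "\<dots> = (r + 1) ^ (\<Sum>i\<le>?K. i + 1)"
    by (simp add: card_PiE power_add algebra_simps)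
  finally have card: "card ?U \<le> (r + 1) ^ (\<Sum>i\<le>?K. i + 1)" .
  have sub: "pbw q F ?K r \<subseteq> ?U"
  proof
    fix x assume "x \<in> pbw q F ?K r"
    then obtain a s b where x: "x = root_mon q F ?K ?K a * b" "root_deg ?K a + s = r" "b \<in> pbw q F k s"
      unfolding pbw.simps(2) by blast
    have "a j \<le> r" if "j \<in> {1..?K}" for j
    proof -
      have "a j * 1 \<le> a j * (Suc ?K - j)" using that by (intro mult_le_mono) auto
      also have "\<dots> \<le> root_deg ?K a"
        unfolding root_deg_def by (rule member_le_sum[OF that]) auto
      finally show ?thesis using x by simp
    qed
    \<comment> \<open>The monomial depends on the exponents in \<open>{1..?K}\<close> only;
      restriction picks one representative from a finite function space.\<close>
    then have mem: "restrict a {1..?K} \<in> ?A" by auto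
    have eq: "root_mon q F ?K j a = root_mon q F ?K j (restrict a {1..?K})" if "j \<le> ?K" for j
      using that by (induction j) auto
    have "x = root_mon q F ?K ?K (restrict a {1..?K}) * b"
      using x(1) eq[OF order_refl] by (simp only:)
    moreover have "s \<in> {..r}" using x by simp
    ultimately show "x \<in> ?U" using x(3) mem by (intro UN_I image_eqI)
  qed
  have "finite ?U" using fin Suc.IH by (intro finite_UN_I finite_imageI) auto
  then show ?case using sub card by (meson card_mono finite_subset order_trans)
qed auto

section \<open>Linear endomorphisms as an algebra\<close>

text \<open>The root vector calculus is carried out in a type of class \<open>real_algebra\<close>,
  so the operators of a representation have to become elements of such a type. Real linearity
  suffices, all structure constants being real.\<close>

typedef (overloaded) 'a endo = "{f :: 'a::real_vector \<Rightarrow> 'a. linear f}"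
  morphisms endo_apply Endo
  by (rule exI[of _ id]) (simp add: linear_id)

lemma linear_endo_apply: "linear (endo_apply f)"
  using endo_apply by auto

lemma endo_eqI: "(\<And>x. endo_apply f x = endo_apply g x) \<Longrightarrow> f = g"
  by (metis endo_apply_inject ext)

text \<open>Not \<open>real_algebra_1\<close>, since \<open>0 = 1\<close> when the underlying space is trivial.\<close>

instantiation endo :: (real_vector) "{real_algebra, monoid_mult}"
begin

definition "0 = Endo (\<lambda>x. 0)"
definition "1 = Endo (\<lambda>x. x)"
definition "f + g = Endo (\<lambda>x. endo_apply f x + endo_apply g x)"
definition "f - g = Endo (\<lambda>x. endo_apply f x - endo_apply g x)"
definition "- f = Endo (\<lambda>x. - endo_apply f x)"
definition "f * g = Endo (\<lambda>x. endo_apply f (endo_apply g x))"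
definition "r *\<^sub>R f = Endo (\<lambda>x. r *\<^sub>R endo_apply f x)"

lemma endo_apply_simps:
  "endo_apply 0 x = 0" "endo_apply 1 x = x"
  "endo_apply (f + g) x = endo_apply f x + endo_apply g x"
  "endo_apply (f - g) x = endo_apply f x - endo_apply g x"
  "endo_apply (- f) x = - endo_apply f x"
  "endo_apply (f * g) x = endo_apply f (endo_apply g x)"
  "endo_apply (r *\<^sub>R f) x = r *\<^sub>R endo_apply f x"
  unfolding zero_endo_def one_endo_def plus_endo_def minus_endo_def uminus_endo_def times_endo_def
    scaleR_endo_def
  by (subst Endo_inverse; simp add: linear_endo_apply linear_compose_add linear_compose_sub
      linear_compose_neg linear_compose_scale_right linear_zero linear_ident
      linear_compose[OF linear_endo_apply linear_endo_apply, unfolded o_def])+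

instance
  by intro_classes
    (auto intro!: endo_eqI simp: endo_apply_simps linear_add[OF linear_endo_apply]
      linear_scale[OF linear_endo_apply] algebra_simps)

end

section \<open>Highest weight representations\<close>

definition cartan :: "nat \<Rightarrow> nat \<Rightarrow> int" where
  "cartan i j = (if i = j then 2 else if \<bar>int i - int j\<bar> = 1 then -1 else 0)"

text \<open>The \<open>i\<close>-th Dynkin label of the weight of \<open>F_w v\<close>;
  \<open>K i\<close> acts on that vector by \<open>q\<close> to half of it.\<close>

definition word_weight :: "(nat \<Rightarrow> nat) \<Rightarrow> nat \<Rightarrow> nat list \<Rightarrow> int" where
  "word_weight n i w = int (n i) - (\<Sum>j\<leftarrow>w. cartan i j)"

definition words :: "nat \<Rightarrow> nat \<Rightarrow> nat list set" where
  "words l r = {w. set w \<subseteq> {1..l} \<and> length w = r}"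

lemma finite_words: "finite (words l r)"
  unfolding words_def by (rule finite_lists_length_eq) simp

text \<open>The expansion of \<open>E\<^sub>i F\<^sub>w v\<close> in words, where \<open>cf i u\<close> is the scalar by which \<open>[E\<^sub>i, F\<^sub>i]\<close> acts on
  \<open>F\<^sub>u v\<close>.  It is kept polymorphic in order to read it also over a polynomial ring.\<close>

primrec raise_word :: "(nat \<Rightarrow> nat list \<Rightarrow> 'c::comm_ring_1) \<Rightarrow> nat \<Rightarrow> nat list \<Rightarrow> ('c \<times> nat list) list" where
  "raise_word cf i [] = []"
| "raise_word cf i (j # w) =
    (if i = j then [(cf i w, w)] else []) @ map (\<lambda>(c, u). (c, j # u)) (raise_word cf i w)"

text \<open>The Shapovalov form on words: each letter of the left word is moved to the other side as
  an \<open>E\<close>, until the highest weight vector is reached.\<close>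

primrec word_gram :: "(nat \<Rightarrow> nat list \<Rightarrow> 'c::comm_ring_1) \<Rightarrow> nat list \<Rightarrow> nat list \<Rightarrow> 'c" where
  "word_gram cf [] J = (if J = [] then 1 else 0)"
| "word_gram cf (i # I) J = (\<Sum>(c, u)\<leftarrow>raise_word cf i J. c * word_gram cf I u)"

definition q_bracket :: "real \<Rightarrow> int \<Rightarrow> real" where
  "q_bracket q k = (q powr k - q powr (- k)) / (q - 1 / q)"

lemma length_raise_word: "(c, u) \<in> set (raise_word cf i w) \<Longrightarrow> length w = Suc (length u)"
  by (induction w arbitrary: c u) (auto split: if_splits)

lemma set_raise_word: "(c, u) \<in> set (raise_word cf i w) \<Longrightarrow> set u \<subseteq> set w"
  by (induction w arbitrary: c u) (fastforce split: if_splits)+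

lemma word_gram_length: "length I \<noteq> length J \<Longrightarrow> word_gram cf I J = 0"
proof (induction I arbitrary: J)
  case (Cons i I)
  have "(case p of (c, u) \<Rightarrow> c * word_gram cf I u) = 0" if "p \<in> set (raise_word cf i J)" for p
  proof -
    obtain c u where p: "p = (c, u)" by (cases p)
    then have "length J = Suc (length u)" using that length_raise_word by blast
    then show ?thesis using Cons p by simp
  qed
  then have "(\<Sum>p\<leftarrow>raise_word cf i J. case p of (c, u) \<Rightarrow> c * word_gram cf I u) = (\<Sum>p\<leftarrow>raise_word cf i J. 0)"
    by (intro arg_cong[of _ _ sum_list] map_cong) auto
  then show ?case by simp
qed auto

section \<open>A highest weight vector and the words applied to it\<close>

locale hw_rep =
  fixes q :: real and l :: nat and \<rho> :: "'h::complex_hilbert_space uq_action"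
    and n :: "nat \<Rightarrow> nat" and V :: "'h set" and v :: 'h
  assumes q: "0 < q" "q < 1"
    and rep: "uq_star_rep q l \<rho> V"
    and irr: "uq_irreducible l \<rho> V"
    and v: "v \<in> V" "v \<noteq> 0"
    and E_v: "\<And>i. i \<in> {1..l} \<Longrightarrow> \<rho> (genE i) v = 0"
    and K_v: "\<And>i. i \<in> {1..l} \<Longrightarrow> \<rho> (genK i) v = (q powr (real (n i) / 2)) *\<^sub>R v"
begin

declare One_nat_def [simp del]

abbreviation "E i \<equiv> \<rho> (genE i)"
abbreviation "F i \<equiv> \<rho> (genF i)"
abbreviation "K i \<equiv> \<rho> (genK i)"
abbreviation "Ki i \<equiv> \<rho> (genKinv i)"

lemma V: "csubspace V" using rep by (simp add: uq_star_rep_def)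

lemma lin: "g \<in> uq_gens l \<Longrightarrow> linear_between V V (\<rho> g)"
  using rep by (simp add: uq_star_rep_def)

lemma gens [simp]:
  "i \<in> {1..l} \<Longrightarrow> genK i \<in> uq_gens l" "i \<in> {1..l} \<Longrightarrow> genKinv i \<in> uq_gens l"
  "i \<in> {1..l} \<Longrightarrow> genE i \<in> uq_gens l" "i \<in> {1..l} \<Longrightarrow> genF i \<in> uq_gens l"
  by (auto simp: uq_gens_def)

lemma in_V: "g \<in> uq_gens l \<Longrightarrow> x \<in> V \<Longrightarrow> \<rho> g x \<in> V"
  using lin by (auto simp: linear_between_def)

lemma scaleR_V: "x \<in> V \<Longrightarrow> r *\<^sub>R x \<in> V"
  by (simp add: scaleR_scaleC complex_vector.subspace_scale[OF V])

lemmas add_V = complex_vector.subspace_add[OF V]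
lemmas diff_V = complex_vector.subspace_diff[OF V]

lemma g_add: "g \<in> uq_gens l \<Longrightarrow> x \<in> V \<Longrightarrow> y \<in> V \<Longrightarrow> \<rho> g (x + y) = \<rho> g x + \<rho> g y"
  using lin by (auto simp: linear_between_def)

lemma g_scaleC: "g \<in> uq_gens l \<Longrightarrow> x \<in> V \<Longrightarrow> \<rho> g (a *\<^sub>C x) = a *\<^sub>C \<rho> g x"
  using lin by (auto simp: linear_between_def)

lemma g_scaleR: "g \<in> uq_gens l \<Longrightarrow> x \<in> V \<Longrightarrow> \<rho> g (a *\<^sub>R x) = a *\<^sub>R \<rho> g x"
  by (simp add: scaleR_scaleC g_scaleC)

lemma g_0: "g \<in> uq_gens l \<Longrightarrow> \<rho> g 0 = 0"
  using g_scaleR[of g v 0] v by simp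

lemma adj_K: "i \<in> {1..l} \<Longrightarrow> x \<in> V \<Longrightarrow> y \<in> V \<Longrightarrow> cinner x (K i y) = cinner (K i x) y"
  using rep by (simp add: uq_star_rep_def)

lemma adj_E: "i \<in> {1..l} \<Longrightarrow> x \<in> V \<Longrightarrow> y \<in> V \<Longrightarrow> cinner x (F i y) = cinner (E i x) y"
  using rep by (simp add: uq_star_rep_def)

lemma adj_F: "i \<in> {1..l} \<Longrightarrow> x \<in> V \<Longrightarrow> y \<in> V \<Longrightarrow> cinner x (E i y) = cinner (F i x) y"
  by (metis adj_E cinner_commute)

text \<open>Positive definiteness turns the relations between the \<open>E i\<close> into their
  adjoints, which are the relations between the \<open>F i\<close> that
  \<open>uq_relations_on\<close> leaves implicit.\<close>

lemma V_eqI: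
  assumes "x \<in> V" "y \<in> V" "\<And>u. u \<in> V \<Longrightarrow> cinner u x = cinner u y"
  shows "x = y"
proof -
  have "cinner (x - y) (x - y) = 0"
    using assms(3)[OF diff_V[OF assms(1,2)]] by (simp add: cinner_diff_right)
  then show ?thesis by (simp add: cinner_self)
qed

lemma relations: "uq_relations_on q l \<rho> V" using rep by (simp add: uq_star_rep_def)

lemma Ki_K: "i \<in> {1..l} \<Longrightarrow> x \<in> V \<Longrightarrow> Ki i (K i x) = x"
  using relations by (simp add: uq_relations_on_def)

lemma E_F: "i \<in> {1..l} \<Longrightarrow> j \<in> {1..l} \<Longrightarrow> x \<in> V \<Longrightarrow>
   E i (F j x) = F j (E i x) + (if i = j then (1 / (q - 1 / q)) *\<^sub>R (K i (K i x) - Ki i (Ki i x)) else 0)"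
  using relations unfolding uq_relations_on_def diff_eq_eq by (simp add: add.commute)

lemma K_E_Ki:
  assumes "i \<in> {1..l}" "j \<in> {1..l}" "x \<in> V"
  shows "K i (E j (Ki i x)) = (q powr (cartan i j / 2)) *\<^sub>R E j x"
proof -
  consider "i = j" | "\<bar>int i - int j\<bar> = 1" | "\<bar>int i - int j\<bar> > 1" by linarith
  then show ?thesis
    using relations assms q by cases (auto simp: uq_relations_on_def cartan_def)
qed

lemma K_F:
  assumes i: "i \<in> {1..l}" and j: "j \<in> {1..l}" and x: "x \<in> V"
  shows "K i (F j x) = (q powr (- cartan i j / 2)) *\<^sub>R F j (K i x)"
proof (rule V_eqI)
  fix u assume u: "u \<in> V"
  let ?c = "q powr (cartan i j / 2)"
  have "K i (E j u) = ?c *\<^sub>R E j (K i u)"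
    using K_E_Ki[OF i j in_V[of "genK i" u]] i u by (simp add: Ki_K)
  moreover have "q powr (- cartan i j / 2) * ?c = 1" using q by (simp add: powr_add[symmetric])
  ultimately have EK: "E j (K i u) = (q powr (- cartan i j / 2)) *\<^sub>R K i (E j u)" by simp
  have "cinner u (K i (F j x)) = cinner (E j (K i u)) x"
    using i j u x by (simp add: adj_K adj_E in_V)
  also have "\<dots> = of_real (q powr (- cartan i j / 2)) * cinner (K i (E j u)) x"
    unfolding EK by (simp add: cinner_scaleR_left)
  also have "\<dots> = cinner u ((q powr (- cartan i j / 2)) *\<^sub>R F j (K i x))"
    using i j u x by (simp add: adj_K adj_E in_V cinner_scaleR_right)
  finally show "cinner u (K i (F j x)) = \<dots>" .
qed (use i j x in \<open>auto intro!: in_V scaleR_V\<close>)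

lemma F_serre:
  assumes i: "i \<in> {1..l}" and j: "j \<in> {1..l}" and x: "x \<in> V" and ij: "\<bar>int i - int j\<bar> = 1"
  shows "F i (F i (F j x)) - (q + 1 / q) *\<^sub>R F i (F j (F i x)) + F j (F i (F i x)) = 0"
proof (rule V_eqI)
  fix u assume u: "u \<in> V"
  have "E i (E i (E j u)) - (q + 1 / q) *\<^sub>R E i (E j (E i u)) + E j (E i (E i u)) = 0"
    using relations i j u ij by (simp add: uq_relations_on_def)
  then have "cinner (E i (E i (E j u)) - (q + 1 / q) *\<^sub>R E i (E j (E i u)) + E j (E i (E i u))) x = 0"
    by simp
  then show "cinner u (F i (F i (F j x)) - (q + 1 / q) *\<^sub>R F i (F j (F i x)) + F j (F i (F i x))) = cinner u 0"
    using i j u x by (simp add: cinner_add_right cinner_diff_right cinner_add_left cinner_diff_left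
        cinner_scaleR_left cinner_scaleR_right adj_E in_V algebra_simps)
qed (use i j x in \<open>auto intro!: in_V add_V diff_V scaleR_V complex_vector.subspace_0[OF V]\<close>)

lemma F_comm:
  assumes i: "i \<in> {1..l}" and j: "j \<in> {1..l}" and x: "x \<in> V" and ij: "\<bar>int i - int j\<bar> > 1"
  shows "F i (F j x) = F j (F i x)"
proof (rule V_eqI)
  fix u assume u: "u \<in> V"
  have "E i (E j u) = E j (E i u)"
    using relations i j u ij by (simp add: uq_relations_on_def)
  then show "cinner u (F i (F j x)) = cinner u (F j (F i x))"
    using i j u x by (simp add: adj_E in_V)
qed (use i j x in \<open>auto intro!: in_V\<close>)

definition fv :: "nat list \<Rightarrow> 'h" where
  "fv w = foldr (\<lambda>i. F i) w v"

lemma fv_simps [simp]: "fv [] = v" "fv (i # w) = F i (fv w)"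
  by (simp_all add: fv_def)

lemma fv_V: "set w \<subseteq> {1..l} \<Longrightarrow> fv w \<in> V"
  by (induction w) (auto simp: v in_V)

lemma K_fv:
  assumes "i \<in> {1..l}" "set w \<subseteq> {1..l}"
  shows "K i (fv w) = (q powr (word_weight n i w / 2)) *\<^sub>R fv w"
  using assms(2)
proof (induction w)
  case Nil
  then show ?case using K_v assms by (simp add: word_weight_def)
next
  case (Cons j w)
  then have "K i (fv (j # w)) = (q powr (- cartan i j / 2) * q powr (word_weight n i w / 2)) *\<^sub>R fv (j # w)"
    using assms(1) by (simp add: K_F fv_V g_scaleR)
  also have "q powr (- cartan i j / 2) * q powr (word_weight n i w / 2) = q powr (word_weight n i (j # w) / 2)"
    using q by (simp add: powr_add[symmetric] word_weight_def diff_divide_distrib add_divide_distrib algebra_simps)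
  finally show ?case .
qed

lemma Ki_fv:
  assumes "i \<in> {1..l}" "set w \<subseteq> {1..l}"
  shows "Ki i (fv w) = (q powr (- word_weight n i w / 2)) *\<^sub>R fv w"
proof -
  have "Ki i (fv w) = Ki i ((q powr (- word_weight n i w / 2)) *\<^sub>R K i (fv w))"
    using q unfolding K_fv[OF assms] by (simp add: powr_add[symmetric])
  also have "\<dots> = (q powr (- word_weight n i w / 2)) *\<^sub>R fv w"
    using assms by (simp add: g_scaleR in_V fv_V Ki_K)
  finally show ?thesis .
qed

abbreviation "cf \<equiv> \<lambda>i w. q_bracket q (word_weight n i w)"

lemma E_fv:
  assumes "i \<in> {1..l}" "set w \<subseteq> {1..l}"
  shows "E i (fv w) = (\<Sum>(c, u)\<leftarrow>raise_word cf i w. c *\<^sub>R fv u)"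
  using assms(2)
proof (induction w)
  case Nil
  then show ?case using E_v assms by simp
next
  case (Cons j w)
  then have j: "j \<in> {1..l}" and w: "set w \<subseteq> {1..l}" by auto
  \<comment> \<open>The generators are linear on \<open>V\<close> only, so membership of the partial
    sums in \<open>V\<close> is carried through the induction.\<close>
  have sub: "set ps \<subseteq> set (raise_word cf i w) \<Longrightarrow>
     F j (\<Sum>(c, u)\<leftarrow>ps. c *\<^sub>R fv u) = (\<Sum>(c, u)\<leftarrow>ps. c *\<^sub>R F j (fv u)) \<and> (\<Sum>(c, u)\<leftarrow>ps. c *\<^sub>R fv u) \<in> V" for ps
  proof (induction ps)
    case Nil
    then show ?case using j by (simp add: g_0 complex_vector.subspace_0[OF V])
  next
    case (Cons p ps)
    then have "fv (snd p) \<in> V"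
      using set_raise_word[of "fst p" "snd p"] w by (intro fv_V) fastforce
    then show ?case using Cons j
      by (auto simp: split_beta g_add g_scaleR scaleR_V add_V)
  qed
  have "F j (E i (fv w)) = (\<Sum>(c, u)\<leftarrow>raise_word cf i w. c *\<^sub>R fv (j # u))"
    using sub[OF order_refl] Cons w by simp
  moreover have "K i (K i (fv w)) - Ki i (Ki i (fv w)) =
     (q powr word_weight n i w - q powr (- word_weight n i w)) *\<^sub>R fv w"
    using assms(1) w by (simp add: K_fv Ki_fv g_scaleR fv_V powr_add[symmetric] scaleR_diff_left)
  then have "(1 / (q - 1 / q)) *\<^sub>R (K i (K i (fv w)) - Ki i (Ki i (fv w))) = cf i w *\<^sub>R fv w"
    by (simp add: q_bracket_def)
  ultimately show ?case
    using E_F[OF assms(1) j fv_V[OF w]]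
    by (cases "i = j") (simp_all add: o_def case_prod_unfold add.commute)
qed

text \<open>The vector \<open>v\<close> is not normalised, hence the factor
  \<open>(norm v)\<^sup>2\<close>. Apart from it the inner products depend on the highest weight
  alone, which makes representations with different \<open>m\<close> comparable.\<close>

lemma cinner_fv:
  assumes "set I \<subseteq> {1..l}" "set J \<subseteq> {1..l}"
  shows "cinner (fv I) (fv J) = of_real (word_gram cf I J * (norm v)\<^sup>2)"
  using assms
proof (induction I arbitrary: J)
  case Nil
  show ?case
  proof (cases J)
    case Nil
    then show ?thesis by (simp add: cinner_self)
  next
    case (Cons j J')
    then show ?thesis using \<open>set J \<subseteq> {1..l}\<close> v by (simp add: adj_E fv_V E_v)
  qed
next
  case (Cons i I)
  have sub: "set ps \<subseteq> set (raise_word cf i J) \<Longrightarrow> cinner (fv I) (\<Sum>(c, u)\<leftarrow>ps. c *\<^sub>R fv u)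
      = of_real ((\<Sum>(c, u)\<leftarrow>ps. c * word_gram cf I u) * (norm v)\<^sup>2)" for ps
  proof (induction ps)
    case (Cons p ps)
    then have "set (snd p) \<subseteq> {1..l}"
      using set_raise_word[of "fst p" "snd p" cf i J] Cons.prems \<open>set J \<subseteq> {1..l}\<close> by fastforce
    then have "cinner (fv I) (fv (snd p)) = of_real (word_gram cf I (snd p) * (norm v)\<^sup>2)"
      using \<open>set (i # I) \<subseteq> {1..l}\<close> Cons.prems
        \<open>\<And>J. set I \<subseteq> {1..l} \<Longrightarrow> set J \<subseteq> {1..l} \<Longrightarrow> cinner (fv I) (fv J) = of_real (word_gram cf I J * (norm v)\<^sup>2)\<close>
      by simp
    then show ?case using Cons
      by (simp add: split_beta cinner_add_right cinner_scaleR_right algebra_simps)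
  qed simp
  have "cinner (fv (i # I)) (fv J) = cinner (fv I) (E i (fv J))"
    using Cons.prems by (simp add: adj_F fv_V)
  also have "\<dots> = of_real (word_gram cf (i # I) J * (norm v)\<^sup>2)"
    using Cons.prems by (simp add: E_fv sub)
  finally show ?case .
qed

definition level :: "nat \<Rightarrow> 'h set" where
  "level r = cspan (fv ` words l r)"

text \<open>By \<open>E_fv\<close>, \<open>K_fv\<close> and \<open>Ki_fv\<close> the span of the
  words is invariant under all generators, not only under the \<open>F i\<close>; as it contains
  \<open>v\<close>, irreducibility makes it everything.\<close>

lemma V_eq_span: "V = cspan (fv ` {w. set w \<subseteq> {1..l}})"
proof -
  let ?S = "fv ` {w. set w \<subseteq> {1..l}}"
  have sub: "cspan ?S \<subseteq> V"
    by (rule complex_vector.span_minimal[OF _ V]) (auto intro: fv_V)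
  have base: "fv w \<in> cspan ?S" if "set w \<subseteq> {1..l}" for w
    using that by (intro complex_vector.span_base) auto
  have baseR: "c *\<^sub>R fv w \<in> cspan ?S" if "set w \<subseteq> {1..l}" for w c
    unfolding scaleR_scaleC by (intro complex_vector.span_scale base that)
  have gen: "\<rho> g (fv w) \<in> cspan ?S" if g: "g \<in> uq_gens l" and w: "set w \<subseteq> {1..l}" for g w
  proof -
    have sl: "(\<Sum>(c, u)\<leftarrow>ps. c *\<^sub>R fv u) \<in> cspan ?S" if "\<forall>(c, u)\<in>set ps. set u \<subseteq> {1..l}" for ps
      using that by (induction ps) (auto intro!: complex_vector.span_add baseR complex_vector.span_zero)
    have Ecase: "E i (fv w) \<in> cspan ?S" if i: "i \<in> {1..l}" for i
      unfolding E_fv[OF i w]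
    proof (rule sl, clarify)
      fix c u j assume "(c, u) \<in> set (raise_word cf i w)" "j \<in> set u"
      then show "j \<in> {1..l}" using set_raise_word[of c u cf i w] w by blast
    qed
    obtain i where i: "i \<in> {1..l}" "g = genK i \<or> g = genKinv i \<or> g = genE i \<or> g = genF i"
      using g by (auto simp: uq_gens_def)
    have "F i (fv w) \<in> cspan ?S" using base[of "i # w"] i w by simp
    then show ?thesis using i Ecase[OF i(1)] baseR[OF w] K_fv[OF i(1) w] Ki_fv[OF i(1) w] by auto
  qed
  have inv: "\<rho> g x \<in> cspan ?S \<and> x \<in> V" if g: "g \<in> uq_gens l" and x: "x \<in> cspan ?S" for g x
    using x
  proof (induction rule: complex_vector.span_induct_alt)
    case base
    show ?case using g by (simp add: g_0 complex_vector.span_zero complex_vector.subspace_0[OF V])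
  next
    case (step c x y)
    then have xy: "x \<in> V" "y \<in> V" "c *\<^sub>C x \<in> V"
      by (auto intro: fv_V complex_vector.subspace_scale[OF V])
    then have "\<rho> g (c *\<^sub>C x + y) = c *\<^sub>C \<rho> g x + \<rho> g y" using g by (simp add: g_add g_scaleC)
    then show ?case using step gen[OF g] xy
      by (auto intro!: complex_vector.span_add complex_vector.span_scale add_V)
  qed
  have "cspan ?S = {0} \<or> cspan ?S = V"
    using irr sub inv unfolding uq_irreducible_def
    by (meson complex_vector.subspace_span image_subsetI)
  moreover have "v \<in> cspan ?S" using base[of "[]"] by simp
  ultimately show ?thesis using v by auto
qed

end

text \<open>Written this way, the dimension depends only on which sets of indices are independent.
  The indices are words and do not change with the representation, whereas the spanned spaces
  do.\<close>

lemma dim_span_image_eq_Max: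
  fixes u :: "'i \<Rightarrow> 'a::complex_hilbert_space"
  assumes W: "finite W"
  shows "complex_vector.dim (cspan (u ` W)) =
    Max (card ` {S. S \<subseteq> W \<and> inj_on u S \<and> complex_vector.independent (u ` S)})"
proof -
  let ?\<S> = "{S. S \<subseteq> W \<and> inj_on u S \<and> complex_vector.independent (u ` S)}"
  obtain B where B: "B \<subseteq> u ` W" "complex_vector.independent B" "u ` W \<subseteq> cspan B"
    using complex_vector.maximal_independent_subset[of "u ` W"] by blast
  then have fB: "finite B" using W finite_surj by blast
  have spB: "cspan (u ` W) \<subseteq> cspan B"
    using B(3) by (intro complex_vector.span_minimal complex_vector.subspace_span)
  have dim: "complex_vector.dim (cspan (u ` W)) = card B"
    using B spB by (intro complex_vector.basis_card_eq_dim[symmetric])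
      (auto intro: complex_vector.span_base)
  obtain S where S: "S \<subseteq> W" "inj_on u S" "B = u ` S"
    using B(1) unfolding subset_image_inj by blast
  have fin: "finite ?\<S>" by (rule finite_subset[of _ "Pow W"]) (use W in auto)
  have "Max (card ` ?\<S>) = card B"
  proof (rule Max_eqI)
    show "card B \<in> card ` ?\<S>" using S B by (intro image_eqI[of _ _ S]) (auto simp: card_image)
    fix y assume "y \<in> card ` ?\<S>"
    then obtain T where T: "T \<subseteq> W" "inj_on u T" "complex_vector.independent (u ` T)" "y = card T" by auto
    have "u ` T \<subseteq> cspan B" using T(1) B(3) by blast
    then have "card (u ` T) \<le> card B"
      using complex_vector.independent_span_bound[OF fB T(3)] by blast
    then show "y \<le> card B" using T by (simp add: card_image)
  qed (use fin in auto)
  then show ?thesis using dim by simp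
qed

lemma cinner_span_eq_0:
  assumes "\<And>a b. a \<in> A \<Longrightarrow> b \<in> B \<Longrightarrow> cinner a b = 0" and "x \<in> cspan A" "y \<in> cspan B"
  shows "cinner x (y::'a::complex_hilbert_space) = 0"
proof -
  have "cspan B \<subseteq> {y. \<forall>e\<in>A. cinner e y = 0}"
    using assms(1) by (intro complex_vector.span_minimal csubspace_Collect_cinner) auto
  then have 1: "cinner e y = 0" if "e \<in> A" for e using assms(3) that by auto
  have "cspan A \<subseteq> {x. \<forall>e\<in>{y}. cinner e x = 0}"
  proof (intro complex_vector.span_minimal csubspace_Collect_cinner, clarify)
    fix x assume "x \<in> A"
    then show "cinner y x = 0" using 1[of x] by (metis cinner_commute complex_cnj_zero)
  qed
  then have "cinner y x = 0" using assms(2) by auto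
  then show ?thesis by (metis cinner_commute complex_cnj_zero)
qed

definition gram_indep :: "('i \<Rightarrow> 'i \<Rightarrow> real) \<Rightarrow> 'i set \<Rightarrow> bool" where
  "gram_indep g S \<longleftrightarrow>
     (\<forall>c. (\<forall>I\<in>S. (\<Sum>J\<in>S. g I J * c J) = 0) \<longrightarrow> (\<forall>J\<in>S. c J = 0))"

section \<open>Pairing with \<open>2\<rho>\<close> and the eigenvalues of
  \<open>K2rho\<close>\<close>

definition rho_weight :: "nat \<Rightarrow> (nat \<Rightarrow> nat) \<Rightarrow> nat" where
  "rho_weight l n = (\<Sum>j\<in>{1..l}. j * (l - j + 1) * n j)"

definition K2rho_idx :: "nat \<Rightarrow> nat list" where
  "K2rho_idx l = (let w = concat (map (\<lambda>j. replicate (j * (l - j + 1)) j) [1..<l + 1]) in w @ w)"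

lemma K2rho_eq: "K2rho l = map genK (K2rho_idx l)"
  by (simp add: K2rho_def K2rho_idx_def Let_def map_concat o_def map_replicate_trivial)

lemma set_K2rho_idx: "set (K2rho_idx l) \<subseteq> {1..l}"
  by (auto simp: K2rho_idx_def Let_def)

lemma sum_K2rho_idx:
  fixes f :: "nat \<Rightarrow> int"
  shows "(\<Sum>j\<leftarrow>K2rho_idx l. f j) = 2 * (\<Sum>j\<in>{1..l}. int (j * (l - j + 1)) * f j)"
proof -
  have "(\<Sum>j\<leftarrow>concat (map (\<lambda>j. replicate (c j) j) xs). f j) = (\<Sum>j\<leftarrow>xs. int (c j) * f j)" for c xs
    by (induction xs) (simp_all add: sum_list_replicate)
  moreover have "(\<Sum>j\<leftarrow>[1..<l + 1]. int (j * (l - j + 1)) * f j) = (\<Sum>j\<in>{1..l}. int (j * (l - j + 1)) * f j)"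
    unfolding interv_sum_list_conv_sum_set_nat by (intro sum.cong) auto
  ultimately show ?thesis by (simp add: K2rho_idx_def Let_def del: upt_Suc)
qed

text \<open>\<open>2\<rho>\<close> pairs to \<open>2\<close> with every simple root.\<close>

lemma sum_rho_cartan:
  assumes i: "i \<in> {1..l}"
  shows "(\<Sum>j\<in>{1..l}. int (j * (l - j + 1)) * cartan j i) = 2"
proof -
  let ?c = "\<lambda>j. int j * (int l - int j + 1)"
  have "(\<Sum>j\<in>{1..l}. int (j * (l - j + 1)) * cartan j i) = (\<Sum>j\<in>{1..l}. ?c j * cartan j i)"
  proof (intro sum.cong refl)
    fix j assume "j \<in> {1..l}"
    then have "int (j * (l - j + 1)) = ?c j" by (simp add: of_nat_diff distrib_left)
    then show "int (j * (l - j + 1)) * cartan j i = ?c j * cartan j i" by simp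
  qed
  \<comment> \<open>The coefficient \<open>j * (l + 1 - j)\<close> vanishes at \<open>0\<close> and
    \<open>l + 1\<close>, so the end nodes may be treated as if they too had two neighbours. What is
    left is minus a second difference of a quadratic.\<close>
  also have "\<dots> = (\<Sum>j\<in>{0..l + 1}. ?c j * cartan j i)"
    by (intro sum.mono_neutral_left) (auto simp: not_le le_Suc_eq)
  also have "\<dots> = (\<Sum>j\<in>{i - 1, i, i + 1}. ?c j * cartan j i)"
    using i by (intro sum.mono_neutral_right) (auto simp: cartan_def)
  also have "\<dots> = - ?c (i - 1) + 2 * ?c i - ?c (i + 1)"
  proof -
    obtain k where "i = Suc k" using i by (cases i) auto
    then show ?thesis by (simp add: cartan_def)
  qed
  also have "\<dots> = 2" using i by (auto simp: algebra_simps of_nat_diff)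
  finally show ?thesis .
qed

text \<open>By \<open>sum_rho_cartan\<close> each letter, whichever it is, lowers the pairing by
  \<open>2\<close>. Hence the eigenvalue sees only the length of the word, and grading by length
  suffices.\<close>

lemma sum_rho_word_weight:
  assumes "set w \<subseteq> {1..l}"
  shows "(\<Sum>j\<in>{1..l}. int (j * (l - j + 1)) * word_weight n j w) = int (rho_weight l n) - 2 * int (length w)"
  using assms
proof (induction w)
  case Nil
  then show ?case by (simp add: word_weight_def rho_weight_def)
next
  case (Cons i w)
  have "word_weight n j (i # w) = word_weight n j w - cartan j i" for j by (simp add: word_weight_def)
  then have "(\<Sum>j\<in>{1..l}. int (j * (l - j + 1)) * word_weight n j (i # w)) =
     (\<Sum>j\<in>{1..l}. int (j * (l - j + 1)) * word_weight n j w) - (\<Sum>j\<in>{1..l}. int (j * (l - j + 1)) * cartan j i)"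
    by (simp only: right_diff_distrib sum_subtractf)
  then show ?case using Cons sum_rho_cartan[of i l] by simp
qed

context hw_rep
begin

lemma level_subset_V: "level r \<subseteq> V"
  unfolding level_def by (rule complex_vector.span_minimal[OF _ V]) (auto simp: words_def intro: fv_V)

lemma V_eq_levels: "V = cspan (\<Union>r. level r)"
proof
  show "V \<subseteq> cspan (\<Union>r. level r)"
    unfolding V_eq_span
  proof (rule complex_vector.span_mono, clarify)
    fix w assume "set w \<subseteq> {1..l}"
    then have "fv w \<in> level (length w)"
      unfolding level_def by (intro complex_vector.span_base) (auto simp: words_def)
    then show "fv w \<in> (\<Union>r. level r)" by blast
  qed
  show "cspan (\<Union>r. level r) \<subseteq> V"
    using level_subset_V by (intro complex_vector.span_minimal V) auto
qed

lemma level_orth: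
  assumes "r \<noteq> s" "x \<in> level r" "y \<in> level s"
  shows "cinner x y = 0"
proof (rule cinner_span_eq_0[OF _ assms(2,3)[unfolded level_def]])
  fix a b assume "a \<in> fv ` words l r" "b \<in> fv ` words l s"
  then obtain I J where I: "a = fv I" "b = fv J" "set I \<subseteq> {1..l}" "set J \<subseteq> {1..l}" "length I \<noteq> length J"
    using assms(1) by (auto simp: words_def)
  then show "cinner a b = 0" by (simp add: cinner_fv word_gram_length)
qed

lemma foldr_K_V: "set js \<subseteq> {1..l} \<Longrightarrow> x \<in> V \<Longrightarrow> foldr \<rho> (map genK js) x \<in> V"
  by (induction js) (auto intro: in_V)

lemma foldr_K_add:
  "set js \<subseteq> {1..l} \<Longrightarrow> x \<in> V \<Longrightarrow> y \<in> V \<Longrightarrow>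
    foldr \<rho> (map genK js) (c *\<^sub>C x + y) = c *\<^sub>C foldr \<rho> (map genK js) x + foldr \<rho> (map genK js) y"
  by (induction js) (auto simp: g_add g_scaleC foldr_K_V complex_vector.subspace_scale[OF V])

lemma foldr_K_fv:
  assumes "set js \<subseteq> {1..l}" "set w \<subseteq> {1..l}"
  shows "foldr \<rho> (map genK js) (fv w) = (q powr ((\<Sum>j\<leftarrow>js. word_weight n j w) / 2)) *\<^sub>R fv w"
  using assms(1)
proof (induction js)
  case (Cons j js)
  then have "foldr \<rho> (map genK (j # js)) (fv w) =
    (q powr ((\<Sum>j\<leftarrow>js. word_weight n j w) / 2) * q powr (word_weight n j w / 2)) *\<^sub>R fv w"
    using assms(2) by (simp add: g_scaleR fv_V K_fv)
  also have "q powr ((\<Sum>j\<leftarrow>js. word_weight n j w) / 2) * q powr (word_weight n j w / 2) =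
    q powr ((\<Sum>j\<leftarrow>j # js. word_weight n j w) / 2)"
    by (simp add: powr_add[symmetric] add_divide_distrib add.commute)
  finally show ?case .
qed (use q in auto)

text \<open>The reversed word is included because it is the adjoint of the word for
  \<open>K2rho\<close>.\<close>

lemma K2rho_level:
  assumes js: "js = K2rho_idx l \<or> js = rev (K2rho_idx l)" and x: "x \<in> level r"
  shows "foldr \<rho> (map genK js) x = (q powr (real (rho_weight l n) - 2 * real r)) *\<^sub>R x"
proof -
  have sub: "set js \<subseteq> {1..l}" using js set_K2rho_idx[of l] by (metis set_rev)
  let ?c = "q powr (real (rho_weight l n) - 2 * real r)"
  have base: "foldr \<rho> (map genK js) x = ?c *\<^sub>R x" if x: "x \<in> fv ` words l r" for x
  proof -
    obtain w where w: "x = fv w" "set w \<subseteq> {1..l}" "length w = r" using x by (auto simp: words_def)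
    have "(\<Sum>j\<leftarrow>js. word_weight n j w) = (\<Sum>j\<leftarrow>K2rho_idx l. word_weight n j w)"
      using js by (auto simp: rev_map[symmetric] sum_list_rev)
    also have "\<dots> = 2 * (int (rho_weight l n) - 2 * int r)"
      unfolding sum_K2rho_idx sum_rho_word_weight[OF w(2)] w(3) ..
    finally have "real_of_int (\<Sum>j\<leftarrow>js. word_weight n j w) / 2 = real (rho_weight l n) - 2 * real r" by simp
    then show ?thesis unfolding w(1) foldr_K_fv[OF sub w(2)] by (simp only:)
  qed
  have "foldr \<rho> (map genK js) x = ?c *\<^sub>R x \<and> x \<in> V"
    using x unfolding level_def
  proof (induction rule: complex_vector.span_induct_alt)
    case base
    have "foldr \<rho> (map genK js) 0 = 0"
      using foldr_K_add[OF sub complex_vector.subspace_0[OF V] complex_vector.subspace_0[OF V], of "-1"]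
      by simp
    then show ?case using complex_vector.subspace_0[OF V] by simp
  next
    case (step c x y)
    then have xV: "x \<in> V" by (auto simp: words_def intro: fv_V)
    then show ?case using step base[of x]
      by (auto simp: foldr_K_add[OF sub] scaleR_scaleC scaleC_scaleC scaleC_add_right mult.commute
          add_V complex_vector.subspace_scale[OF V])
  qed
  then show ?thesis by simp
qed

text \<open>A combination orthogonal to all its constituents is orthogonal to itself, hence zero: so
  linear relations are exactly the kernel of the Gram matrix. The matrix is real, so a complex
  kernel vector splits into real and imaginary parts.\<close>

lemma indep_iff_gram_indep:
  assumes S: "finite S" "\<And>I. I \<in> S \<Longrightarrow> set I \<subseteq> {1..l}"
  shows "inj_on fv S \<and> complex_vector.independent (fv ` S) \<longleftrightarrow> gram_indep (word_gram cf) S"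
proof -
  have lc: "inj_on fv S \<and> complex_vector.independent (fv ` S) \<longleftrightarrow>
     (\<forall>c. (\<Sum>J\<in>S. c J *\<^sub>C fv J) = 0 \<longrightarrow> (\<forall>J\<in>S. c J = 0))" (is "_ \<longleftrightarrow> ?R")
  proof
    assume ind: "inj_on fv S \<and> complex_vector.independent (fv ` S)"
    show ?R
    proof (intro allI impI ballI)
      fix c J assume c: "(\<Sum>J\<in>S. c J *\<^sub>C fv J) = 0" and J: "J \<in> S"
      define d where "d x = c (the_inv_into S fv x)" for x
      have "(\<Sum>x\<in>fv ` S. d x *\<^sub>C x) = 0"
        using c ind by (subst sum.reindex) (auto simp: d_def the_inv_into_f_f)
      then have "d (fv J) = 0"
        using ind S J complex_vector.independentD[of "fv ` S" "fv ` S" d "fv J"] by auto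
      then show "c J = 0" using ind J by (simp add: d_def the_inv_into_f_f)
    qed
  next
    assume R: ?R
    have inj: "inj_on fv S"
    proof (rule inj_onI, rule ccontr)
      fix I J assume IJ: "I \<in> S" "J \<in> S" "fv I = fv J" "I \<noteq> J"
      let ?c = "\<lambda>L. if L = I then 1 :: complex else if L = J then -1 else 0"
      have "(\<Sum>L\<in>S. ?c L *\<^sub>C fv L) = (\<Sum>L\<in>{I, J}. ?c L *\<^sub>C fv L)"
        using S IJ by (intro sum.mono_neutral_right) auto
      also have "\<dots> = 0" using IJ by simp
      finally have "\<forall>L\<in>S. ?c L = 0" by (rule R[THEN spec, THEN mp])
      from bspec[OF this IJ(1)] show False by simp
    qed
    moreover have "complex_vector.independent (fv ` S)"
      unfolding complex_vector.independent_explicit_finite_subsets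
    proof (intro allI impI ballI)
      fix A u x assume A: "A \<subseteq> fv ` S" "finite A" "(\<Sum>x\<in>A. u x *\<^sub>C x) = 0" "x \<in> A"
      let ?c = "\<lambda>J. if fv J \<in> A then u (fv J) else 0"
      have "(\<Sum>J\<in>S. ?c J *\<^sub>C fv J) = (\<Sum>x\<in>fv ` S. (if x \<in> A then u x else 0) *\<^sub>C x)"
        by (subst sum.reindex[OF inj]) (simp add: o_def)
      also have "\<dots> = (\<Sum>x\<in>A. u x *\<^sub>C x)"
        using A S by (intro sum.mono_neutral_cong_right) auto
      finally have "(\<Sum>J\<in>S. ?c J *\<^sub>C fv J) = 0" unfolding A(3) .
      then have c0: "\<forall>J\<in>S. ?c J = 0" by (rule R[THEN spec, THEN mp])
      obtain J where "J \<in> S" "x = fv J" using A by auto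
      then show "u x = 0" using c0 A(4) by auto
    qed
    ultimately show "inj_on fv S \<and> complex_vector.independent (fv ` S)" by blast
  qed
  have gr: "cinner (fv I) (\<Sum>J\<in>S. c J *\<^sub>C fv J) = of_real ((norm v)\<^sup>2) * (\<Sum>J\<in>S. of_real (word_gram cf I J) * c J)"
    if "I \<in> S" for I c
    using S that by (auto simp: cinner_sum_right cinner_scaleC_right cinner_fv sum_distrib_left mult_ac
        intro!: sum.cong)
  show ?thesis unfolding lc
  proof
    assume R: "\<forall>c. (\<Sum>J\<in>S. c J *\<^sub>C fv J) = 0 \<longrightarrow> (\<forall>J\<in>S. c J = 0)"
    show "gram_indep (word_gram cf) S"
      unfolding gram_indep_def
    proof (intro allI impI)
      fix c :: "nat list \<Rightarrow> real" assume c: "\<forall>I\<in>S. (\<Sum>J\<in>S. word_gram cf I J * c J) = 0"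
      let ?x = "\<Sum>J\<in>S. complex_of_real (c J) *\<^sub>C fv J"
      have "cinner (fv I) ?x = 0" if "I \<in> S" for I
        using c that unfolding gr[OF that] by (simp flip: of_real_mult of_real_sum)
      then have "cinner ?x ?x = 0"
      proof (intro cinner_span_eq_0[of "fv ` S" "{?x}" ?x ?x])
        show "?x \<in> cspan (fv ` S)"
          by (intro complex_vector.span_sum complex_vector.span_scale complex_vector.span_base imageI)
        show "?x \<in> cspan {?x}" by (intro complex_vector.span_base) simp
      qed auto
      then have "?x = 0" by (simp add: cinner_self)
      then have "\<forall>J\<in>S. complex_of_real (c J) = 0" using R[rule_format, of "\<lambda>J. complex_of_real (c J)"] by blast
      then show "\<forall>J\<in>S. c J = 0" by simp
    qed
  next
    assume G: "gram_indep (word_gram cf) S"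
    show "\<forall>c. (\<Sum>J\<in>S. c J *\<^sub>C fv J) = 0 \<longrightarrow> (\<forall>J\<in>S. c J = 0)"
    proof (intro allI impI)
      fix c assume c: "(\<Sum>J\<in>S. c J *\<^sub>C fv J) = 0"
      have 0: "(\<Sum>J\<in>S. of_real (word_gram cf I J) * c J) = 0" if "I \<in> S" for I
        using gr[OF that, of c] v unfolding c by simp
      have gi: "\<forall>J\<in>S. d J = 0" if "\<forall>I\<in>S. (\<Sum>J\<in>S. word_gram cf I J * d J) = 0" for d
        using G that unfolding gram_indep_def by blast
      have "\<forall>I\<in>S. (\<Sum>J\<in>S. word_gram cf I J * Re (c J)) = 0"
        using arg_cong[where f = Re, OF 0] by auto
      from gi[OF this] have "\<forall>J\<in>S. Re (c J) = 0" .
      moreover have "\<forall>I\<in>S. (\<Sum>J\<in>S. word_gram cf I J * Im (c J)) = 0"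
        using arg_cong[where f = Im, OF 0] by auto
      from gi[OF this] have "\<forall>J\<in>S. Im (c J) = 0" .
      ultimately show "\<forall>J\<in>S. c J = 0" by (simp add: complex_eq_iff)
    qed
  qed
qed

lemma dim_level:
  "complex_vector.dim (level r) = Max (card ` {S. S \<subseteq> words l r \<and> gram_indep (word_gram cf) S})"
proof -
  have "{S. S \<subseteq> words l r \<and> inj_on fv S \<and> complex_vector.independent (fv ` S)} =
     {S. S \<subseteq> words l r \<and> gram_indep (word_gram cf) S}"
  proof (intro Collect_cong conj_cong refl)
    fix S assume S: "S \<subseteq> words l r"
    then show "(inj_on fv S \<and> complex_vector.independent (fv ` S)) = gram_indep (word_gram cf) S"
      by (intro indep_iff_gram_indep finite_subset[OF S finite_words]) (auto simp: words_def)
  qed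
  then show ?thesis unfolding level_def dim_span_image_eq_Max[OF finite_words] by simp
qed

lemma dim_level_le: "complex_vector.dim (level r) \<le> (r + 1) ^ (\<Sum>i\<le>l. i + 1)"
proof -
  have "subspace V"
    using V by (auto simp: subspace_def complex_vector.subspace_def scaleR_scaleC)
  \<comment> \<open>The action is controlled on \<open>V\<close> only. Composing with an algebraic
    projection onto \<open>V\<close> yields endomorphisms of the whole space that satisfy the Serre
    relations everywhere.\<close>
  then obtain \<pi> where \<pi>: "range \<pi> \<subseteq> V" "linear \<pi>" "\<And>x. x \<in> V \<Longrightarrow> \<pi> x = x"
    using linear_exists_left_inverse_on[OF linear_id, of V] by auto
  define Fe where "Fe i = (if i \<in> {1..l} then Endo (\<lambda>x. F i (\<pi> x)) else 0)" for i
  have \<pi>V: "\<pi> x \<in> V" for x using \<pi>(1) by auto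
  have Fe: "endo_apply (Fe i) x = F i (\<pi> x)" if i: "i \<in> {1..l}" for i x
  proof -
    have "linear (\<lambda>x. F i (\<pi> x))"
      using i \<pi>V by (intro linearI) (simp_all add: linear_add[OF \<pi>(2)] linear_scale[OF \<pi>(2)] g_add g_scaleR)
    then show ?thesis using i by (simp add: Fe_def Endo_inverse)
  qed
  interpret q_serre q l Fe
  proof
    fix i j assume i: "i \<in> {1..l}" and j: "j \<in> {1..l}"
    have "\<pi> (F i (\<pi> x)) = F i (\<pi> x)" "\<pi> (F j (\<pi> x)) = F j (\<pi> x)"
      "\<pi> (F i (F j (\<pi> x))) = F i (F j (\<pi> x))" "\<pi> (F j (F i (\<pi> x))) = F j (F i (\<pi> x))"
      "\<pi> (F i (F i (\<pi> x))) = F i (F i (\<pi> x))" for x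
      using i j \<pi>V by (auto intro!: \<pi>(3) in_V)
    note simps = endo_apply_simps Fe[OF i] Fe[OF j] this
    show "Fe i * (Fe i * Fe j) - (q + 1 / q) *\<^sub>R (Fe i * (Fe j * Fe i)) + Fe j * (Fe i * Fe i) = 0"
      if "\<bar>int i - int j\<bar> = 1"
      by (rule endo_eqI) (simp add: simps F_serre[OF i j \<pi>V that])
    show "Fe i * Fe j = Fe j * Fe i" if "\<bar>int i - int j\<bar> > 1"
      by (rule endo_eqI) (simp add: simps F_comm[OF i j \<pi>V that])
  qed (use q in auto)
  have prod: "endo_apply (prod_list (map Fe w)) v = fv w" if "set w \<subseteq> {1..l}" for w
    using that by (induction w) (simp_all add: endo_apply_simps v Fe \<pi>(3) fv_V)
  \<comment> \<open>Evaluation at \<open>v\<close> sends a real combination of ordered monomials to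
    a vector in the complex span of their values, so the number of monomials bounds the complex
    dimension.\<close>
  let ?P = "pbw q Fe l r" and ?ev = "\<lambda>b. endo_apply b v"
  have P: "finite ?P" "card ?P \<le> (r + 1) ^ (\<Sum>i\<le>l. i + 1)" using finite_card_pbw by auto
  have "fv w \<in> cspan (?ev ` ?P)" if w: "w \<in> words l r" for w
  proof -
    have "prod_list (map Fe w) \<in> span ?P"
      using word_in_span_pbw[of w] w by (auto simp: words_def)
    then have "?ev (prod_list (map Fe w)) \<in> cspan (?ev ` ?P)"
    proof (induction rule: span_induct_alt)
      case (step c b y)
      then show ?case
        by (auto simp: endo_apply_simps scaleR_scaleC intro!: complex_vector.span_add complex_vector.span_scale
            intro: complex_vector.span_base)
    qed (simp add: endo_apply_simps complex_vector.span_zero)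
    then show ?thesis using w by (simp add: prod words_def)
  qed
  then have "level r \<subseteq> cspan (?ev ` ?P)"
    unfolding level_def by (intro complex_vector.span_minimal complex_vector.subspace_span) auto
  then have "complex_vector.dim (level r) \<le> card (?ev ` ?P)"
    using P by (intro complex_vector.dim_le_card) auto
  also have "\<dots> \<le> (r + 1) ^ (\<Sum>i\<le>l. i + 1)" using P card_image_le[OF P(1)] by (meson order_trans)
  finally show ?thesis .
qed

end

section \<open>Operators diagonal in a basis of eigenvectors\<close>

lemma orthonormal_set_imp_independent:
  assumes "orthonormal_set B"
  shows "complex_vector.independent B"
  unfolding complex_vector.independent_explicit_finite_subsets
proof (intro allI impI ballI)
  fix A u x assume A: "A \<subseteq> B" "finite A" "(\<Sum>x\<in>A. u x *\<^sub>C x) = 0" "x \<in> A"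
  have "0 = cinner x (\<Sum>x\<in>A. u x *\<^sub>C x)" using A by simp
  also have "\<dots> = (\<Sum>y\<in>A. if y = x then u x else 0)"
    unfolding cinner_sum_right cinner_scaleC_right
    using A assms by (intro sum.cong) (auto simp: orthonormal_set_def subset_iff)
  finally show "u x = 0" using A by simp
qed

lemma orthonormal_set_basis_exists:
  fixes S :: "'a::complex_hilbert_space set"
  assumes "finite S"
  shows "\<exists>B. finite B \<and> orthonormal_set B \<and> cspan B = cspan S \<and> card B = complex_vector.dim (cspan S)"
proof -
  have "\<exists>B. finite B \<and> orthonormal_set B \<and> cspan B = cspan S"
    using assms
  proof (induction S)
    case empty
    show ?case by (intro exI[of _ "{}"]) (simp add: orthonormal_set_def)
  next
    case (insert a S)
    then obtain B where B: "finite B" "orthonormal_set B" "cspan B = cspan S" by blast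
    define x where "x = a - oproj B a"
    show ?case
    proof (cases "x = 0")
      case True
      then have "a \<in> cspan S" using oproj_in_span[of B a] B(3) by (simp add: x_def)
      then have "cspan (insert a S) = cspan S" by (rule complex_vector.span_redundant)
      then show ?thesis using B by (intro exI[of _ B]) simp
    next
      case False
      define e where "e = complex_of_real (1 / norm x) *\<^sub>C x"
      have ex: "x = complex_of_real (norm x) *\<^sub>C e"
        using False by (simp add: e_def scaleC_scaleC scaleC_one)
      have fe: "cinner f e = 0" if "f \<in> B" for f
        using cinner_oproj_orth[OF B(2,1), of f a] that complex_vector.span_base[of f B]
        by (simp add: e_def x_def cinner_scaleC_right)
      have ef: "cinner e f = 0" if "f \<in> B" for f
        using fe[OF that] by (metis cinner_commute complex_cnj_zero)
      have "norm e = 1" using False by (simp add: e_def norm_scaleC norm_divide)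
      then have "cinner e e = 1" by (simp add: cinner_self)
      then have on: "orthonormal_set (insert e B)"
        using B(2) fe ef by (auto simp: orthonormal_set_def)
      have BS: "cspan B \<subseteq> cspan (insert a S)"
        unfolding B(3) by (intro complex_vector.span_mono) auto
      have ia: "x \<in> cspan (insert a S)"
        unfolding x_def
        by (intro complex_vector.span_diff complex_vector.span_base insertI1 subsetD[OF BS oproj_in_span])
      have "cspan (insert e B) = cspan (insert a S)"
      proof
        show "cspan (insert e B) \<subseteq> cspan (insert a S)"
          using ia BS complex_vector.span_base[of _ B]
          by (intro complex_vector.span_minimal complex_vector.subspace_span)
            (auto simp: e_def intro!: complex_vector.span_scale)
        have Bsub: "cspan B \<subseteq> cspan (insert e B)" by (intro complex_vector.span_mono) auto
        have "x \<in> cspan (insert e B)"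
          by (subst ex) (intro complex_vector.span_scale complex_vector.span_base insertI1)
        moreover have "oproj B a \<in> cspan (insert e B)" using Bsub oproj_in_span[of B a] by auto
        ultimately have "x + oproj B a \<in> cspan (insert e B)" by (rule complex_vector.span_add)
        then have "a \<in> cspan (insert e B)" by (simp add: x_def)
        moreover have "S \<subseteq> cspan (insert e B)"
          using Bsub complex_vector.span_base[of _ S] B(3) by auto
        ultimately show "cspan (insert a S) \<subseteq> cspan (insert e B)"
          by (intro complex_vector.span_minimal complex_vector.subspace_span) auto
      qed
      then show ?thesis using B on by (intro exI[of _ "insert e B"]) auto
    qed
  qed
  then obtain B where B: "finite B" "orthonormal_set B" "cspan B = cspan S" by blast
  then show ?thesis
    using complex_vector.dim_span_eq_card_independent[OF orthonormal_set_imp_independent[OF B(2)]] by auto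
qed

lemma linear_between_foldr:
  "(\<And>g. g \<in> set gs \<Longrightarrow> linear_between M M (\<rho> g)) \<Longrightarrow> linear_between M M (foldr \<rho> gs)"
  by (induction gs) (simp_all add: linear_between_def)

text \<open>The hypothesis \<open>adj\<close> places the graph inside a closed relation, and
  \<open>eig\<close> places the core of that relation inside the graph, so the closure is squeezed
  between equal sets.\<close>

lemma closure_graph_eq_diag_op:
  assumes B: "orthonormal_basis B" "B \<subseteq> M" and M: "csubspace M" and k: "linear_between M M k"
    and eig: "\<And>e. e \<in> B \<Longrightarrow> k e = \<kappa> e *\<^sub>R e"
    and adj: "\<And>e x. e \<in> B \<Longrightarrow> x \<in> M \<Longrightarrow> cinner e (k x) = of_real (\<kappa> e) * cinner e x"
  shows "closure {(x, k x) | x. x \<in> M} = diag_op B \<kappa>"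
proof
  show "closure {(x, k x) | x. x \<in> M} \<subseteq> diag_op B \<kappa>"
    using adj by (intro closure_minimal closed_diag_op) (auto simp: diag_op_def)
  have "csubspace {(x, k x) | x. x \<in> M}"
  proof (rule complex_vector.subspaceI)
    have "k (0 *\<^sub>C 0) = 0 *\<^sub>C k 0" using k complex_vector.subspace_0[OF M] unfolding linear_between_def by blast
    then have "k 0 = 0" by simp
    then show "0 \<in> {(x, k x) | x. x \<in> M}"
      using complex_vector.subspace_0[OF M] by (auto simp: zero_prod_def)
    show "p + r \<in> {(x, k x) | x. x \<in> M}" if "p \<in> {(x, k x) | x. x \<in> M}" "r \<in> {(x, k x) | x. x \<in> M}" for p r
      using that k complex_vector.subspace_add[OF M] by (auto simp: linear_between_def)
    show "c *\<^sub>C p \<in> {(x, k x) | x. x \<in> M}" if "p \<in> {(x, k x) | x. x \<in> M}" for c p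
      using that k complex_vector.subspace_scale[OF M] by (auto simp: linear_between_def scaleC_prod_def)
  qed
  then have "cspan {(e, \<kappa> e *\<^sub>R e) | e. e \<in> B} \<subseteq> {(x, k x) | x. x \<in> M}"
    using B(2) eig by (intro complex_vector.span_minimal) force+
  then show "diag_op B \<kappa> \<subseteq> closure {(x, k x) | x. x \<in> M}"
    unfolding diag_op_eq_closure[OF B(1)] by (rule closure_mono)
qed

lemma self_adjoint_square_symmetric:
  assumes D: "self_adjoint D" and "(x, x') \<in> op_comp D D" "(y, y') \<in> op_comp D D"
  shows "cinner x' y = cinner x y'"
proof -
  have sym: "cinner w y = cinner x z" if "(x, w) \<in> D" "(y, z) \<in> D" for x w y z
  proof -
    have "(y, z) \<in> op_adjoint D" using D that by (simp add: self_adjoint_def)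
    then show ?thesis using that(1) unfolding op_adjoint_def by auto
  qed
  obtain u w where "(x, u) \<in> D" "(u, x') \<in> D" "(y, w) \<in> D" "(w, y') \<in> D"
    using assms(2,3) unfolding op_comp_def by auto
  then show ?thesis using sym by metis
qed

text \<open>The functional calculus is built from all eigenvectors, not just those in
  \<open>B\<close>. Symmetry of the square makes an eigenvector for \<open>\<mu>\<close> orthogonal
  to every \<open>e\<close> with \<open>\<nu> e + 1 \<noteq> \<mu>\<close>, so the remaining
  coefficients are all multiplied by \<open>f \<mu>\<close>.\<close>

lemma pp_calculus_square_eq_diag_op:
  assumes B: "orthonormal_basis B" and D: "self_adjoint D"
    and eig: "\<And>e. e \<in> B \<Longrightarrow> (e, \<nu> e *\<^sub>R e) \<in> op_comp D D"
  shows "pp_calculus f (op_add (op_comp D D) Id) = diag_op B (\<lambda>e. f (\<nu> e + 1))"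
proof
  let ?A = "op_add (op_comp D D) Id"
  show "pp_calculus f ?A \<subseteq> diag_op B (\<lambda>e. f (\<nu> e + 1))"
    unfolding pp_calculus_def
  proof (intro closure_minimal complex_vector.span_minimal csubspace_diag_op closed_diag_op, clarify)
    fix x \<mu> assume "(x, \<mu> *\<^sub>R x) \<in> ?A"
    then obtain y where y: "(x, y) \<in> op_comp D D" "\<mu> *\<^sub>R x = y + x" by (auto simp: op_add_def)
    have "cinner e (f \<mu> *\<^sub>R x) = of_real (f (\<nu> e + 1)) * cinner e x" if e: "e \<in> B" for e
    proof -
      have "cinner (\<nu> e *\<^sub>R e) x = cinner e y"
        using self_adjoint_square_symmetric[OF D eig[OF e] y(1)] .
      then have "of_real (\<nu> e + 1) * cinner e x = cinner e (y + x)"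
        by (simp add: cinner_scaleR_left cinner_add_right distrib_right)
      also have "\<dots> = of_real \<mu> * cinner e x" unfolding y(2)[symmetric] by (rule cinner_scaleR_right)
      finally have "cinner e x = 0 \<or> \<nu> e + 1 = \<mu>"
        using mult_right_cancel of_real_eq_iff by blast
      then show ?thesis by (auto simp: cinner_scaleR_right)
    qed
    then show "(x, f \<mu> *\<^sub>R x) \<in> diag_op B (\<lambda>e. f (\<nu> e + 1))" by (simp add: diag_op_def)
  qed
  have "(e, (\<nu> e + 1) *\<^sub>R e) \<in> ?A" if "e \<in> B" for e
    using eig[OF that] unfolding op_add_def by (auto simp: scaleR_add_left)
  then show "diag_op B (\<lambda>e. f (\<nu> e + 1)) \<subseteq> pp_calculus f ?A"
    unfolding diag_op_eq_closure[OF B] pp_calculus_def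
    by (intro closure_mono complex_vector.span_mono) blast
qed

lemma zeta_operator_eq_diag_op:
  assumes B: "orthonormal_basis B" and D: "self_adjoint D"
    and eig: "\<And>e. e \<in> B \<Longrightarrow> (e, \<nu> e *\<^sub>R e) \<in> op_comp D D" and \<nu>: "\<And>e. e \<in> B \<Longrightarrow> 0 \<le> \<nu> e"
    and K: "K = diag_op B \<kappa>" and \<kappa>: "\<And>e. e \<in> B \<Longrightarrow> \<kappa> e \<noteq> 0" and s: "0 < s"
  shows "zeta_operator (K\<inverse>) D s = diag_op B (\<lambda>e. 1 / \<kappa> e * (\<nu> e + 1) powr (- s / 2))"
proof -
  have K': "K\<inverse> = diag_op B (\<lambda>e. 1 / \<kappa> e)" unfolding K using \<kappa> by (rule diag_op_converse)
  \<comment> \<open>The base is at least \<open>1\<close> and the exponent negative. This bound is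
    what allows composition with the possibly unbounded inverse of \<open>K\<close>.\<close>
  have le: "\<bar>(\<nu> e + 1) powr (- s / 2)\<bar> \<le> 1" if "e \<in> B" for e
  proof -
    have "(\<nu> e + 1) powr (- s / 2) \<le> (\<nu> e + 1) powr 0" using \<nu>[OF that] s by (intro powr_mono) auto
    then show ?thesis using \<nu>[OF that] by simp
  qed
  have pp: "pp_calculus f (op_add (op_comp D D) Id) = diag_op B (\<lambda>e. f (\<nu> e + 1))" for f
    by (rule pp_calculus_square_eq_diag_op[OF B D eig])
  show ?thesis
    unfolding zeta_operator_def pp K'
    by (rule op_comp_diag_op[where M = 1]) (use B le in auto)
qed

lemma adjoint_foldr_genK:
  assumes rep: "uq_star_rep q l \<rho> M" and js: "set js \<subseteq> {1..l}" and x: "x \<in> M" and y: "y \<in> M"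
  shows "cinner (foldr \<rho> (map genK js) x) y = cinner x (foldr \<rho> (map genK (rev js)) y)"
  using js y
proof (induction js arbitrary: y)
  case (Cons j js)
  have lin: "linear_between M M (\<rho> (genK i))" if "i \<in> {1..l}" for i
    using rep that by (auto simp: uq_star_rep_def uq_gens_def)
  have "linear_between M M (foldr \<rho> (map genK js))"
    using Cons.prems lin by (intro linear_between_foldr) auto
  then have mem: "foldr \<rho> (map genK js) x \<in> M" using x by (simp add: linear_between_def)
  have Kj: "\<rho> (genK j) y \<in> M" using lin[of j] Cons.prems by (auto simp: linear_between_def)
  have "cinner (\<rho> (genK j) (foldr \<rho> (map genK js) x)) y = cinner (foldr \<rho> (map genK js) x) (\<rho> (genK j) y)"
    using rep Cons.prems mem by (simp add: uq_star_rep_def)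
  then show ?case using Cons.IH[OF _ Kj] Cons.prems by simp
qed simp

section \<open>Dimensions in a family of representations\<close>

lemma gram_indep_iff_det:
  assumes ws: "distinct ws" "set ws = S"
  shows "gram_indep g S \<longleftrightarrow>
    Determinant.det (mat (length ws) (length ws) (\<lambda>(i, j). g (ws ! i) (ws ! j))) \<noteq> 0"
proof -
  let ?k = "length ws" and ?A = "mat (length ws) (length ws) (\<lambda>(i, j). g (ws ! i) (ws ! j))"
  have sum_ws: "(\<Sum>J\<in>S. f J) = (\<Sum>j<?k. f (ws ! j))" for f :: "_ \<Rightarrow> real"
    by (rule sum.reindex_bij_betw[OF bij_betw_nth[OF ws(1) refl ws(2)[symmetric]], symmetric])
  have mult: "vec_index (?A *\<^sub>v w) i = (\<Sum>j<?k. g (ws ! i) (ws ! j) * vec_index w j)" if "i < ?k" "w \<in> carrier_vec ?k" for w i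
    using that by (auto simp: scalar_prod_def atLeast0LessThan intro!: sum.cong)
  have "Determinant.det ?A = 0 \<longleftrightarrow> (\<exists>w. w \<in> carrier_vec ?k \<and> w \<noteq> 0\<^sub>v ?k \<and> ?A *\<^sub>v w = 0\<^sub>v ?k)"
    by (rule det_0_iff_vec_prod_zero_field) simp
  also have "\<dots> \<longleftrightarrow> \<not> gram_indep g S"
  proof
    assume "\<exists>w. w \<in> carrier_vec ?k \<and> w \<noteq> 0\<^sub>v ?k \<and> ?A *\<^sub>v w = 0\<^sub>v ?k"
    then obtain w where w: "w \<in> carrier_vec ?k" "w \<noteq> 0\<^sub>v ?k" "?A *\<^sub>v w = 0\<^sub>v ?k" by blast
    define c where "c J = vec_index w (the_inv_into {..<?k} ((!) ws) J)" for J
    have inj: "inj_on ((!) ws) {..<?k}" using ws(1) by (simp add: inj_on_nth)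
    have c: "c (ws ! j) = vec_index w j" if "j < ?k" for j
      using that unfolding c_def by (subst the_inv_into_f_f[OF inj]) auto
    have "(\<Sum>J\<in>S. g I J * c J) = 0" if I: "I \<in> S" for I
    proof -
      obtain i where i: "i < ?k" "I = ws ! i" using I ws in_set_conv_nth[of I ws] by auto
      have "(\<Sum>J\<in>S. g I J * c J) = vec_index (?A *\<^sub>v w) i"
        unfolding mult[OF i(1) w(1)] sum_ws using i c by (intro sum.cong) auto
      then show ?thesis using w i by simp
    qed
    moreover have "\<exists>j<?k. vec_index w j \<noteq> 0"
    proof (rule ccontr)
      assume "\<not> (\<exists>j<?k. vec_index w j \<noteq> 0)"
      then have "w = 0\<^sub>v ?k" using w(1) by (intro eq_vecI) auto
      then show False using w(2) by blast
    qed
    then obtain j where "j < ?k" "vec_index w j \<noteq> 0" by blast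
    then have "c (ws ! j) \<noteq> 0" "ws ! j \<in> S" using c ws by auto
    ultimately show "\<not> gram_indep g S" unfolding gram_indep_def by blast
  next
    assume "\<not> gram_indep g S"
    then obtain c J where c: "\<And>I. I \<in> S \<Longrightarrow> (\<Sum>J\<in>S. g I J * c J) = 0" "J \<in> S" "c J \<noteq> 0"
      unfolding gram_indep_def by blast
    define w where "w = Matrix.vec ?k (\<lambda>j. c (ws ! j))"
    have w: "w \<in> carrier_vec ?k" by (simp add: w_def)
    obtain j where j: "j < ?k" "J = ws ! j" using c(2) ws in_set_conv_nth[of J ws] by auto
    then have "vec_index w j \<noteq> vec_index (0\<^sub>v ?k) j" using c(3) by (simp add: w_def)
    then have "w \<noteq> 0\<^sub>v ?k" by blast
    moreover have "?A *\<^sub>v w = 0\<^sub>v ?k"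
    proof (rule eq_vecI)
      fix i assume "i < dim_vec (0\<^sub>v ?k :: real Matrix.vec)"
      then have i: "i < ?k" by simp
      then have "vec_index (?A *\<^sub>v w) i = (\<Sum>J\<in>S. g (ws ! i) J * c J)"
        unfolding mult[OF i w] sum_ws by (intro sum.cong) (auto simp: w_def)
      then show "vec_index (?A *\<^sub>v w) i = vec_index (0\<^sub>v ?k) i" using c(1)[of "ws ! i"] i ws by auto
    qed simp
    ultimately show "\<exists>w. w \<in> carrier_vec ?k \<and> w \<noteq> 0\<^sub>v ?k \<and> ?A *\<^sub>v w = 0\<^sub>v ?k" using w by blast
  qed
  finally show ?thesis by blast
qed

lemma gram_indep_scale: "s \<noteq> 0 \<Longrightarrow> gram_indep (\<lambda>I J. s * g I J) S \<longleftrightarrow> gram_indep g S"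
  by (simp add: gram_indep_def mult.assoc flip: sum_distrib_left)

lemma gram_indep_poly_eventually:
  fixes p :: "'i \<Rightarrow> 'i \<Rightarrow> real poly"
  assumes S: "finite S" and q: "0 < q" "q < 1"
  shows "\<exists>b. \<forall>\<^sub>F m in sequentially. gram_indep (\<lambda>I J. poly (p I J) (q ^ m)) S = b"
proof -
  obtain ws where ws: "distinct ws" "set ws = S" using finite_distinct_list[OF S] by blast
  define P where "P = Determinant.det (mat (length ws) (length ws) (\<lambda>(i, j). p (ws ! i) (ws ! j)))"
  have eq: "gram_indep (\<lambda>I J. poly (p I J) x) S \<longleftrightarrow> poly P x \<noteq> 0" for x
  proof -
    \<comment> \<open>Evaluation is a ring homomorphism and so commutes with the determinant: one
      polynomial \<open>P\<close> governs all \<open>m\<close> at once.\<close>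
    interpret ev: comm_ring_hom "\<lambda>p::real poly. poly p x" by unfold_locales auto
    have "map_mat (\<lambda>p. poly p x) (mat (length ws) (length ws) (\<lambda>(i, j). p (ws ! i) (ws ! j))) =
       mat (length ws) (length ws) (\<lambda>(i, j). poly (p (ws ! i) (ws ! j)) x)"
      by (rule eq_matI) auto
    then show ?thesis unfolding gram_indep_iff_det[OF ws] P_def ev.hom_det[symmetric] by simp
  qed
  show ?thesis
  proof (cases "P = 0")
    case True
    then show ?thesis unfolding eq by (intro exI[of _ False]) simp
  next
    case False
    have "inj (\<lambda>m. q ^ m)" using q by (auto intro!: injI dest: power_inject_exp[THEN iffD1, rotated] simp: power_inject_exp')
    then have "finite ((\<lambda>m. q ^ m) -` {x. poly P x = 0})"
      using poly_roots_finite[OF False] by (intro finite_vimageI) auto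
    then have "\<forall>\<^sub>F m in cofinite. poly P (q ^ m) \<noteq> 0"
      by (simp add: eventually_cofinite vimage_def)
    then show ?thesis unfolding eq cofinite_eq_sequentially by (intro exI[of _ True]) simp
  qed
qed

section \<open>Gram matrices over a polynomial ring\<close>

lemma raise_word_poly:
  fixes x :: "'a::comm_ring_1"
  assumes "\<And>i w. poly (p i w) x = x * c i w"
  shows "map (\<lambda>(a, u). (poly a x, u)) (raise_word p i J) = map (\<lambda>(a, u). (x * a, u)) (raise_word c i J)"
proof (induction J)
  case (Cons j J)
  have "map (\<lambda>(a, u). (poly a x, u)) (map (\<lambda>(a, u). (a, j # u)) (raise_word p i J)) =
    map (\<lambda>(a, u). (a, j # u)) (map (\<lambda>(a, u). (poly a x, u)) (raise_word p i J))"
    by (simp add: case_prod_unfold)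
  also have "\<dots> = map (\<lambda>(a, u). (x * a, u)) (map (\<lambda>(a, u). (a, j # u)) (raise_word c i J))"
    unfolding Cons by (simp add: case_prod_unfold)
  finally show ?case using assms by simp
qed simp

text \<open>Every letter of \<open>I\<close> contributes one value of the coefficient function, so
  the form is homogeneous of degree \<open>length I\<close> in it; scaling that function by
  \<open>x\<close> produces \<open>x ^ length I\<close>.\<close>

lemma word_gram_poly:
  fixes x :: "'a::comm_ring_1"
  assumes "\<And>i w. poly (p i w) x = x * c i w"
  shows "poly (word_gram p I J) x = x ^ length I * word_gram c I J"
proof (induction I arbitrary: J)
  case (Cons i I)
  have ps: "poly (sum_list (map f L)) x = sum_list (map (\<lambda>y. poly (f y) x) L)" for f :: "'a poly \<times> nat list \<Rightarrow> 'a poly" and L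
    by (induction L) (auto simp: case_prod_unfold)
  have "poly (word_gram p (i # I) J) x =
     (\<Sum>(a, u)\<leftarrow>map (\<lambda>(a, u). (poly a x, u)) (raise_word p i J). a * (x ^ length I * word_gram c I u))"
    unfolding word_gram.simps ps by (simp add: Cons case_prod_unfold o_def)
  also have "\<dots> = (\<Sum>(a, u)\<leftarrow>raise_word c i J. x ^ Suc (length I) * (a * word_gram c I u))"
    unfolding raise_word_poly[OF assms] by (simp add: case_prod_unfold o_def mult_ac)
  also have "\<dots> = x ^ length (i # I) * word_gram c (i # I) J"
    by (simp add: sum_list_const_mult[symmetric] case_prod_unfold)
  finally show ?case .
qed simp

text \<open>The dimension of a level as a function of the highest weight alone, so that the limit in
  \<open>m\<close> can be discussed without any representation.\<close>

definition level_dim :: "real \<Rightarrow> nat \<Rightarrow> (nat \<Rightarrow> nat) \<Rightarrow> nat \<Rightarrow> nat" where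
  "level_dim q l n r =
     Max (card ` {S. S \<subseteq> words l r \<and> gram_indep (word_gram (\<lambda>i w. q_bracket q (word_weight n i w))) S})"

lemma level_dim_eventually:
  assumes q: "0 < q" "q < 1" and n: "\<And>m i. n m i = s i + d i * m" and d: "\<And>i. d i \<le> (1::nat)"
  shows "\<exists>D. \<forall>\<^sub>F m in sequentially. level_dim q l (n m) r = D"
proof -
  \<comment> \<open>The quantum integer contains \<open>q\<close> to the powers
    \<open>d i * m\<close> and \<open>- d i * m\<close>. Multiplication by \<open>q ^ m\<close>
    clears the negative one and leaves the degrees \<open>1 + d i\<close> and \<open>1 - d i\<close>
    in \<open>q ^ m\<close>; \<open>d i \<le> 1\<close> keeps the subtraction exact.\<close>
  define p where "p i w = Polynomial.smult (1 / (q - 1 / q))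
    (monom (q powr word_weight s i w) (1 + d i) - monom (q powr (- word_weight s i w)) (1 - d i))" for i w
  let ?c = "\<lambda>m i w. q_bracket q (word_weight (n m) i w)"
  have p: "poly (p i w) (q ^ m) = q ^ m * ?c m i w" for m i w
  proof -
    have ww: "word_weight (n m) i w = word_weight s i w + int (d i * m)"
      by (simp add: word_weight_def n)
    have d: "d i = 0 \<or> d i = 1" using d[of i] by auto
    then have 1: "q ^ m * q powr (word_weight (n m) i w) = q powr word_weight s i w * (q ^ m) ^ (1 + d i)"
      using q by (auto simp: ww powr_add powr_realpow[symmetric] power2_eq_square)
    from d have 2: "q ^ m * q powr (- word_weight (n m) i w) = q powr (- word_weight s i w) * (q ^ m) ^ (1 - d i)"
      using q by (auto simp: ww powr_add powr_realpow[symmetric] powr_diff powr_minus field_simps)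
    have "q ^ m * ?c m i w = (1 / (q - 1 / q)) * (q ^ m * q powr (word_weight (n m) i w) - q ^ m * q powr (- word_weight (n m) i w))"
      by (simp add: q_bracket_def right_diff_distrib diff_divide_distrib)
    then show ?thesis unfolding 1 2 by (simp add: p_def poly_monom)
  qed
  have "\<exists>b. \<forall>\<^sub>F m in sequentially. gram_indep (word_gram (?c m)) S = b" if S: "S \<subseteq> words l r" for S
  proof -
    have "gram_indep (\<lambda>I J. poly (word_gram p I J) (q ^ m)) S = gram_indep (word_gram (?c m)) S" for m
    proof -
      have "gram_indep (\<lambda>I J. poly (word_gram p I J) (q ^ m)) S =
          gram_indep (\<lambda>I J. (q ^ m) ^ r * word_gram (?c m) I J) S"
        unfolding gram_indep_def using S
        by (auto simp: word_gram_poly[of p "q ^ m", OF p] words_def subset_iff)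
      also have "\<dots> = gram_indep (word_gram (?c m)) S" using q by (intro gram_indep_scale) simp
      finally show ?thesis .
    qed
    then show ?thesis
      using gram_indep_poly_eventually[OF finite_subset[OF S finite_words] q, of "word_gram p"] by simp
  qed
  then obtain b where b: "\<And>S. S \<subseteq> words l r \<Longrightarrow> \<forall>\<^sub>F m in sequentially. gram_indep (word_gram (?c m)) S = b S"
    by metis
  have "\<forall>\<^sub>F m in sequentially. \<forall>S\<in>Pow (words l r). gram_indep (word_gram (?c m)) S = b S"
    using b finite_words by (intro eventually_ball_finite) auto
  then have "\<forall>\<^sub>F m in sequentially. level_dim q l (n m) r = Max (card ` {S. S \<subseteq> words l r \<and> b S})"
  proof eventually_elim
    case (elim m)
    then have "{S. S \<subseteq> words l r \<and> gram_indep (word_gram (?c m)) S} = {S. S \<subseteq> words l r \<and> b S}" by auto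
    then show ?case by (simp add: level_dim_def)
  qed
  then show ?thesis by blast
qed

lemma (in hw_rep) dim_level_eq: "complex_vector.dim (level r) = level_dim q l n r"
  by (simp add: dim_level level_dim_def)

lemma (in hw_rep) dim_level_0: "level_dim q l n 0 \<ge> 1"
proof -
  have "words l 0 = {[]}" by (auto simp: words_def)
  then have "level 0 = cspan {v}" by (simp add: level_def)
  moreover have "complex_vector.independent {v}" using v by simp
  ultimately have "complex_vector.dim (level 0) = 1"
    using complex_vector.dim_span_eq_card_independent[of "{v}"] by (simp del: complex_vector.dim_span)
  then show ?thesis by (simp add: dim_level_eq)
qed

section \<open>Dominated convergence over the levels\<close>

lemma summable_poly_power:
  fixes x :: real
  assumes "0 \<le> x" "x < 1"
  shows "summable (\<lambda>r. (real r + 1) ^ p * x ^ r)"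
proof (cases "x = 0")
  case True
  then have "(real r + 1) ^ p * x ^ r = (if r = 0 then 1 else 0)" for r by (cases r) auto
  then show ?thesis by (simp add: summable_single)
next
  case False
  \<comment> \<open>Any ratio strictly between \<open>x\<close> and \<open>1\<close> would do:
    \<open>(x / y) ^ r\<close> absorbs the polynomial and \<open>y ^ r\<close> remains
    summable.\<close>
  define y where "y = (x + 1) / 2"
  have y: "x < y" "y < 1" "0 < y" using assms by (auto simp: y_def)
  have "(\<lambda>r. (real r + 1) ^ p * (x / y) ^ r) \<longlonglongrightarrow> 0"
    using assms y False by real_asymp
  then have "Bseq (\<lambda>r. (real r + 1) ^ p * (x / y) ^ r)" by (intro convergent_imp_Bseq convergentI)
  then obtain M where M: "\<And>r. norm ((real r + 1) ^ p * (x / y) ^ r) \<le> M" by (auto simp: Bseq_def)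
  show ?thesis
  proof (rule summable_comparison_test'[of "\<lambda>r. M * y ^ r"])
    show "summable (\<lambda>r. M * y ^ r)" using y by (intro summable_mult summable_geometric) auto
    fix r
    have "norm ((real r + 1) ^ p * x ^ r) = norm ((real r + 1) ^ p * (x / y) ^ r) * y ^ r"
      using y assms by (simp add: power_divide abs_mult)
    also have "\<dots> \<le> M * y ^ r" using M y by (intro mult_right_mono) auto
    finally show "norm ((real r + 1) ^ p * x ^ r) \<le> M * y ^ r" .
  qed
qed

lemma level_dim_series_limit:
  assumes q: "0 < q" "q < 1" and n: "\<And>m i. n m i = s i + d i * m" and d: "\<And>i. d i \<le> (1::nat)"
    and bound: "\<And>m r. level_dim q l (n m) r \<le> (r + 1) ^ p"
    and one: "\<And>m. level_dim q l (n m) 0 \<ge> 1"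
  shows "\<exists>\<tau>. \<tau> > 0 \<and> (\<lambda>m. \<Sum>r. real (level_dim q l (n m) r) * q ^ (2 * r)) \<longlonglongrightarrow> \<tau>"
    and "\<And>m. summable (\<lambda>r. real (level_dim q l (n m) r) * q ^ (2 * r))"
proof -
  have q2: "0 \<le> q ^ 2" "q ^ 2 < 1" using q by (auto simp: power_less_one_iff)
  have M: "summable (\<lambda>r. (real r + 1) ^ p * q ^ (2 * r))"
    using summable_poly_power[OF q2, of p] by (simp add: power_mult)
  have le: "norm (real (level_dim q l (n m) r) * q ^ (2 * r)) \<le> (real r + 1) ^ p * q ^ (2 * r)" for m r
  proof -
    have "real (level_dim q l (n m) r) \<le> (real r + 1) ^ p"
      using bound[of m r] by (metis of_nat_1 of_nat_add of_nat_le_iff of_nat_power)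
    then show ?thesis using q by (simp add: abs_mult mult_right_mono)
  qed
  show sm: "summable (\<lambda>r. real (level_dim q l (n m) r) * q ^ (2 * r))" for m
    by (rule summable_comparison_test'[OF M le])
  have "\<forall>r. \<exists>D. \<forall>\<^sub>F m in sequentially. level_dim q l (n m) r = D"
    by (intro allI level_dim_eventually[of q n s d] q n d)
  from choice[OF this]
  obtain D where D: "\<And>r. \<forall>\<^sub>F m in sequentially. level_dim q l (n m) r = D r" by blast
  let ?\<tau> = "\<Sum>r. real (D r) * q ^ (2 * r)"
  have lim: "(\<lambda>m. \<Sum>r. real (level_dim q l (n m) r) * q ^ (2 * r)) \<longlonglongrightarrow> ?\<tau>"
  proof (rule tannerys_theorem[OF _ _ M, THEN conjunct2, THEN conjunct2])
    show "(\<lambda>m. real (level_dim q l (n m) r) * q ^ (2 * r)) \<longlonglongrightarrow> real (D r) * q ^ (2 * r)" for r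
      by (rule tendsto_eventually) (rule eventually_mono[OF D[of r]], simp)
    show "\<forall>\<^sub>F (r, m) in sequentially \<times>\<^sub>F sequentially.
        norm (real (level_dim q l (n m) r) * q ^ (2 * r)) \<le> (real r + 1) ^ p * q ^ (2 * r)"
      unfolding case_prod_unfold by (intro always_eventually allI le)
  qed simp
  \<comment> \<open>The highest weight vector alone contributes at least \<open>1\<close> for every
    \<open>m\<close>; this passes to the limit and keeps it away from zero.\<close>
  have "1 \<le> (\<Sum>r. real (level_dim q l (n m) r) * q ^ (2 * r))" for m
  proof -
    have "(\<Sum>r\<in>{0}. real (level_dim q l (n m) r) * q ^ (2 * r)) \<le> (\<Sum>r. real (level_dim q l (n m) r) * q ^ (2 * r))"
      using q by (intro sum_le_suminf sm) auto
    then show ?thesis using one[of m] by simp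
  qed
  then have "1 \<le> ?\<tau>" using lim by (intro tendsto_lowerbound[OF lim]) auto
  then show "\<exists>\<tau>. \<tau> > 0 \<and> (\<lambda>m. \<Sum>r. real (level_dim q l (n m) r) * q ^ (2 * r)) \<longlonglongrightarrow> \<tau>"
    using lim by (intro exI[of _ ?\<tau>]) auto
qed

section \<open>An Abel type limit\<close>

text \<open>The numbers \<open>(1 - u s) * u s ^ m\<close> are weights of total mass one, and as
  \<open>u s\<close> tends to \<open>1\<close> their mass leaves every finite range of
  \<open>m\<close>. So the terms below some \<open>M\<close> only need to be bounded, while beyond
  \<open>M\<close> the joint limit keeps \<open>c m s\<close> close to \<open>L\<close> for all
  \<open>s\<close> near the end of the filter simultaneously.\<close>

lemma abel_limit:
  fixes c :: "nat \<Rightarrow> real \<Rightarrow> real"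
  assumes lim: "((\<lambda>(m, s). c m s) \<longlongrightarrow> L) (sequentially \<times>\<^sub>F F)"
    and bdd: "\<And>m. \<exists>K. \<forall>\<^sub>F s in F. \<bar>c m s\<bar> \<le> K"
    and u1: "(u \<longlongrightarrow> 1) F" and u: "\<forall>\<^sub>F s in F. 0 < u s \<and> u s < (1::real)"
  shows "((\<lambda>s. (1 - u s) * (\<Sum>m. c m s * u s ^ m)) \<longlongrightarrow> L) F"
proof (rule tendstoI)
  fix \<epsilon> :: real assume \<epsilon>: "\<epsilon> > 0"
  have "\<forall>\<^sub>F p in sequentially \<times>\<^sub>F F. dist (case p of (m, s) \<Rightarrow> c m s) L < \<epsilon> / 2"
    using tendstoD[OF lim, of "\<epsilon> / 2"] \<epsilon> by simp
  then obtain P Q where P: "eventually P sequentially" and Q: "eventually Q F"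
    and PQ: "\<And>m s. P m \<Longrightarrow> Q s \<Longrightarrow> \<bar>c m s - L\<bar> < \<epsilon> / 2"
    unfolding eventually_prod_filter by (auto simp: dist_real_def)
  obtain M where M: "\<And>m. m \<ge> M \<Longrightarrow> P m" using P by (auto simp: eventually_sequentially)
  obtain K where K: "\<And>m. \<forall>\<^sub>F s in F. \<bar>c m s\<bar> \<le> K m" using bdd by metis
  \<comment> \<open>The summand \<open>1\<close> makes \<open>S\<close> positive, so that it can be
    divided by even when the sum vanishes.\<close>
  define S where "S = (\<Sum>m<M. \<bar>K m\<bar> + \<bar>L\<bar>) + 1"
  have S: "S > 0" unfolding S_def by (intro add_nonneg_pos sum_nonneg) auto
  have KF: "\<forall>\<^sub>F s in F. \<forall>m\<in>{..<M}. \<bar>c m s\<bar> \<le> K m"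
    by (intro eventually_ball_finite ballI K) auto
  have "\<forall>\<^sub>F s in F. dist (u s) 1 < \<epsilon> / (2 * S)"
    by (rule tendstoD[OF u1]) (use \<epsilon> S in auto)
  then show "\<forall>\<^sub>F s in F. dist ((1 - u s) * (\<Sum>m. c m s * u s ^ m)) L < \<epsilon>"
    using KF u Q
  proof eventually_elim
    case (elim s)
    let ?u = "u s"
    have u: "0 < ?u" "?u < 1" using elim by auto
    define d where "d m = (c m s - L) * ?u ^ m" for m
    define bnd where "bnd m = (if m < M then \<bar>K m\<bar> + \<bar>L\<bar> else 0) + \<epsilon> / 2 * ?u ^ m" for m
    have geo: "summable (\<lambda>m. ?u ^ m)" using u by (intro summable_geometric) auto
    have d_le: "norm (d m) \<le> bnd m" for m
    proof (cases "m < M")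
      case True
      have "\<bar>c m s\<bar> \<le> K m" using elim(2) True by simp
      then have "\<bar>c m s - L\<bar> \<le> \<bar>K m\<bar> + \<bar>L\<bar>" by linarith
      moreover have "?u ^ m \<le> 1" using u by (simp add: power_le_one)
      ultimately have "\<bar>c m s - L\<bar> * ?u ^ m \<le> (\<bar>K m\<bar> + \<bar>L\<bar>) * 1"
        using u by (intro mult_mono) auto
      then show ?thesis using True u \<epsilon> by (simp add: d_def bnd_def abs_mult add_increasing2)
    next
      case False
      then have "\<bar>c m s - L\<bar> \<le> \<epsilon> / 2" using PQ[OF M[of m] elim(4)] by simp
      then show ?thesis using False u by (simp add: d_def bnd_def abs_mult mult_right_mono)
    qed
    have fin: "summable (\<lambda>m. if m < M then \<bar>K m\<bar> + \<bar>L\<bar> else 0)"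
      by (rule summable_finite[of "{..<M}"]) auto
    have sb: "summable bnd" unfolding bnd_def by (intro summable_add fin summable_mult geo)
    have sd: "summable d" by (rule summable_comparison_test'[OF sb d_le])
    have sum_bnd: "suminf bnd = (\<Sum>m<M. \<bar>K m\<bar> + \<bar>L\<bar>) + \<epsilon> / 2 * (1 / (1 - ?u))"
    proof -
      have "(\<Sum>m. if m < M then \<bar>K m\<bar> + \<bar>L\<bar> else 0) = (\<Sum>m<M. \<bar>K m\<bar> + \<bar>L\<bar>)"
        by (subst suminf_finite[of "{..<M}"]) auto
      moreover have "(\<Sum>m. \<epsilon> / 2 * ?u ^ m) = \<epsilon> / 2 * (1 / (1 - ?u))"
        using u by (subst suminf_mult[OF geo]) (simp add: suminf_geometric)
      ultimately show ?thesis unfolding bnd_def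
        using suminf_add[OF fin summable_mult[OF geo, of "\<epsilon> / 2"]] by simp
    qed
    have "(\<Sum>m. c m s * ?u ^ m) = (\<Sum>m. d m + L * ?u ^ m)" by (simp add: d_def algebra_simps)
    also have "\<dots> = suminf d + L * (1 / (1 - ?u))"
      using u sd geo by (subst suminf_add[symmetric]) (auto simp: suminf_mult suminf_geometric summable_mult)
    finally have "(1 - ?u) * (\<Sum>m. c m s * ?u ^ m) - L = (1 - ?u) * suminf d"
      using u by (simp add: field_simps)
    moreover have "\<bar>suminf d\<bar> \<le> suminf bnd"
      using norm_suminf_le[OF d_le sb] by simp
    ultimately have "\<bar>(1 - ?u) * (\<Sum>m. c m s * ?u ^ m) - L\<bar> \<le> (1 - ?u) * suminf bnd"
      using u by (simp add: abs_mult mult_left_mono)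
    also have "\<dots> = (1 - ?u) * (\<Sum>m<M. \<bar>K m\<bar> + \<bar>L\<bar>) + \<epsilon> / 2"
      unfolding sum_bnd using u by (simp add: field_simps)
    also have "(1 - ?u) * (\<Sum>m<M. \<bar>K m\<bar> + \<bar>L\<bar>) \<le> (1 - ?u) * S"
      using u by (intro mult_left_mono) (auto simp: S_def)
    also have "(1 - ?u) * S < \<epsilon> / 2"
      using elim(1) u S by (simp add: dist_real_def field_simps)
    finally show ?case by (simp add: dist_real_def)
  qed
qed

lemma family_asymptotics:
  fixes A lam :: "nat \<Rightarrow> real" and w :: real
  assumes q: "0 < q" "q < 1" and A: "A \<longlonglongrightarrow> \<tau>" "\<tau> > 0"
    and lam: "(\<lambda>m. lam m * q ^ m) \<longlonglongrightarrow> C" "C \<noteq> 0"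
  defines "g \<equiv> \<lambda>m s. A m * q powr (- w * real m) * ((lam m)\<^sup>2 + 1) powr (- s / 2)"
  shows "\<And>s. s > w \<Longrightarrow> summable (\<lambda>m. g m s)"
    and "\<exists>L. L > 0 \<and> ((\<lambda>s. (s - w) * (\<Sum>m. g m s)) \<longlongrightarrow> L) (at_right w)"
    and "\<And>s. s \<le> w \<Longrightarrow> \<not> summable (\<lambda>m. g m s)"
proof -
  \<comment> \<open>The growth \<open>lam m \<sim> q ^ (- m)\<close> is taken out, leaving a
    sequence with limit \<open>C\<^sup>2\<close>; the exponential part of \<open>g\<close> becomes
    \<open>u s ^ m\<close> with \<open>u s = q powr (s - w)\<close>.\<close>
  define B where "B m = ((lam m)\<^sup>2 + 1) * q ^ (2 * m)" for m
  have l1: "(lam m)\<^sup>2 + 1 > 0" for m by (intro add_nonneg_pos) auto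
  have Bpos: "B m > 0" for m using q l1 by (simp add: B_def)
  have "(\<lambda>m. (q ^ 2) ^ m) \<longlonglongrightarrow> 0" using q by (intro LIMSEQ_power_zero) (simp add: norm_power power_less_one_iff)
  from tendsto_add[OF tendsto_power[OF lam(1)] this]
  have "(\<lambda>m. (lam m * q ^ m)\<^sup>2 + (q ^ 2) ^ m) \<longlonglongrightarrow> C\<^sup>2 + 0" .
  moreover have "(lam m * q ^ m)\<^sup>2 + (q ^ 2) ^ m = B m" for m
    by (simp add: B_def power_mult_distrib distrib_right mult.commute[of m] flip: power_mult)
  ultimately have B: "B \<longlonglongrightarrow> C\<^sup>2" by simp
  have C: "C\<^sup>2 > 0" using lam by simp
  define c where "c m s = A m * B m powr (- s / 2)" for m s
  define u where "u s = q powr (s - w)" for s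
  have u_less_1: "u s < 1" if "s > w" for s
    using q that by (simp add: u_def powr_def mult_pos_neg)
  have u_ge_1: "u s \<ge> 1" if "s \<le> w" for s
    using q that by (simp add: u_def powr_def mult_nonpos_nonpos)
  have g: "g m s = c m s * u s ^ m" for m s
  proof -
    have "B m powr (- s / 2) = ((lam m)\<^sup>2 + 1) powr (- s / 2) * (q powr real (2 * m)) powr (- s / 2)"
      unfolding B_def powr_realpow[OF q(1)] by (rule powr_mult)
    also have "(q powr real (2 * m)) powr (- s / 2) = q powr (- s * m)"
      by (simp add: powr_powr mult.commute)
    finally have "B m powr (- s / 2) * u s ^ m =
      ((lam m)\<^sup>2 + 1) powr (- s / 2) * (q powr (- s * m) * q powr ((s - w) * m))"
      using q by (simp add: u_def powr_powr flip: powr_realpow)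
    also have "q powr (- s * m) * q powr ((s - w) * m) = q powr (- w * m)"
      by (simp add: powr_add[symmetric] algebra_simps)
    finally show ?thesis by (simp add: g_def c_def mult_ac)
  qed
  have climit: "(\<lambda>m. c m s) \<longlonglongrightarrow> \<tau> * C\<^sup>2 powr (- s / 2)" for s
    unfolding c_def using A B C by (intro tendsto_intros) auto
  show "summable (\<lambda>m. g m s)" if s: "s > w" for s
  proof -
    have u: "0 < u s" "u s < 1" using u_less_1[OF s] q by (auto simp: u_def)
    obtain K where K: "\<And>m. norm (c m s) \<le> K"
      using convergent_imp_Bseq[OF convergentI[OF climit[of s]]] by (auto simp: Bseq_def)
    show ?thesis unfolding g
    proof (rule summable_comparison_test'[of "\<lambda>m. K * u s ^ m"])
      show "summable (\<lambda>m. K * u s ^ m)" using u by (intro summable_mult summable_geometric) auto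
      show "norm (c m s * u s ^ m) \<le> K * u s ^ m" for m
        using K[of m] u by (simp add: abs_mult mult_right_mono)
    qed
  qed
  \<comment> \<open>Here \<open>u s \<ge> 1\<close>, so eventually the terms are at least
    \<open>c m s\<close>, which has a positive limit; summable terms would tend to zero.\<close>
  show "\<not> summable (\<lambda>m. g m s)" if s: "s \<le> w" for s
  proof
    assume "summable (\<lambda>m. g m s)"
    then have "(\<lambda>m. c m s * u s ^ m) \<longlonglongrightarrow> 0" unfolding g by (rule summable_LIMSEQ_zero)
    moreover have "\<forall>\<^sub>F m in sequentially. c m s \<le> c m s * u s ^ m"
    proof -
      have "\<forall>\<^sub>F m in sequentially. c m s > 0"
        using A C by (intro order_tendstoD(1)[OF climit[of s]]) simp
      moreover have "u s \<ge> 1" by (rule u_ge_1[OF s])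
      ultimately show ?thesis by (auto elim!: eventually_mono simp: one_le_power)
    qed
    ultimately have "\<tau> * C\<^sup>2 powr (- s / 2) \<le> 0"
      using climit[of s] by (intro tendsto_le[of sequentially]) auto
    then show False using A C by (auto simp: not_le mult_le_0_iff)
  qed
  show "\<exists>L. L > 0 \<and> ((\<lambda>s. (s - w) * (\<Sum>m. g m s)) \<longlongrightarrow> L) (at_right w)"
  proof -
    have sid: "((\<lambda>s. s) \<longlongrightarrow> w) (at_right w)" by (rule tendsto_ident_at)
    have "((\<lambda>p. A (fst p) * B (fst p) powr (- snd p / 2)) \<longlongrightarrow> \<tau> * C\<^sup>2 powr (- w / 2)) (sequentially \<times>\<^sub>F at_right w)"
      using C by (intro tendsto_intros filterlim_compose[OF A(1) filterlim_fst]
          filterlim_compose[OF B filterlim_fst] filterlim_compose[OF sid filterlim_snd]) auto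
    then have "((\<lambda>(m, s). c m s) \<longlongrightarrow> \<tau> * C\<^sup>2 powr (- w / 2)) (sequentially \<times>\<^sub>F at_right w)"
      by (simp add: c_def case_prod_unfold)
    moreover have "\<exists>K. \<forall>\<^sub>F s in at_right w. \<bar>c m s\<bar> \<le> K" for m
    proof -
      have "((\<lambda>s. \<bar>c m s\<bar>) \<longlongrightarrow> \<bar>c m w\<bar>) (at_right w)"
        unfolding c_def using Bpos[of m] sid by (intro tendsto_intros) auto
      then have "\<forall>\<^sub>F s in at_right w. \<bar>c m s\<bar> < \<bar>c m w\<bar> + 1" by (intro order_tendstoD) auto
      then show ?thesis by (intro exI[of _ "\<bar>c m w\<bar> + 1"]) (auto elim!: eventually_mono)
    qed
    moreover have "(u \<longlongrightarrow> 1) (at_right w)"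
    proof -
      have "(u \<longlongrightarrow> q powr (w - w)) (at_right w)"
        unfolding u_def using q sid by (intro tendsto_intros) auto
      then show ?thesis using q by simp
    qed
    moreover have u: "\<forall>\<^sub>F s in at_right w. 0 < u s \<and> u s < 1"
      unfolding eventually_at_right_field
      using q u_less_1 by (intro exI[of _ "w + 1"]) (auto simp: u_def)
    ultimately have abel: "((\<lambda>s. (1 - u s) * (\<Sum>m. c m s * u s ^ m)) \<longlongrightarrow> \<tau> * C\<^sup>2 powr (- w / 2)) (at_right w)"
      by (rule abel_limit)
    \<comment> \<open>The Abel limit is normalised by \<open>1 - u s\<close>; the derivative
      \<open>ln q\<close> of \<open>u\<close> at \<open>w\<close> converts this into
      \<open>s - w\<close> and puts the positive factor \<open>- inverse (ln q)\<close> into the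
      limit.\<close>
    have lnq: "ln q < 0" using q by simp
    have "(u has_real_derivative ln q) (at w)"
      unfolding u_def using q by (auto intro!: derivative_eq_intros)
    then have "((\<lambda>s. (u s - u w) / (s - w)) \<longlongrightarrow> ln q) (at w)"
      by (simp add: has_field_derivative_iff)
    then have "((\<lambda>s. (u s - 1) / (s - w)) \<longlongrightarrow> ln q) (at_right w)"
      using q by (auto simp: u_def intro: tendsto_mono[OF at_le])
    then have "((\<lambda>s. - inverse ((u s - 1) / (s - w))) \<longlongrightarrow> - inverse (ln q)) (at_right w)"
      using lnq by (intro tendsto_intros) auto
    then have "((\<lambda>s. - inverse ((u s - 1) / (s - w)) * ((1 - u s) * (\<Sum>m. c m s * u s ^ m)))
        \<longlongrightarrow> - inverse (ln q) * (\<tau> * C\<^sup>2 powr (- w / 2))) (at_right w)"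
      by (rule tendsto_mult[OF _ abel])
    moreover have "\<forall>\<^sub>F s in at_right w. - inverse ((u s - 1) / (s - w)) * ((1 - u s) * (\<Sum>m. c m s * u s ^ m))
        = (s - w) * (\<Sum>m. g m s)"
      using u
    proof eventually_elim
      case (elim s)
      then have "- inverse ((u s - 1) / (s - w)) * (1 - u s) = s - w"
        by (simp add: field_simps)
      then show ?case by (simp add: g flip: mult.assoc)
    qed
    ultimately have "((\<lambda>s. (s - w) * (\<Sum>m. g m s)) \<longlongrightarrow> - inverse (ln q) * (\<tau> * C\<^sup>2 powr (- w / 2))) (at_right w)"
      by (rule Lim_transform_eventually)
    moreover have "- inverse (ln q) * (\<tau> * C\<^sup>2 powr (- w / 2)) > 0"
      using lnq A C by (intro mult_pos_pos) auto
    ultimately show ?thesis by blast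
  qed
qed

section \<open>Summation over the summands\<close>

text \<open>An equivalence, because it has to transport divergence as well as the value of the
  sum.\<close>

lemma nonneg_has_sum_Sigma_iff:
  fixes f :: "'a \<times> 'b \<Rightarrow> real"
  assumes inner: "\<And>x. x \<in> A \<Longrightarrow> ((\<lambda>y. f (x, y)) has_sum g x) (B x)"
    and f0: "\<And>x y. x \<in> A \<Longrightarrow> y \<in> B x \<Longrightarrow> f (x, y) \<ge> 0"
  shows "(f has_sum S) (Sigma A B) \<longleftrightarrow> (g has_sum S) A"
proof
  assume "(f has_sum S) (Sigma A B)"
  then show "(g has_sum S) A" using inner by (rule has_sum_SigmaD)
next
  assume g: "(g has_sum S) A"
  show "(f has_sum S) (Sigma A B)"
    by (rule has_sum_SigmaI[OF inner g summable_on_SigmaI[OF inner has_sum_imp_summable[OF g] f0]])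
qed

lemma has_sum_blocks_iff:
  fixes z :: "'e \<Rightarrow> real"
  assumes disj: "\<And>p p'. p \<in> P \<Longrightarrow> p' \<in> P \<Longrightarrow> p \<noteq> p' \<Longrightarrow> Bb p \<inter> Bb p' = {}"
    and fin: "\<And>p. p \<in> P \<Longrightarrow> finite (Bb p)"
    and z: "\<And>p e. p \<in> P \<Longrightarrow> e \<in> Bb p \<Longrightarrow> z e = w p" and w: "\<And>p. p \<in> P \<Longrightarrow> 0 \<le> w p"
  shows "(z has_sum S) (\<Union>p\<in>P. Bb p) \<longleftrightarrow> ((\<lambda>p. real (card (Bb p)) * w p) has_sum S) P"
proof -
  have bij: "bij_betw snd (Sigma P Bb) (\<Union>p\<in>P. Bb p)"
    unfolding bij_betw_def
  proof
    show "inj_on snd (Sigma P Bb)"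
    proof (rule inj_onI, clarsimp)
      fix p p' e assume "p \<in> P" "e \<in> Bb p" "p' \<in> P" "e \<in> Bb p'"
      then show "p = p'" using disj[of p p'] by blast
    qed
  qed force
  have "(z has_sum S) (\<Union>p\<in>P. Bb p) \<longleftrightarrow> ((\<lambda>x. z (snd x)) has_sum S) (Sigma P Bb)"
    by (rule has_sum_reindex_bij_betw[OF bij, symmetric])
  also have "\<dots> \<longleftrightarrow> ((\<lambda>p. real (card (Bb p)) * w p) has_sum S) P"
  proof (rule nonneg_has_sum_Sigma_iff)
    fix p assume p: "p \<in> P"
    have "(z has_sum sum z (Bb p)) (Bb p)" by (rule has_sum_finite[OF fin[OF p]])
    also have "sum z (Bb p) = real (card (Bb p)) * w p" using z[OF p] by simp
    finally show "((\<lambda>e. z (snd (p, e))) has_sum real (card (Bb p)) * w p) (Bb p)" by simp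
  qed (use z w in auto)
  finally show ?thesis .
qed

text \<open>Distinct levels are mutually orthogonal, so orthonormal bases of the single levels
  combine into one of \<open>V\<close> that is adapted to the eigenspaces of \<open>K2rho\<close>.
  Levels may be zero, in which case \<open>Bb r\<close> is empty.\<close>

lemma summand_eigenbasis:
  assumes hw: "uq_highest_weight_irrep q l \<rho> n V" and q: "0 < q" "q < 1"
  shows "\<exists>Bb. (\<forall>r. finite (Bb r) \<and> card (Bb r) = level_dim q l n r \<and> card (Bb r) \<le> (r + 1) ^ (\<Sum>i\<le>l. i + 1) \<and>
      (\<forall>e\<in>Bb r. \<forall>js\<in>{K2rho_idx l, rev (K2rho_idx l)}.
         foldr \<rho> (map genK js) e = (q powr (real (rho_weight l n) - 2 * real r)) *\<^sub>R e)) \<and>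
    card (Bb 0) \<ge> 1 \<and> (\<forall>r s. r \<noteq> s \<longrightarrow> Bb r \<inter> Bb s = {}) \<and> orthonormal_set (\<Union>r. Bb r) \<and> cspan (\<Union>r. Bb r) = V"
proof -
  obtain v where v: "v \<in> V" "v \<noteq> 0"
    "\<And>i. i \<in> {1..l} \<Longrightarrow> \<rho> (genE i) v = 0 \<and> \<rho> (genK i) v = (q powr (real (n i) / 2)) *\<^sub>R v"
    using hw unfolding uq_highest_weight_irrep_def by blast
  interpret hw_rep q l \<rho> n V v
    using hw v q unfolding uq_highest_weight_irrep_def by unfold_locales auto
  have "\<forall>r. \<exists>B. finite B \<and> orthonormal_set B \<and> cspan B = level r \<and> card B = complex_vector.dim (level r)"
    unfolding level_def by (intro allI orthonormal_set_basis_exists finite_imageI finite_words)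
  from choice[OF this]
  obtain Bb where Bb: "\<And>r. finite (Bb r)" "\<And>r. orthonormal_set (Bb r)" "\<And>r. cspan (Bb r) = level r"
    "\<And>r. card (Bb r) = level_dim q l n r"
    unfolding dim_level_eq by blast
  have lev: "e \<in> level r" if "e \<in> Bb r" for e r
    using that complex_vector.span_base[of e "Bb r"] Bb(3) by simp
  have orth: "cinner e f = 0" if "e \<in> Bb r" "f \<in> Bb s" "r \<noteq> s" for e f r s
    using level_orth[OF that(3)] lev that by blast
  have self: "cinner e e = 1" if "e \<in> Bb r" for e r
    using Bb(2)[of r] that by (simp add: orthonormal_set_def)
  have disj: "Bb r \<inter> Bb s = {}" if "r \<noteq> s" for r s
    using orth[OF _ _ that] self by force
  have "cinner e f = (if e = f then 1 else 0)" if "e \<in> Bb r" "f \<in> Bb s" for e f r s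
  proof (cases "r = s")
    case True
    then show ?thesis using Bb(2)[of r] that by (simp add: orthonormal_set_def)
  next
    case False
    then show ?thesis using orth[OF that False] disj[OF False] that by auto
  qed
  then have on: "orthonormal_set (\<Union>r. Bb r)" unfolding orthonormal_set_def by blast
  have sp: "cspan (\<Union>r. Bb r) = V"
  proof
    have "Bb r \<subseteq> V" for r using lev level_subset_V by blast
    then show "cspan (\<Union>r. Bb r) \<subseteq> V" by (intro complex_vector.span_minimal V) auto
    have "level r \<subseteq> cspan (\<Union>r. Bb r)" for r
      unfolding Bb(3)[symmetric] by (intro complex_vector.span_mono) auto
    then show "V \<subseteq> cspan (\<Union>r. Bb r)"
      by (subst V_eq_levels, intro complex_vector.span_minimal complex_vector.subspace_span) auto
  qed
  have eig: "foldr \<rho> (map genK js) e = (q powr (real (rho_weight l n) - 2 * real r)) *\<^sub>R e"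
    if "e \<in> Bb r" "js \<in> {K2rho_idx l, rev (K2rho_idx l)}" for e r js
    by (rule K2rho_level[OF _ lev[OF that(1)]]) (use that(2) in auto)
  have le: "card (Bb r) \<le> (r + 1) ^ (\<Sum>i\<le>l. i + 1)" for r
    using dim_level_le[of r] unfolding Bb(4) dim_level_eq .
  have "card (Bb 0) \<ge> 1" using dim_level_0 unfolding Bb(4) .
  then show ?thesis using Bb(1,4) le eig disj on sp by (intro exI[of _ Bb]) blast
qed

text \<open>For \<open>2 \<le> l\<close> the two ends of the diagram are distinct, so no label grows
  faster than \<open>m\<close>; this is the slope bound that \<open>level_dim_eventually\<close>
  asks for.\<close>

lemma summand_weight_affine:
  assumes "2 \<le> l"
  shows "summand_weight l k j a b m i = summand_weight l k j a b 0 i + (if i = 1 \<or> i = l then 1 else 0) * m"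
  using assms by (auto simp: summand_weight_def)

text \<open>The origin of the number \<open>2l\<close>: the coefficient
  \<open>i * (l - i + 1)\<close> equals \<open>l\<close> at both ends of the diagram, and both end
  labels grow by one with \<open>m\<close>.\<close>

lemma rho_weight_summand_weight:
  assumes l: "2 \<le> l"
  shows "rho_weight l (summand_weight l k j a b m) = rho_weight l (summand_weight l k j a b 0) + 2 * l * m"
proof -
  have "rho_weight l (summand_weight l k j a b m) = rho_weight l (summand_weight l k j a b 0) +
      (\<Sum>i\<in>{1..l}. i * (l - i + 1) * ((if i = 1 \<or> i = l then 1 else 0) * m))"
    unfolding rho_weight_def summand_weight_affine[OF l, of k j a b m]
    by (simp only: distrib_left sum.distrib)
  also have "(\<Sum>i\<in>{1..l}. i * (l - i + 1) * ((if i = 1 \<or> i = l then 1 else 0) * m)) =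
      (\<Sum>i\<in>{1, l}. i * (l - i + 1) * ((if i = 1 \<or> i = l then 1 else 0) * m))"
    using l by (intro sum.mono_neutral_right) auto
  also have "\<dots> = 2 * l * m" using l by simp
  finally show ?thesis .
qed

lemma K2rho_operator_eq_diag_op:
  assumes B: "orthonormal_basis B" "B \<subseteq> all_forms l X"
    and rep: "uq_star_rep q l (action X) (all_forms l X)"
    and eig: "\<And>e js. e \<in> B \<Longrightarrow> js \<in> {K2rho_idx l, rev (K2rho_idx l)} \<Longrightarrow>
      foldr (action X) (map genK js) e = \<kappa> e *\<^sub>R e"
  shows "K2rho_operator l X = diag_op B \<kappa>"
  unfolding K2rho_operator_def
proof (rule closure_graph_eq_diag_op[OF B])
  show "csubspace (all_forms l X)" using rep by (simp add: uq_star_rep_def)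
  show "linear_between (all_forms l X) (all_forms l X) (foldr (action X) (K2rho l))"
    using rep set_K2rho_idx[of l]
    by (intro linear_between_foldr) (auto simp: K2rho_eq uq_star_rep_def uq_gens_def)
  show "foldr (action X) (K2rho l) e = \<kappa> e *\<^sub>R e" if "e \<in> B" for e
    using eig[OF that] by (simp add: K2rho_eq)
  show "cinner e (foldr (action X) (K2rho l) x) = of_real (\<kappa> e) * cinner e x"
    if "e \<in> B" "x \<in> all_forms l X" for e x
  proof -
    have "cinner (foldr (action X) (map genK (rev (K2rho_idx l))) e) x = cinner e (foldr (action X) (K2rho l) x)"
      using adjoint_foldr_genK[OF rep _ _ that(2), of "rev (K2rho_idx l)" e] set_K2rho_idx[of l] that B
      by (auto simp: K2rho_eq)
    then show ?thesis using eig[OF that(1), of "rev (K2rho_idx l)"] by (simp add: cinner_scaleR_left)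
  qed
qed

section \<open>Assembly of the eigenbasis, the trace and its pole\<close>

theorem corollary1:
  fixes q :: real and l :: nat and N :: int
    and X :: "int \<Rightarrow> 'h::complex_hilbert_space dolbeault_data"
  assumes "0 < q" and "q < 1" and "2 \<le> l"
    and "dolbeault_dirac q l (X N)"
  shows "(\<forall>s > 2 * real l.
            trace_class (zeta_operator ((K2rho_operator l (X N))\<inverse>) (dirac (X N)) s)) \<and>
         modular_spectral_dimension ((K2rho_operator l (X N))\<inverse>) (dirac (X N)) = 2 * real l \<and>
         (\<exists>L. L \<noteq> 0 \<and>
            ((\<lambda>s. of_real (s - 2 * real l) *
                   op_trace (zeta_operator ((K2rho_operator l (X N))\<inverse>) (dirac (X N)) s))
              \<longlongrightarrow> L) (at_right (2 * real l)))"
proof -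
  note q = assms(1,2) and l = assms(3)
  let ?X = "X N" and ?\<rho> = "action (X N)" and ?I = "summand_index l" and ?D = "dirac (X N)"
  let ?p = "\<Sum>i\<le>l. i + 1"
  obtain V lam where
    dense: "closure (all_forms l ?X) = UNIV" and rep: "uq_star_rep q l ?\<rho> (all_forms l ?X)"
    and sa: "self_adjoint ?D" and dec: "forms_decomposition q l ?X V"
    and eigD: "\<And>t x. t \<in> ?I \<Longrightarrow> x \<in> V t \<Longrightarrow> (x, (lam t)\<^sup>2 *\<^sub>R x) \<in> op_comp ?D ?D"
    and lim: "\<And>k j. (k, j, 0) \<in> ?I \<Longrightarrow> \<exists>C. C \<noteq> 0 \<and> (\<lambda>m. lam (k, j, m) * q ^ m) \<longlonglongrightarrow> C"
    using assms(4) unfolding dolbeault_dirac_def by blast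
  obtain a b where
    hw: "\<And>k j m. (k, j, m) \<in> ?I \<Longrightarrow>
      uq_highest_weight_irrep q l ?\<rho> (summand_weight l k j (a k j) (b k j) m) (V (k, j, m))"
    and orth: "\<And>t u x y. t \<in> ?I \<Longrightarrow> u \<in> ?I \<Longrightarrow> t \<noteq> u \<Longrightarrow> x \<in> V t \<Longrightarrow> y \<in> V u \<Longrightarrow> cinner x y = 0"
    and forms: "\<And>k. k \<le> l \<Longrightarrow> forms ?X k = cspan (\<Union>{V (k, j, m) | j m. (k, j, m) \<in> ?I})"
    using dec unfolding forms_decomposition_def by (elim exE conjE) (fastforce)
  define n where "n = (\<lambda>(k, j, m). summand_weight l k j (a k j) (b k j) m)"
  have hw': "uq_highest_weight_irrep q l ?\<rho> (n t) (V t)" if "t \<in> ?I" for t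
    using hw that by (cases t) (auto simp: n_def)
  have "\<forall>t\<in>?I. \<exists>Bb. (\<forall>r. finite (Bb r) \<and> card (Bb r) = level_dim q l (n t) r \<and> card (Bb r) \<le> (r + 1) ^ ?p \<and>
      (\<forall>e\<in>Bb r. \<forall>js\<in>{K2rho_idx l, rev (K2rho_idx l)}.
         foldr ?\<rho> (map genK js) e = (q powr (real (rho_weight l (n t)) - 2 * real r)) *\<^sub>R e)) \<and>
    card (Bb 0) \<ge> 1 \<and> (\<forall>r s. r \<noteq> s \<longrightarrow> Bb r \<inter> Bb s = {}) \<and> orthonormal_set (\<Union>r. Bb r) \<and> cspan (\<Union>r. Bb r) = V t"
    using summand_eigenbasis[OF hw' q] by blast
  from bchoice[OF this] obtain Bb where
    "\<forall>t\<in>?I. (\<forall>r. finite (Bb t r) \<and> card (Bb t r) = level_dim q l (n t) r \<and> card (Bb t r) \<le> (r + 1) ^ ?p \<and>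
      (\<forall>e\<in>Bb t r. \<forall>js\<in>{K2rho_idx l, rev (K2rho_idx l)}.
         foldr ?\<rho> (map genK js) e = (q powr (real (rho_weight l (n t)) - 2 * real r)) *\<^sub>R e)) \<and>
    card (Bb t 0) \<ge> 1 \<and> (\<forall>r s. r \<noteq> s \<longrightarrow> Bb t r \<inter> Bb t s = {}) \<and> orthonormal_set (\<Union>r. Bb t r) \<and> cspan (\<Union>r. Bb t r) = V t" ..
  then have fin: "\<And>t r. t \<in> ?I \<Longrightarrow> finite (Bb t r)"
    and card: "\<And>t r. t \<in> ?I \<Longrightarrow> card (Bb t r) = level_dim q l (n t) r"
    and card_le: "\<And>t r. t \<in> ?I \<Longrightarrow> card (Bb t r) \<le> (r + 1) ^ ?p"
    and eigK: "\<And>t r e js. t \<in> ?I \<Longrightarrow> e \<in> Bb t r \<Longrightarrow> js \<in> {K2rho_idx l, rev (K2rho_idx l)} \<Longrightarrow>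
      foldr ?\<rho> (map genK js) e = (q powr (real (rho_weight l (n t)) - 2 * real r)) *\<^sub>R e"
    and card0: "\<And>t. t \<in> ?I \<Longrightarrow> card (Bb t 0) \<ge> 1"
    and disj: "\<And>t r s. t \<in> ?I \<Longrightarrow> r \<noteq> s \<Longrightarrow> Bb t r \<inter> Bb t s = {}"
    and on: "\<And>t. t \<in> ?I \<Longrightarrow> orthonormal_set (\<Union>r. Bb t r)"
    and span: "\<And>t. t \<in> ?I \<Longrightarrow> cspan (\<Union>r. Bb t r) = V t"
    by blast+
  define BB where "BB p = Bb (fst p) (snd p)" for p
  define B where "B = (\<Union>p\<in>?I \<times> UNIV. BB p)"
  have BV: "e \<in> V t" if "t \<in> ?I" "e \<in> Bb t r" for e t r
    using span[OF that(1)] that(2) complex_vector.span_base[of e "\<Union>r. Bb t r"] by blast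
  have ip: "cinner e f = (if e = f then 1 else 0)" if "e \<in> Bb t r" "f \<in> Bb u s" "t \<in> ?I" "u \<in> ?I" for e f t u r s
  proof (cases "t = u")
    case True
    then show ?thesis using on[OF that(3)] that unfolding orthonormal_set_def by blast
  next
    case False
    have "cinner e e = 1" using on[OF that(3)] that(1) unfolding orthonormal_set_def by force
    moreover have "cinner e f = 0" using orth[OF that(3,4) False] BV that by blast
    ultimately show ?thesis by auto
  qed
  have disjB: "BB p \<inter> BB p' = {}" if "p \<in> ?I \<times> UNIV" "p' \<in> ?I \<times> UNIV" "p \<noteq> p'" for p p'
  proof (cases "fst p = fst p'")
    case True
    then show ?thesis using disj[of "fst p" "snd p" "snd p'"] that by (auto simp: BB_def prod_eq_iff)
  next
    case False
    show ?thesis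
    proof (rule ccontr)
      assume "BB p \<inter> BB p' \<noteq> {}"
      then obtain e where e: "e \<in> Bb (fst p) (snd p)" "e \<in> Bb (fst p') (snd p')" by (auto simp: BB_def)
      have I: "fst p \<in> ?I" "fst p' \<in> ?I" using that by auto
      have "cinner e e = 1" using ip[OF e(1,1) I(1,1)] by simp
      moreover have "cinner e e = 0" using orth[OF I False BV[OF I(1) e(1)] BV[OF I(2) e(2)]] .
      ultimately show False by simp
    qed
  qed
  have Bforms: "B \<subseteq> all_forms l ?X" and spanB: "cspan B = all_forms l ?X"
  proof -
    have VB: "V t \<subseteq> cspan B" if "t \<in> ?I" for t
      unfolding span[OF that, symmetric] using that
      by (intro complex_vector.span_mono) (auto simp: B_def BB_def)
    have VF: "V (k, j, m) \<subseteq> forms ?X k" if "(k, j, m) \<in> ?I" for k j m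
    proof -
      have "k \<le> l" using that by (simp add: summand_index_def)
      then show ?thesis using forms[of k] complex_vector.span_superset[of "\<Union>{V (k, j, m) | j m. (k, j, m) \<in> ?I}"] that
        by blast
    qed
    have FF: "forms ?X k \<subseteq> all_forms l ?X" if "k \<le> l" for k
      unfolding all_forms_def using that complex_vector.span_superset[of "\<Union>k\<le>l. forms ?X k"] by blast
    show "B \<subseteq> all_forms l ?X"
    proof
      fix e assume "e \<in> B"
      then obtain k j m r where t: "(k, j, m) \<in> ?I" "e \<in> Bb (k, j, m) r" by (auto simp: B_def BB_def)
      then have "k \<le> l" by (simp add: summand_index_def)
      then show "e \<in> all_forms l ?X" using BV[OF t] VF[OF t(1)] FF by blast
    qed
    then have "cspan B \<subseteq> all_forms l ?X"
      unfolding all_forms_def by (intro complex_vector.span_minimal complex_vector.subspace_span)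
    moreover have "forms ?X k \<subseteq> cspan B" if "k \<le> l" for k
      unfolding forms[OF that] using VB
      by (intro complex_vector.span_minimal complex_vector.subspace_span) auto
    then have "all_forms l ?X \<subseteq> cspan B"
      unfolding all_forms_def by (intro complex_vector.span_minimal complex_vector.subspace_span) auto
    ultimately show "cspan B = all_forms l ?X" by blast
  qed
  have onb: "orthonormal_basis B"
    unfolding orthonormal_basis_def spanB
  proof (intro conjI ballI dense)
    fix e f assume "e \<in> B" "f \<in> B"
    then obtain p p' where "fst p \<in> ?I" "e \<in> Bb (fst p) (snd p)" "fst p' \<in> ?I" "f \<in> Bb (fst p') (snd p')"
      by (auto simp: B_def BB_def)
    then show "cinner e f = (if e = f then 1 else 0)" by (intro ip)
  qed
  \<comment> \<open>The blocks are disjoint, so every basis vector determines its summand and level;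
    the eigenvalues are functions of this label.\<close>
  define ix where "ix e = (SOME p. p \<in> ?I \<times> UNIV \<and> e \<in> BB p)" for e
  have ix: "ix e = p" if p: "p \<in> ?I \<times> UNIV" "e \<in> BB p" for e p
  proof -
    have "ix e \<in> ?I \<times> UNIV \<and> e \<in> BB (ix e)" unfolding ix_def by (rule someI) (use p in blast)
    then have "p \<noteq> ix e \<Longrightarrow> BB p \<inter> BB (ix e) = {}" "e \<in> BB p \<inter> BB (ix e)"
      using disjB[of p "ix e"] p by auto
    then show ?thesis by (metis empty_iff)
  qed
  define \<kappa> where "\<kappa> e = q powr (real (rho_weight l (n (fst (ix e)))) - 2 * real (snd (ix e)))" for e
  define \<nu> where "\<nu> e = (lam (fst (ix e)))\<^sup>2" for e
  have K: "K2rho_operator l ?X = diag_op B \<kappa>"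
  proof (rule K2rho_operator_eq_diag_op[OF onb Bforms rep])
    fix e js assume e: "e \<in> B" and js: "js \<in> {K2rho_idx l, rev (K2rho_idx l)}"
    then obtain p where p: "p \<in> ?I \<times> UNIV" "e \<in> BB p" by (auto simp: B_def)
    then show "foldr ?\<rho> (map genK js) e = \<kappa> e *\<^sub>R e"
      using eigK[of "fst p" e "snd p" js] js by (auto simp: \<kappa>_def ix[OF p] BB_def)
  qed
  have eD: "(e, \<nu> e *\<^sub>R e) \<in> op_comp ?D ?D" if e: "e \<in> B" for e
  proof -
    obtain p where p: "p \<in> ?I \<times> UNIV" "e \<in> BB p" using e by (auto simp: B_def)
    then show ?thesis using eigD[of "fst p" e] BV[of "fst p" e "snd p"]
      by (auto simp: \<nu>_def ix[OF p] BB_def)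
  qed
  define z where "z s e = 1 / \<kappa> e * (\<nu> e + 1) powr (- s / 2)" for s e
  have \<kappa>0: "\<kappa> e > 0" for e using q by (simp add: \<kappa>_def)
  have \<nu>0: "\<nu> e \<ge> 0" for e by (simp add: \<nu>_def)
  have z0: "0 \<le> z s e" for s e using \<kappa>0[of e] by (simp add: z_def)
  have zeta: "zeta_operator ((K2rho_operator l ?X)\<inverse>) ?D s = diag_op B (z s)" if "s > 0" for s
    unfolding z_def
    by (rule zeta_operator_eq_diag_op[OF onb sa eD \<nu>0 K _ that]) (use \<kappa>0 in \<open>auto simp: less_imp_neq[symmetric]\<close>)
  define w where "w s p = q powr (2 * real (snd p) - real (rho_weight l (n (fst p)))) *
     ((lam (fst p))\<^sup>2 + 1) powr (- s / 2)" for s and p :: "(nat \<times> nat \<times> nat) \<times> nat"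
  have zw: "z s e = w s p" if p: "p \<in> ?I \<times> UNIV" "e \<in> BB p" for s e p
    unfolding z_def w_def \<kappa>_def \<nu>_def ix[OF p]
    by (simp add: powr_minus_divide[symmetric])
  \<comment> \<open>Up to the factor \<open>q powr (- real (rho_weight l (n t)))\<close>, the trace
    of the inverse of \<open>K2rho\<close> on the summand \<open>t\<close>.\<close>
  define T where "T t = (\<Sum>r. real (level_dim q l (n t) r) * q ^ (2 * r))" for t
  \<comment> \<open>The families of summands. There are finitely many, so their asymptotics may
    simply be added.\<close>
  define Fam where "Fam = {(k, j). (k, j, 0) \<in> ?I}"
  have Fam_I: "(k, j, m) \<in> ?I \<longleftrightarrow> (k, j) \<in> Fam" for k j m
    by (auto simp: Fam_def summand_index_def)
  have finFam: "finite Fam"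
    by (rule finite_subset[of _ "{..l} \<times> {..1}"]) (auto simp: Fam_def summand_index_def split: if_splits)
  have Fam0: "(0, 0) \<in> Fam" by (auto simp: Fam_def summand_index_def)
  have bound: "level_dim q l (n t) r \<le> (r + 1) ^ ?p" if "t \<in> ?I" for t r
    using card_le[OF that] card[OF that] by simp
  have one: "level_dim q l (n t) 0 \<ge> 1" if "t \<in> ?I" for t
    using card0[OF that] card[OF that] by simp
  have aff: "n (k, j, m) i = n (k, j, 0) i + (if i = 1 \<or> i = l then 1 else 0) * m" for k j m i
    unfolding n_def prod.case by (rule summand_weight_affine[OF l])
  have series: "\<exists>\<tau>. \<tau> > 0 \<and> (\<lambda>m. T (k, j, m)) \<longlonglongrightarrow> \<tau>"
    and smT': "summable (\<lambda>r. real (level_dim q l (n (k, j, m)) r) * q ^ (2 * r))"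
    if kj: "(k, j) \<in> Fam" for k j m
  proof -
    have I: "(k, j, m) \<in> ?I" for m using kj by (simp add: Fam_I)
    let ?d = "\<lambda>i. if i = 1 \<or> i = l then 1 else 0"
    have d: "?d i \<le> (1::nat)" for i by simp
    show "\<exists>\<tau>. \<tau> > 0 \<and> (\<lambda>m. T (k, j, m)) \<longlonglongrightarrow> \<tau>"
      unfolding T_def
      by (rule level_dim_series_limit(1)[where n = "\<lambda>m. n (k, j, m)", OF q aff d bound[OF I] one[OF I]])
    show "summable (\<lambda>r. real (level_dim q l (n (k, j, m)) r) * q ^ (2 * r))"
      by (rule level_dim_series_limit(2)[where n = "\<lambda>m. n (k, j, m)", OF q aff d bound[OF I] one[OF I]])
  qed
  have smT: "summable (\<lambda>r. real (level_dim q l (n t) r) * q ^ (2 * r))" if "t \<in> ?I" for t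
    using smT' that by (cases t) (auto simp: Fam_I)
  define c0 where "c0 kj = real (rho_weight l (n (fst kj, snd kj, 0)))" for kj
  define G where "G s t = T t * q powr (- real (rho_weight l (n t))) * ((lam t)\<^sup>2 + 1) powr (- s / 2)" for s t
  have G0: "G s t \<ge> 0" if "t \<in> ?I" for s t
    unfolding G_def T_def using q by (intro mult_nonneg_nonneg suminf_nonneg smT that) auto
  \<comment> \<open>Stated for every candidate sum \<open>S\<close>, so that it serves both the
    trace formula above \<open>2l\<close> and the divergence at and below \<open>2l\<close>.\<close>
  have hsB: "(z s has_sum S) B \<longleftrightarrow> (G s has_sum S) ?I" for s S
  proof -
    have "(z s has_sum S) B \<longleftrightarrow> ((\<lambda>p. real (card (BB p)) * w s p) has_sum S) (?I \<times> UNIV)"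
      unfolding B_def
    proof (rule has_sum_blocks_iff)
      show "finite (BB p)" if "p \<in> ?I \<times> UNIV" for p using fin that by (auto simp: BB_def)
      show "0 \<le> w s p" for p by (simp add: w_def)
    qed (use disjB zw in auto)
    also have "\<dots> \<longleftrightarrow> (G s has_sum S) ?I"
    proof (rule nonneg_has_sum_Sigma_iff)
      fix t assume t: "t \<in> ?I"
      have "real (card (BB (t, r))) * w s (t, r) = real (level_dim q l (n t) r) * q ^ (2 * r) *
         (q powr (- real (rho_weight l (n t))) * ((lam t)\<^sup>2 + 1) powr (- s / 2))" for r
        using q by (simp add: BB_def card[OF t] w_def powr_diff powr_minus_divide powr_realpow[symmetric])
      moreover have "(\<lambda>r. real (level_dim q l (n t) r) * q ^ (2 * r) *
         (q powr (- real (rho_weight l (n t))) * ((lam t)\<^sup>2 + 1) powr (- s / 2))) sums G s t"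
        unfolding G_def T_def mult.assoc[of _ "q powr _"]
        by (intro sums_mult2 summable_sums smT t)
      ultimately have "(\<lambda>r. real (card (BB (t, r))) * w s (t, r)) sums G s t" by simp
      then show "((\<lambda>r. real (card (BB (t, r))) * w s (t, r)) has_sum G s t) UNIV"
        by (rule sums_nonneg_imp_has_sum) (simp add: w_def)
    qed (simp add: w_def)
    finally show ?thesis .
  qed
  have bijI: "bij_betw (\<lambda>p. (fst (fst p), snd (fst p), snd p)) (Fam \<times> UNIV) ?I"
    by (rule bij_betwI[where g = "\<lambda>(k, j, m). ((k, j), m)"]) (auto simp: Fam_I)
  \<comment> \<open>The contribution \<open>G\<close> with the exponent split into a part constant
    along the family and \<open>2 * l * m\<close>, in the shape required by
    \<open>family_asymptotics\<close> with \<open>w = 2 * l\<close>.\<close>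
  define g where "g kj m s = (T (fst kj, snd kj, m) * q powr (- c0 kj)) * q powr (- (2 * real l) * real m) *
     ((lam (fst kj, snd kj, m))\<^sup>2 + 1) powr (- s / 2)" for kj m s
  have Gg: "G s (k, j, m) = g (k, j) m s" for s k j m
  proof -
    have "real (rho_weight l (n (k, j, m))) = c0 (k, j) + 2 * real l * real m"
      unfolding n_def prod.case c0_def fst_conv snd_conv rho_weight_summand_weight[OF l, of k j _ _ m] by simp
    then have "q powr (- real (rho_weight l (n (k, j, m)))) = q powr (- c0 (k, j)) * q powr (- (2 * real l) * real m)"
      by (simp add: powr_add[symmetric])
    then show ?thesis by (simp add: G_def g_def)
  qed
  have fam: "(\<forall>s > 2 * real l. summable (\<lambda>m. g kj m s)) \<and>
      (\<exists>L > 0. ((\<lambda>s. (s - 2 * real l) * (\<Sum>m. g kj m s)) \<longlongrightarrow> L) (at_right (2 * real l))) \<and>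
      (\<forall>s \<le> 2 * real l. \<not> summable (\<lambda>m. g kj m s))" if kj: "kj \<in> Fam" for kj
  proof -
    obtain k j where kj': "kj = (k, j)" by (cases kj)
    have I: "(k, j, m) \<in> ?I" for m using kj kj' by (simp add: Fam_I)
    obtain \<tau> where \<tau>: "\<tau> > 0" "(\<lambda>m. T (k, j, m)) \<longlonglongrightarrow> \<tau>"
      using series kj kj' by blast
    then have A: "(\<lambda>m. T (k, j, m) * q powr (- c0 (k, j))) \<longlonglongrightarrow> \<tau> * q powr (- c0 (k, j))"
      by (intro tendsto_intros)
    have A0: "\<tau> * q powr (- c0 (k, j)) > 0" using \<tau> q by simp
    obtain C where C: "C \<noteq> 0" "(\<lambda>m. lam (k, j, m) * q ^ m) \<longlonglongrightarrow> C" using lim[OF I] by blast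
    show ?thesis
      unfolding g_def kj' fst_conv snd_conv
      by (intro conjI allI impI family_asymptotics[OF q A A0 C(2,1)])
  qed
  have g0: "g kj m s \<ge> 0" if "kj \<in> Fam" for kj m s
    using G0[of "(fst kj, snd kj, m)" s] that Gg[of s "fst kj" "snd kj" m] by (simp add: Fam_I)
  have hs: "(z s has_sum (\<Sum>kj\<in>Fam. \<Sum>m. g kj m s)) B" if s: "s > 2 * real l" for s
  proof -
    have "((\<lambda>p. g (fst p) (snd p) s) has_sum (\<Sum>kj\<in>Fam. \<Sum>m. g kj m s)) (Fam \<times> UNIV)"
    proof (subst nonneg_has_sum_Sigma_iff)
      fix kj assume kj: "kj \<in> Fam"
      have "(\<lambda>m. g kj m s) sums (\<Sum>m. g kj m s)" using fam[OF kj] s by (intro summable_sums) auto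
      then show "((\<lambda>m. g (fst (kj, m)) (snd (kj, m)) s) has_sum (\<Sum>m. g kj m s)) UNIV"
        unfolding fst_conv snd_conv by (rule sums_nonneg_imp_has_sum) (rule g0[OF kj])
    qed (use g0 has_sum_finite[OF finFam] in auto)
    then have "((\<lambda>p. G s (fst (fst p), snd (fst p), snd p)) has_sum (\<Sum>kj\<in>Fam. \<Sum>m. g kj m s)) (Fam \<times> UNIV)"
      by (simp add: Gg)
    then show ?thesis unfolding hsB using has_sum_reindex_bij_betw[OF bijI, of "G s"] by blast
  qed
  \<comment> \<open>All terms are non-negative, so it is enough that the single family in degree
    \<open>0\<close> diverges.\<close>
  have nsm: "\<not> z s summable_on B" if s: "s \<le> 2 * real l" for s
  proof
    assume "z s summable_on B"
    then have "G s summable_on ?I" unfolding summable_on_def hsB .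
    then have "G s summable_on range (\<lambda>m. (0, 0, m))"
      by (rule summable_on_subset_banach) (use Fam0 in \<open>auto simp: Fam_I\<close>)
    then have "(\<lambda>m. G s (0, 0, m)) summable_on UNIV"
      by (subst (asm) summable_on_reindex) (auto simp: inj_on_def o_def)
    then have "summable (\<lambda>m. g (0, 0) m s)"
      unfolding Gg by (rule summable_on_imp_summable)
    then show False using fam[OF Fam0] s by blast
  qed
  have l0: "0 \<le> 2 * real l" by simp
  have tc: "trace_class (zeta_operator ((K2rho_operator l ?X)\<inverse>) ?D s)"
    and pt: "positive_trace (zeta_operator ((K2rho_operator l ?X)\<inverse>) ?D s) < \<infinity>"
    and tr: "op_trace (zeta_operator ((K2rho_operator l ?X)\<inverse>) ?D s) = of_real (\<Sum>kj\<in>Fam. \<Sum>m. g kj m s)"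
    if s: "s > 2 * real l" for s
  proof -
    have s0: "s > 0" using s l0 by linarith
    have sm: "z s summable_on B" using hs[OF s] by (rule has_sum_imp_summable)
    show "trace_class (zeta_operator ((K2rho_operator l ?X)\<inverse>) ?D s)"
      unfolding zeta[OF s0] by (rule trace_class_diag_op[OF onb z0 sm])
    show "positive_trace (zeta_operator ((K2rho_operator l ?X)\<inverse>) ?D s) < \<infinity>"
      unfolding zeta[OF s0] by (rule positive_trace_diag_op[OF onb z0 sm])
    show "op_trace (zeta_operator ((K2rho_operator l ?X)\<inverse>) ?D s) = of_real (\<Sum>kj\<in>Fam. \<Sum>m. g kj m s)"
      unfolding zeta[OF s0] op_trace_diag_op[OF onb z0 sm] infsumI[OF hs[OF s]] ..
  qed
  \<comment> \<open>The trace is infinite at \<open>2l\<close> itself, so the admissible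
    \<open>s\<close> form an open half-line whose infimum is not attained.\<close>
  have "{s. 0 < s \<and> positive_trace (zeta_operator ((K2rho_operator l ?X)\<inverse>) ?D s) < \<infinity>} = {2 * real l<..}"
  proof (intro equalityI subsetI)
    fix s assume s: "s \<in> {s. 0 < s \<and> positive_trace (zeta_operator ((K2rho_operator l ?X)\<inverse>) ?D s) < \<infinity>}"
    then have "positive_trace (diag_op B (z s)) < \<infinity>" using zeta[of s] by simp
    then have "z s summable_on B" by (rule positive_trace_diag_op_finiteD[OF onb z0])
    then show "s \<in> {2 * real l<..}" using nsm[of s] by (auto simp: not_le[symmetric])
  next
    fix s assume "s \<in> {2 * real l<..}"
    then show "s \<in> {s. 0 < s \<and> positive_trace (zeta_operator ((K2rho_operator l ?X)\<inverse>) ?D s) < \<infinity>}"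
      using pt[of s] l0 by auto
  qed
  then have dim: "modular_spectral_dimension ((K2rho_operator l ?X)\<inverse>) ?D = 2 * real l"
    unfolding modular_spectral_dimension_def by simp
  have "\<forall>kj\<in>Fam. \<exists>L. L > 0 \<and> ((\<lambda>s. (s - 2 * real l) * (\<Sum>m. g kj m s)) \<longlongrightarrow> L) (at_right (2 * real l))"
    using fam by blast
  from bchoice[OF this] obtain L where L: "\<And>kj. kj \<in> Fam \<Longrightarrow> L kj > 0"
    "\<And>kj. kj \<in> Fam \<Longrightarrow> ((\<lambda>s. (s - 2 * real l) * (\<Sum>m. g kj m s)) \<longlongrightarrow> L kj) (at_right (2 * real l))"
    by blast
  have "((\<lambda>s. \<Sum>kj\<in>Fam. (s - 2 * real l) * (\<Sum>m. g kj m s)) \<longlongrightarrow> (\<Sum>kj\<in>Fam. L kj)) (at_right (2 * real l))"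
    by (intro tendsto_sum L)
  then have "((\<lambda>s. complex_of_real (\<Sum>kj\<in>Fam. (s - 2 * real l) * (\<Sum>m. g kj m s))) \<longlongrightarrow>
      complex_of_real (\<Sum>kj\<in>Fam. L kj)) (at_right (2 * real l))"
    by (rule tendsto_of_real)
  moreover have "\<forall>\<^sub>F s in at_right (2 * real l). complex_of_real (\<Sum>kj\<in>Fam. (s - 2 * real l) * (\<Sum>m. g kj m s)) =
      of_real (s - 2 * real l) * op_trace (zeta_operator ((K2rho_operator l ?X)\<inverse>) ?D s)"
    using eventually_at_right_less[of "2 * real l"]
    by eventually_elim (simp add: tr sum_distrib_left)
  ultimately have "((\<lambda>s. of_real (s - 2 * real l) * op_trace (zeta_operator ((K2rho_operator l ?X)\<inverse>) ?D s))
      \<longlongrightarrow> complex_of_real (\<Sum>kj\<in>Fam. L kj)) (at_right (2 * real l))"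
    by (rule Lim_transform_eventually)
  \<comment> \<open>Each family has a positive limit, so no cancellation between families can
    occur.\<close>
  moreover have "(\<Sum>kj\<in>Fam. L kj) > 0" using L(1) finFam Fam0 by (intro sum_pos) auto
  then have "complex_of_real (\<Sum>kj\<in>Fam. L kj) \<noteq> 0" by (simp only: of_real_eq_0_iff)
  ultimately show ?thesis using tc dim by blast
qed

end
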